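(* Let $\Lambda$ be a row-finite, strongly connected $k$-graph and let $x\in\Lambda^\infty$. Then the operators $\{T_\lambda\}_{\lambda\in\Lambda}$ on the Hilbert space $\mathcal H_x$ given by $$T_\lambda[\xi^i_\mu]=\begin{cases}[\xi^i_{\lambda\mu}],& s(\lambda)=r(\mu),\\ 0,&\text{else,}\end{cases}$$ define a faithful separable representation $\pi_x$ of $C^*(\Lambda)$ on $\mathcal H_x$, with $\pi_x(t_\lambda)=T_\lambda$. (The Hilbert space $\mathcal H_x$ and the vectors $[\xi^i_\mu]$ are defined in the context.)
   Context: $\mathbb N=\{0,1,2,\dots\}$. A $k$-graph is a countable small category $\Lambda$ with a degree functor $d:\Lambda\to\mathbb N^k$ such that if $d(\lambda)=m+n$ there are unique $\mu,\nu$ with $\lambda=\mu\nu$, $d(\mu)=m$, $d(\nu)=n$. $\Lambda^n=d^{-1}(n)$; $\Lambda^0$ is the set of objects (vertices, identified with identity morphisms); $r,s$ are range and source; $v\Lambda^n=\{\lambda\in\Lambda^n:r(\lambda)=v\}$; $\Lambda v=\{\lambda:s(\lambda)=v\}$. $\Lambda$ is row-finite if $|v\Lambda^n|<\infty$ for all $v,n$; strongly connected if for all $v,w\in\Lambda^0$ there is $\lambda\in\Lambda$ with $r(\lambda)=v$, $s(\lambda)=w$. $\Lambda^\infty$ is the set of infinite paths: degree-preserving functors $x:\Omega_k\to\Lambda$, where $\Omega_k$ is the $k$-graph with objects $\mathbb N^k$, morphisms $\{(p,q):p\le q\}$, $r(p,q)=p$, $s(p,q)=q$, $d(p,q)=q-p$.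 $C^*(\Lambda)$ is the universal $C^*$-algebra generated by partial isometries $\{t_\lambda\}_{\lambda\in\Lambda}$ with: $t_v$ ($v\in\Lambda^0$) mutually orthogonal projections; $t_\lambda t_\eta=t_{\lambda\eta}$ if $s(\lambda)=r(\eta)$; $t_\lambda^*t_\lambda=t_{s(\lambda)}$; $t_v=\sum_{\lambda\in v\Lambda^n}t_\lambda t_\lambda^*$ for all $v\in\Lambda^0$, $n\in\mathbb N^k$. A separable representation is one on a separable Hilbert space. Construction of $\mathcal H_x$: write $x=x_1x_2x_3\cdots$ with $d(x_i)=(1,\dots,1)$ for all $i$, and $v_i=r(x_i)$. Let $F_i=\Lambda v_i$, let $\{\xi^i_\lambda:\lambda\in F_i\}$ be the standard orthonormal basis of $\ell^2(F_i)$, and let $\rho_i:\ell^2(F_i)\to\ell^2(F_{i+1})$ be the isometry with $\rho_i(\xi^i_\lambda)=\xi^{i+1}_{\lambda x_i}$. $\mathcal H_x=\varinjlim(\ell^2(F_i),\rho_i)$ is the inductive limit Hilbert space, and $[\xi^i_\lambda]$ is the image of $\xi^i_\lambda$ in $\mathcal H_x$; thus, for $i\le j$, $[\xi^i_\lambda]=[\xi^j_\mu]$ iff $\mu=\lambda x_ix_{i+1}\cdots x_{j-1}$. *)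

theory Defs
  imports "HOL-Analysis.Analysis" "HOL-Library.Function_Algebras"
begin

section \<open>Higher-rank graphs\<close>

text \<open>
  The monoid \<open>\<nat>\<^sup>k\<close> is the set of functions \<open>nat \<Rightarrow> nat\<close> that vanish from index \<open>k\<close> on;
  addition, truncated subtraction and order are the pointwise ones.
\<close>

definition Nk :: "nat \<Rightarrow> (nat \<Rightarrow> nat) set" where
  "Nk k = {n. \<forall>i\<ge>k. n i = 0}"

definition diag :: "nat \<Rightarrow> nat \<Rightarrow> nat \<Rightarrow> nat" where
  "diag k i = (\<lambda>j. if j < k then i else 0)"

text \<open>
  Categories are single-sorted: an object is identified with its identity morphism, so range
  and source are maps from morphisms to (identity) morphisms. The product \<open>cmp \<Lambda> \<alpha> \<mu>\<close>
  is meaningful when \<open>sc \<Lambda> \<alpha> = rg \<Lambda> \<mu>\<close>.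
\<close>

record 'm kgraph =
  Mor :: "'m set"
  rg :: "'m \<Rightarrow> 'm"
  sc :: "'m \<Rightarrow> 'm"
  cmp :: "'m \<Rightarrow> 'm \<Rightarrow> 'm"
  deg :: "'m \<Rightarrow> nat \<Rightarrow> nat"

definition small_category :: "'m kgraph \<Rightarrow> bool" where
  "small_category \<Lambda> \<longleftrightarrow>
     (\<forall>\<alpha>\<in>Mor \<Lambda>. rg \<Lambda> \<alpha> \<in> Mor \<Lambda> \<and> sc \<Lambda> \<alpha> \<in> Mor \<Lambda>
        \<and> rg \<Lambda> (rg \<Lambda> \<alpha>) = rg \<Lambda> \<alpha> \<and> sc \<Lambda> (rg \<Lambda> \<alpha>) = rg \<Lambda> \<alpha>
        \<and> rg \<Lambda> (sc \<Lambda> \<alpha>) = sc \<Lambda> \<alpha> \<and> sc \<Lambda> (sc \<Lambda> \<alpha>) = sc \<Lambda> \<alpha>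
        \<and> cmp \<Lambda> (rg \<Lambda> \<alpha>) \<alpha> = \<alpha> \<and> cmp \<Lambda> \<alpha> (sc \<Lambda> \<alpha>) = \<alpha>) \<and>
     (\<forall>\<alpha>\<in>Mor \<Lambda>. \<forall>\<mu>\<in>Mor \<Lambda>. sc \<Lambda> \<alpha> = rg \<Lambda> \<mu> \<longrightarrow>
        cmp \<Lambda> \<alpha> \<mu> \<in> Mor \<Lambda> \<and> rg \<Lambda> (cmp \<Lambda> \<alpha> \<mu>) = rg \<Lambda> \<alpha> \<and> sc \<Lambda> (cmp \<Lambda> \<alpha> \<mu>) = sc \<Lambda> \<mu>) \<and>
     (\<forall>\<alpha>\<in>Mor \<Lambda>. \<forall>\<mu>\<in>Mor \<Lambda>. \<forall>\<nu>\<in>Mor \<Lambda>. sc \<Lambda> \<alpha> = rg \<Lambda> \<mu> \<longrightarrow> sc \<Lambda> \<mu> = rg \<Lambda> \<nu> \<longrightarrow>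
        cmp \<Lambda> (cmp \<Lambda> \<alpha> \<mu>) \<nu> = cmp \<Lambda> \<alpha> (cmp \<Lambda> \<mu> \<nu>))"

definition degree_functor :: "nat \<Rightarrow> 'm kgraph \<Rightarrow> bool" where
  "degree_functor k \<Lambda> \<longleftrightarrow>
     (\<forall>\<alpha>\<in>Mor \<Lambda>. deg \<Lambda> \<alpha> \<in> Nk k \<and> deg \<Lambda> (rg \<Lambda> \<alpha>) = 0 \<and> deg \<Lambda> (sc \<Lambda> \<alpha>) = 0) \<and>
     (\<forall>\<alpha>\<in>Mor \<Lambda>. \<forall>\<mu>\<in>Mor \<Lambda>. sc \<Lambda> \<alpha> = rg \<Lambda> \<mu> \<longrightarrow>
        deg \<Lambda> (cmp \<Lambda> \<alpha> \<mu>) = deg \<Lambda> \<alpha> + deg \<Lambda> \<mu>)"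

definition unique_factorization :: "nat \<Rightarrow> 'm kgraph \<Rightarrow> bool" where
  "unique_factorization k \<Lambda> \<longleftrightarrow>
     (\<forall>\<alpha>\<in>Mor \<Lambda>. \<forall>m\<in>Nk k. \<forall>n\<in>Nk k. deg \<Lambda> \<alpha> = m + n \<longrightarrow>
        (\<exists>!(\<mu>, \<nu>). \<mu> \<in> Mor \<Lambda> \<and> \<nu> \<in> Mor \<Lambda> \<and> sc \<Lambda> \<mu> = rg \<Lambda> \<nu> \<and> cmp \<Lambda> \<mu> \<nu> = \<alpha>
           \<and> deg \<Lambda> \<mu> = m \<and> deg \<Lambda> \<nu> = n))"

definition higher_rank_graph :: "nat \<Rightarrow> 'm kgraph \<Rightarrow> bool" where
  "higher_rank_graph k \<Lambda> \<longleftrightarrow>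
     countable (Mor \<Lambda>) \<and> small_category \<Lambda> \<and> degree_functor k \<Lambda> \<and> unique_factorization k \<Lambda>"

definition paths :: "'m kgraph \<Rightarrow> (nat \<Rightarrow> nat) \<Rightarrow> 'm set" where
  "paths \<Lambda> n = {\<alpha>\<in>Mor \<Lambda>. deg \<Lambda> \<alpha> = n}"

definition paths_to :: "'m kgraph \<Rightarrow> 'm \<Rightarrow> (nat \<Rightarrow> nat) \<Rightarrow> 'm set" where
  "paths_to \<Lambda> v n = {\<alpha>\<in>paths \<Lambda> n. rg \<Lambda> \<alpha> = v}"

abbreviation vertices :: "'m kgraph \<Rightarrow> 'm set" where
  "vertices \<Lambda> \<equiv> paths \<Lambda> 0"

lemma vertices_eq_identities:
  assumes "higher_rank_graph k \<Lambda>"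
  shows "vertices \<Lambda> = {v\<in>Mor \<Lambda>. rg \<Lambda> v = v}"
proof (intro set_eqI iffI)
  have cat: "small_category \<Lambda>" and df: "degree_functor k \<Lambda>" and uf: "unique_factorization k \<Lambda>"
    using assms by (auto simp: higher_rank_graph_def)
  fix v
  show "v \<in> {v\<in>Mor \<Lambda>. rg \<Lambda> v = v}" if "v \<in> vertices \<Lambda>"
  proof -
    have v: "v \<in> Mor \<Lambda>" "deg \<Lambda> v = 0 + 0" using that by (auto simp: paths_def)
    have "(0 :: nat \<Rightarrow> nat) \<in> Nk k" by (simp add: Nk_def)
    then have ex: "\<exists>!(\<mu>, \<nu>). \<mu> \<in> Mor \<Lambda> \<and> \<nu> \<in> Mor \<Lambda> \<and> sc \<Lambda> \<mu> = rg \<Lambda> \<nu> \<and> cmp \<Lambda> \<mu> \<nu> = v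
           \<and> deg \<Lambda> \<mu> = 0 \<and> deg \<Lambda> \<nu> = 0"
      using uf v unfolding unique_factorization_def by blast
    have c: "rg \<Lambda> v \<in> Mor \<Lambda>" "sc \<Lambda> v \<in> Mor \<Lambda>" "sc \<Lambda> (rg \<Lambda> v) = rg \<Lambda> v" "rg \<Lambda> (sc \<Lambda> v) = sc \<Lambda> v"
        "cmp \<Lambda> (rg \<Lambda> v) v = v" "cmp \<Lambda> v (sc \<Lambda> v) = v"
        "deg \<Lambda> (rg \<Lambda> v) = 0" "deg \<Lambda> (sc \<Lambda> v) = 0"
      using cat df v(1) unfolding small_category_def degree_functor_def by blast+
    have "(rg \<Lambda> v, v) = (v, sc \<Lambda> v)"
      by (rule ex1E[OF ex], rule trans[OF _ sym])
         (use c v in \<open>auto split: prod.splits\<close>)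
    then show ?thesis using v by simp
  qed
  show "v \<in> vertices \<Lambda>" if "v \<in> {v\<in>Mor \<Lambda>. rg \<Lambda> v = v}"
  proof -
    have "v \<in> Mor \<Lambda>" "rg \<Lambda> v = v" using that by auto
    moreover have "deg \<Lambda> (rg \<Lambda> v) = 0" using df calculation(1) unfolding degree_functor_def by blast
    ultimately show ?thesis by (simp add: paths_def)
  qed
qed

definition row_finite :: "nat \<Rightarrow> 'm kgraph \<Rightarrow> bool" where
  "row_finite k \<Lambda> \<longleftrightarrow> (\<forall>v\<in>vertices \<Lambda>. \<forall>n\<in>Nk k. finite (paths_to \<Lambda> v n))"

definition strongly_connected :: "'m kgraph \<Rightarrow> bool" where
  "strongly_connected \<Lambda> \<longleftrightarrow>
     (\<forall>v\<in>vertices \<Lambda>. \<forall>w\<in>vertices \<Lambda>. \<exists>\<alpha>\<in>Mor \<Lambda>. rg \<Lambda> \<alpha> = v \<and> sc \<Lambda> \<alpha> = w)"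

definition Omega :: "nat \<Rightarrow> ((nat \<Rightarrow> nat) \<times> (nat \<Rightarrow> nat)) kgraph" where
  "Omega k = \<lparr> Mor = {(p, q). p \<in> Nk k \<and> q \<in> Nk k \<and> p \<le> q},
               rg = (\<lambda>(p, q). (p, p)),
               sc = (\<lambda>(p, q). (q, q)),
               cmp = (\<lambda>(p, q) (p', q'). (p, q')),
               deg = (\<lambda>(p, q). q - p) \<rparr>"

definition degree_preserving_functor :: "'a kgraph \<Rightarrow> 'm kgraph \<Rightarrow> ('a \<Rightarrow> 'm) \<Rightarrow> bool" where
  "degree_preserving_functor \<Gamma> \<Lambda> f \<longleftrightarrow>
     (\<forall>a\<in>Mor \<Gamma>. f a \<in> Mor \<Lambda> \<and> f (rg \<Gamma> a) = rg \<Lambda> (f a) \<and> f (sc \<Gamma> a) = sc \<Lambda> (f a)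
        \<and> deg \<Lambda> (f a) = deg \<Gamma> a) \<and>
     (\<forall>a\<in>Mor \<Gamma>. \<forall>b\<in>Mor \<Gamma>. sc \<Gamma> a = rg \<Gamma> b \<longrightarrow> f (cmp \<Gamma> a b) = cmp \<Lambda> (f a) (f b))"

definition infinite_paths :: "nat \<Rightarrow> 'm kgraph \<Rightarrow> ((nat \<Rightarrow> nat) \<times> (nat \<Rightarrow> nat) \<Rightarrow> 'm) set" where
  "infinite_paths k \<Lambda> = {x. degree_preserving_functor (Omega k) \<Lambda> x}"


section \<open>Vector spaces, algebras and Hilbert spaces with explicit carriers\<close>

text \<open>
  The spaces needed here depend on the graph and the path, hence the carriers.
  The operations are only meaningful on the carrier.
\<close>

record 'a vs =
  car :: "'a set"
  add :: "'a \<Rightarrow> 'a \<Rightarrow> 'a"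
  zer :: "'a"
  scl :: "complex \<Rightarrow> 'a \<Rightarrow> 'a"

record 'a star_alg = "'a vs" +
  mul :: "'a \<Rightarrow> 'a \<Rightarrow> 'a"
  star :: "'a \<Rightarrow> 'a"

record 'a normed_star_alg = "'a star_alg" +
  nrm :: "'a \<Rightarrow> real"

record 'a ip_space = "'a vs" +
  ip :: "'a \<Rightarrow> 'a \<Rightarrow> complex"

definition vdiff :: "('a, 'z) vs_scheme \<Rightarrow> 'a \<Rightarrow> 'a \<Rightarrow> 'a" where
  "vdiff V a b = add V a (scl V (- 1) b)"

definition ip_norm :: "('a, 'z) ip_space_scheme \<Rightarrow> 'a \<Rightarrow> real" where
  "ip_norm H a = sqrt (Re (ip H a a))"


subsection \<open>Hausdorff completion with respect to a seminorm\<close>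

text \<open>
  Elements of the completion are classes of Cauchy sequences modulo sequences tending to
  \<open>0\<close> in seminorm; in particular vectors at seminorm distance \<open>0\<close> are identified.
\<close>

definition cauchy_seqs :: "('a, 'z) vs_scheme \<Rightarrow> ('a \<Rightarrow> real) \<Rightarrow> (nat \<Rightarrow> 'a) set" where
  "cauchy_seqs V p = {f. (\<forall>n. f n \<in> car V) \<and>
     (\<forall>e>0. \<exists>N. \<forall>m\<ge>N. \<forall>n\<ge>N. p (vdiff V (f m) (f n)) < e)}"

definition cauchy_class ::
  "('a, 'z) vs_scheme \<Rightarrow> ('a \<Rightarrow> real) \<Rightarrow> (nat \<Rightarrow> 'a) \<Rightarrow> (nat \<Rightarrow> 'a) set" where
  "cauchy_class V p f = {g \<in> cauchy_seqs V p. (\<lambda>n. p (vdiff V (f n) (g n))) \<longlonglongrightarrow> 0}"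

definition rep :: "(nat \<Rightarrow> 'a) set \<Rightarrow> nat \<Rightarrow> 'a" where
  "rep X = (SOME f. f \<in> X)"

definition star_completion ::
  "('a, 'z) star_alg_scheme \<Rightarrow> ('a \<Rightarrow> real) \<Rightarrow> (nat \<Rightarrow> 'a) set normed_star_alg" where
  "star_completion A p =
     \<lparr> car = cauchy_class A p ` cauchy_seqs A p,
       add = (\<lambda>X Y. cauchy_class A p (\<lambda>n. add A (rep X n) (rep Y n))),
       zer = cauchy_class A p (\<lambda>_. zer A),
       scl = (\<lambda>c X. cauchy_class A p (\<lambda>n. scl A c (rep X n))),
       mul = (\<lambda>X Y. cauchy_class A p (\<lambda>n. mul A (rep X n) (rep Y n))),
       star = (\<lambda>X. cauchy_class A p (\<lambda>n. star A (rep X n))),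
       nrm = (\<lambda>X. lim (\<lambda>n. p (rep X n))) \<rparr>"

definition hilbert_completion :: "('a, 'z) ip_space_scheme \<Rightarrow> (nat \<Rightarrow> 'a) set ip_space" where
  "hilbert_completion H =
     (let p = ip_norm H in
     \<lparr> car = cauchy_class H p ` cauchy_seqs H p,
       add = (\<lambda>X Y. cauchy_class H p (\<lambda>n. add H (rep X n) (rep Y n))),
       zer = cauchy_class H p (\<lambda>_. zer H),
       scl = (\<lambda>c X. cauchy_class H p (\<lambda>n. scl H c (rep X n))),
       ip = (\<lambda>X Y. lim (\<lambda>n. ip H (rep X n) (rep Y n))) \<rparr>)"


subsection \<open>Operators and representations\<close>

text \<open>
  Operators are extensional (\<open>undefined\<close> off the carrier of \<open>H\<close>), so that equality of
  operators is equality in HOL.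
\<close>

definition bounded_ops :: "('h, 'z) ip_space_scheme \<Rightarrow> ('h \<Rightarrow> 'h) star_alg" where
  "bounded_ops H =
     (let B = {T. T \<in> extensional (car H) \<and> T \<in> car H \<rightarrow> car H \<and>
                  (\<forall>x\<in>car H. \<forall>y\<in>car H. T (add H x y) = add H (T x) (T y)) \<and>
                  (\<forall>c. \<forall>x\<in>car H. T (scl H c x) = scl H c (T x)) \<and>
                  (\<exists>C. \<forall>x\<in>car H. ip_norm H (T x) \<le> C * ip_norm H x)}
      in \<lparr> car = B,
           add = (\<lambda>S T. \<lambda>x\<in>car H. add H (S x) (T x)),
           zer = (\<lambda>x\<in>car H. zer H),
           scl = (\<lambda>c T. \<lambda>x\<in>car H. scl H c (T x)),
           mul = (\<lambda>S T. \<lambda>x\<in>car H. S (T x)),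
           star = (\<lambda>T. THE S. S \<in> B \<and> (\<forall>x\<in>car H. \<forall>y\<in>car H. ip H (T x) y = ip H x (S y))) \<rparr>)"

definition star_hom ::
  "('a, 'y) star_alg_scheme \<Rightarrow> ('b, 'z) star_alg_scheme \<Rightarrow> ('a \<Rightarrow> 'b) \<Rightarrow> bool" where
  "star_hom A B \<phi> \<longleftrightarrow>
     \<phi> \<in> car A \<rightarrow> car B \<and>
     (\<forall>a\<in>car A. \<forall>b\<in>car A. \<phi> (add A a b) = add B (\<phi> a) (\<phi> b)) \<and>
     (\<forall>c. \<forall>a\<in>car A. \<phi> (scl A c a) = scl B c (\<phi> a)) \<and>
     (\<forall>a\<in>car A. \<forall>b\<in>car A. \<phi> (mul A a b) = mul B (\<phi> a) (\<phi> b)) \<and>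
     (\<forall>a\<in>car A. \<phi> (star A a) = star B (\<phi> a))"

definition representation ::
  "('a, 'y) star_alg_scheme \<Rightarrow> ('h, 'z) ip_space_scheme \<Rightarrow> ('a \<Rightarrow> 'h \<Rightarrow> 'h) \<Rightarrow> bool" where
  "representation A H \<pi> \<longleftrightarrow> star_hom A (bounded_ops H) \<pi>"

definition faithful :: "('a, 'y) star_alg_scheme \<Rightarrow> ('a \<Rightarrow> 'h \<Rightarrow> 'h) \<Rightarrow> bool" where
  "faithful A \<pi> \<longleftrightarrow> inj_on \<pi> (car A)"

definition separable :: "('h, 'z) ip_space_scheme \<Rightarrow> bool" where
  "separable H \<longleftrightarrow>
     (\<exists>D\<subseteq>car H. countable D \<and> (\<forall>x\<in>car H. \<forall>e>0. \<exists>y\<in>D. ip_norm H (vdiff H x y) < e))"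


section \<open>Universal \<open>C\<^sup>*\<close>-algebras\<close>

text \<open>
  The free (non-unital) \<open>*\<close>-algebra on a set \<open>G\<close>: finitely supported functions on nonempty
  words, where the letter \<open>(g, False)\<close> stands for \<open>g\<close> and \<open>(g, True)\<close> for \<open>g\<^sup>*\<close>.
  Sums and differences of elements are the pointwise ones.
\<close>

type_synonym 'g free = "('g \<times> bool) list \<Rightarrow> complex"

definition fgen :: "'g \<Rightarrow> 'g free" where
  "fgen g = (\<lambda>w. if w = [(g, False)] then 1 else 0)"

definition fmul :: "'g free \<Rightarrow> 'g free \<Rightarrow> 'g free" where
  "fmul a b = (\<lambda>w. \<Sum>i\<le>length w. a (take i w) * b (drop i w))"

definition fstar :: "'g free \<Rightarrow> 'g free" where
  "fstar a = (\<lambda>w. cnj (a (rev (map (\<lambda>(g, e). (g, \<not> e)) w))))"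

definition free_star_alg :: "'g set \<Rightarrow> 'g free star_alg" where
  "free_star_alg G =
     \<lparr> car = {a. finite {w. a w \<noteq> 0} \<and> (\<forall>w. a w \<noteq> 0 \<longrightarrow> w \<noteq> [] \<and> fst ` set w \<subseteq> G)},
       add = (\<lambda>a b. a + b),
       zer = 0,
       scl = (\<lambda>c a w. c * a w),
       mul = fmul,
       star = fstar \<rparr>"

definition cstar_seminorm :: "('a, 'z) star_alg_scheme \<Rightarrow> ('a \<Rightarrow> real) \<Rightarrow> bool" where
  "cstar_seminorm A p \<longleftrightarrow>
     (\<forall>a\<in>car A. 0 \<le> p a) \<and>
     (\<forall>a\<in>car A. \<forall>b\<in>car A. p (add A a b) \<le> p a + p b) \<and>
     (\<forall>c. \<forall>a\<in>car A. p (scl A c a) = cmod c * p a) \<and>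
     (\<forall>a\<in>car A. \<forall>b\<in>car A. p (mul A a b) \<le> p a * p b) \<and>
     (\<forall>a\<in>car A. p (star A a) = p a) \<and>
     (\<forall>a\<in>car A. p (mul A (star A a) a) = (p a)\<^sup>2)"

text \<open>
  Relations are pairs (left-hand side, right-hand side) in the free \<open>*\<close>-algebra. The
  \<open>C\<^sup>*\<close>-seminorms \<open>p\<close> that vanish on them are exactly the functions \<open>a \<mapsto> \<parallel>\<phi> a\<parallel>\<close> for
  \<open>*\<close>-homomorphisms \<open>\<phi>\<close> into \<open>C\<^sup>*\<close>-algebras that respect the relations, so the largest one
  is the universal norm. Using seminorms avoids quantifying over all \<open>C\<^sup>*\<close>-algebras, of all
  types. The supremum is meaningful only if these seminorms are bounded on each generator;
  below they are, by \<open>1\<close>, the generators being partial isometries.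
\<close>

definition universal_seminorm :: "'g set \<Rightarrow> ('g free \<times> 'g free) set \<Rightarrow> 'g free \<Rightarrow> real" where
  "universal_seminorm G R a =
     (SUP p \<in> {p. cstar_seminorm (free_star_alg G) p \<and> (\<forall>(b, c)\<in>R. p (b - c) = 0)}. p a)"

definition universal_cstar ::
  "'g set \<Rightarrow> ('g free \<times> 'g free) set \<Rightarrow> (nat \<Rightarrow> 'g free) set normed_star_alg" where
  "universal_cstar G R = star_completion (free_star_alg G) (universal_seminorm G R)"

definition universal_gen ::
  "'g set \<Rightarrow> ('g free \<times> 'g free) set \<Rightarrow> 'g \<Rightarrow> (nat \<Rightarrow> 'g free) set" where
  "universal_gen G R g = cauchy_class (free_star_alg G) (universal_seminorm G R) (\<lambda>_. fgen g)"


subsection \<open>The \<open>C\<^sup>*\<close>-algebra of a \<open>k\<close>-graph\<close>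

inductive_set ck_relations :: "nat \<Rightarrow> 'm kgraph \<Rightarrow> ('m free \<times> 'm free) set"
  for k :: nat and \<Lambda> :: "'m kgraph" where
  partial_isometry: "\<alpha> \<in> Mor \<Lambda> \<Longrightarrow>
    (fmul (fmul (fgen \<alpha>) (fstar (fgen \<alpha>))) (fgen \<alpha>), fgen \<alpha>) \<in> ck_relations k \<Lambda>"
| vertex_selfadjoint: "v \<in> vertices \<Lambda> \<Longrightarrow> (fstar (fgen v), fgen v) \<in> ck_relations k \<Lambda>"
| vertex_idempotent: "v \<in> vertices \<Lambda> \<Longrightarrow> (fmul (fgen v) (fgen v), fgen v) \<in> ck_relations k \<Lambda>"
| vertex_orthogonal: "v \<in> vertices \<Lambda> \<Longrightarrow> w \<in> vertices \<Lambda> \<Longrightarrow> v \<noteq> w \<Longrightarrow>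
    (fmul (fgen v) (fgen w), 0) \<in> ck_relations k \<Lambda>"
| product: "\<alpha> \<in> Mor \<Lambda> \<Longrightarrow> \<eta> \<in> Mor \<Lambda> \<Longrightarrow> sc \<Lambda> \<alpha> = rg \<Lambda> \<eta> \<Longrightarrow>
    (fmul (fgen \<alpha>) (fgen \<eta>), fgen (cmp \<Lambda> \<alpha> \<eta>)) \<in> ck_relations k \<Lambda>"
| source_projection: "\<alpha> \<in> Mor \<Lambda> \<Longrightarrow>
    (fmul (fstar (fgen \<alpha>)) (fgen \<alpha>), fgen (sc \<Lambda> \<alpha>)) \<in> ck_relations k \<Lambda>"
| range_sum: "v \<in> vertices \<Lambda> \<Longrightarrow> n \<in> Nk k \<Longrightarrow>
    (fgen v, \<Sum>\<alpha>\<in>paths_to \<Lambda> v n. fmul (fgen \<alpha>) (fstar (fgen \<alpha>))) \<in> ck_relations k \<Lambda>"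

definition kgraph_cstar :: "nat \<Rightarrow> 'm kgraph \<Rightarrow> (nat \<Rightarrow> 'm free) set normed_star_alg" where
  "kgraph_cstar k \<Lambda> = universal_cstar (Mor \<Lambda>) (ck_relations k \<Lambda>)"

definition kgraph_gen :: "nat \<Rightarrow> 'm kgraph \<Rightarrow> 'm \<Rightarrow> (nat \<Rightarrow> 'm free) set" where
  "kgraph_gen k \<Lambda> \<alpha> = universal_gen (Mor \<Lambda>) (ck_relations k \<Lambda>) \<alpha>"


section \<open>Inductive limits of Hilbert spaces\<close>

definition ell2 :: "'a set \<Rightarrow> ('a \<Rightarrow> complex) ip_space" where
  "ell2 F =
     \<lparr> car = {f. (\<forall>a. a \<notin> F \<longrightarrow> f a = 0) \<and> (\<lambda>a. (cmod (f a))\<^sup>2) summable_on F},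
       add = (\<lambda>f g. f + g),
       zer = 0,
       scl = (\<lambda>c f a. c * f a),
       ip = (\<lambda>f g. \<Sum>\<^sub>\<infinity>a\<in>F. f a * cnj (g a)) \<rparr>"

definition ell2_basis :: "'a \<Rightarrow> 'a \<Rightarrow> complex" where
  "ell2_basis b = (\<lambda>a. if a = b then 1 else 0)"

text \<open>
  The algebraic direct limit is represented by pairs \<open>(i, f)\<close> with \<open>f\<close> in the \<open>i\<close>-th space;
  two such pairs are compared, added and paired in the larger of the two stages. The
  identification of \<open>(i, f)\<close> with \<open>(i + 1, \<rho> i f)\<close> is left to the Hausdorff completion.
\<close>

definition push :: "(nat \<Rightarrow> 'a \<Rightarrow> 'a) \<Rightarrow> nat \<Rightarrow> nat \<Rightarrow> 'a \<Rightarrow> 'a" where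
  "push \<rho> i j f = fold \<rho> [i..<j] f"

definition direct_limit :: "(nat \<Rightarrow> 'a ip_space) \<Rightarrow> (nat \<Rightarrow> 'a \<Rightarrow> 'a) \<Rightarrow> (nat \<times> 'a) ip_space" where
  "direct_limit H \<rho> =
     \<lparr> car = (SIGMA i:UNIV. car (H i)),
       add = (\<lambda>(i, f) (j, g). let m = max i j in (m, add (H m) (push \<rho> i m f) (push \<rho> j m g))),
       zer = (0, zer (H 0)),
       scl = (\<lambda>c (i, f). (i, scl (H i) c f)),
       ip = (\<lambda>(i, f) (j, g). let m = max i j in ip (H m) (push \<rho> i m f) (push \<rho> j m g)) \<rparr>"

definition hilbert_limit ::
  "(nat \<Rightarrow> 'a ip_space) \<Rightarrow> (nat \<Rightarrow> 'a \<Rightarrow> 'a) \<Rightarrow> (nat \<Rightarrow> nat \<times> 'a) set ip_space" where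
  "hilbert_limit H \<rho> = hilbert_completion (direct_limit H \<rho>)"

definition limit_map ::
  "(nat \<Rightarrow> 'a ip_space) \<Rightarrow> (nat \<Rightarrow> 'a \<Rightarrow> 'a) \<Rightarrow> nat \<Rightarrow> 'a \<Rightarrow> (nat \<Rightarrow> nat \<times> 'a) set" where
  "limit_map H \<rho> i f = cauchy_class (direct_limit H \<rho>) (ip_norm (direct_limit H \<rho>)) (\<lambda>_. (i, f))"


subsection \<open>The Hilbert space of an infinite path\<close>

text \<open>
  Indices start at \<open>0\<close>: \<open>segment k x i\<close> is the usual \<open>x\<^sub>i\<^sub>+\<^sub>1\<close>, the \<open>(i+1)\<close>-st factor of degree
  \<open>(1,\<dots>,1)\<close> of \<open>x\<close>, and likewise for \<open>F\<^sub>i\<close>, \<open>\<rho>\<^sub>i\<close> and \<open>\<xi>\<^sup>i\<close>.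
\<close>

definition segment :: "nat \<Rightarrow> ((nat \<Rightarrow> nat) \<times> (nat \<Rightarrow> nat) \<Rightarrow> 'm) \<Rightarrow> nat \<Rightarrow> 'm" where
  "segment k x i = x (diag k i, diag k (Suc i))"

definition paths_into ::
  "nat \<Rightarrow> 'm kgraph \<Rightarrow> ((nat \<Rightarrow> nat) \<times> (nat \<Rightarrow> nat) \<Rightarrow> 'm) \<Rightarrow> nat \<Rightarrow> 'm set" where
  "paths_into k \<Lambda> x i = {\<alpha>\<in>Mor \<Lambda>. sc \<Lambda> \<alpha> = rg \<Lambda> (segment k x i)}"

text \<open>
  The isometry with \<open>\<xi>\<^sub>\<alpha> \<mapsto> \<xi>\<^bsub>\<alpha> x\<^sub>i\<^esub>\<close>. By unique factorization the sum has at most one term.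
\<close>

definition shift_isometry ::
  "nat \<Rightarrow> 'm kgraph \<Rightarrow> ((nat \<Rightarrow> nat) \<times> (nat \<Rightarrow> nat) \<Rightarrow> 'm) \<Rightarrow> nat \<Rightarrow> ('m \<Rightarrow> complex) \<Rightarrow> 'm \<Rightarrow> complex"
  where
  "shift_isometry k \<Lambda> x i f =
     (\<lambda>\<mu>. \<Sum>\<alpha> | \<alpha> \<in> paths_into k \<Lambda> x i \<and> cmp \<Lambda> \<alpha> (segment k x i) = \<mu>. f \<alpha>)"

definition path_space ::
  "nat \<Rightarrow> 'm kgraph \<Rightarrow> ((nat \<Rightarrow> nat) \<times> (nat \<Rightarrow> nat) \<Rightarrow> 'm) \<Rightarrow>
    (nat \<Rightarrow> nat \<times> ('m \<Rightarrow> complex)) set ip_space" where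
  "path_space k \<Lambda> x = hilbert_limit (\<lambda>i. ell2 (paths_into k \<Lambda> x i)) (shift_isometry k \<Lambda> x)"

definition path_vector ::
  "nat \<Rightarrow> 'm kgraph \<Rightarrow> ((nat \<Rightarrow> nat) \<times> (nat \<Rightarrow> nat) \<Rightarrow> 'm) \<Rightarrow> nat \<Rightarrow> 'm \<Rightarrow>
    (nat \<Rightarrow> nat \<times> ('m \<Rightarrow> complex)) set" where
  "path_vector k \<Lambda> x i \<mu> =
     limit_map (\<lambda>i. ell2 (paths_into k \<Lambda> x i)) (shift_isometry k \<Lambda> x) i (ell2_basis \<mu>)"

definition is_path_operator ::
  "nat \<Rightarrow> 'm kgraph \<Rightarrow> ((nat \<Rightarrow> nat) \<times> (nat \<Rightarrow> nat) \<Rightarrow> 'm) \<Rightarrow> 'm \<Rightarrow>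
    ((nat \<Rightarrow> nat \<times> ('m \<Rightarrow> complex)) set \<Rightarrow> (nat \<Rightarrow> nat \<times> ('m \<Rightarrow> complex)) set) \<Rightarrow> bool" where
  "is_path_operator k \<Lambda> x \<alpha> T \<longleftrightarrow>
     T \<in> car (bounded_ops (path_space k \<Lambda> x)) \<and>
     (\<forall>i. \<forall>\<mu>\<in>paths_into k \<Lambda> x i.
        T (path_vector k \<Lambda> x i \<mu>) =
          (if sc \<Lambda> \<alpha> = rg \<Lambda> \<mu> then path_vector k \<Lambda> x i (cmp \<Lambda> \<alpha> \<mu>) else zer (path_space k \<Lambda> x)))"

end

theory Submission
  imports Defs "HOL-Real_Asymp.Real_Asymp"
begin

text \<open>
  The vectors \<open>[\<xi>\<^sup>i\<^sub>\<mu>]\<close> form an orthonormal basis of \<open>\<H>\<^sub>x\<close>, indexed by the set \<open>X\<close> of classes of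
  pairs \<open>(i, \<mu>)\<close>, where \<open>(i, \<mu>)\<close> and \<open>(i + 1, \<mu> x\<^sub>i)\<close> are in the same class. So \<open>\<H>\<^sub>x\<close> is
  \<open>\<ell>\<^sup>2(X)\<close>, and the graph acts on \<open>X\<close> by prepending paths. By unique factorization every path acts
  as a partial injection, and every element of \<open>X\<close> has exactly one initial path of each degree,
  since its representatives can be prolonged along \<open>x\<close>. Hence the operators \<open>T\<^sub>\<lambda>\<close> satisfy the
  Cuntz-Krieger relations, and they generate a \<open>*\<close>-homomorphism of the free \<open>*\<close>-algebra whose
  operator norm \<open>q\<close> is a \<open>C\<^sup>*\<close>-seminorm that vanishes on the relations.

  Faithfulness is the statement that \<open>q\<close> is the universal norm, that is, \<open>p \<le> q\<close> for every
  \<open>C\<^sup>*\<close>-seminorm \<open>p\<close> that vanishes on the relations; enlarging \<open>p\<close> to the maximum of \<open>p\<close> and \<open>q\<close>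
  one may assume \<open>q \<le> p\<close>. This is a form of the gauge-invariant uniqueness theorem, and the
  gauge action enters through the grading: \<open>X\<close> carries the \<open>\<int>\<^sup>k\<close>-valued degree
  \<open>d(\<mu>) - i (1,\<dots>,1)\<close>, and \<open>T\<^sub>\<lambda>\<close> raises it by \<open>d(\<lambda>)\<close>. Instead of integrating over the torus the
  proof compares growth rates: for \<open>a\<^sub>0 = a\<close> and \<open>a\<^sub>m\<^sub>+\<^sub>1 = a\<^sub>m\<^sup>* a\<^sub>m\<close> the \<open>C\<^sup>*\<close>-identity gives
  \<open>p(a\<^sub>m) = p(a)\<close> to the power \<open>2\<^sup>m\<close>, and likewise for \<open>q\<close>, so \<open>p(a) \<le> q(a)\<close> follows from
  \<open>p(a\<^sub>m) \<le> C D\<^sup>m q(a\<^sub>m)\<close> (\<open>growth_bound\<close>). Such a bound is available in two situations.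

  \<^item> Elements of degree \<open>0\<close> are, modulo the relations, matrices with respect to finitely many
    matrix units \<open>t\<^sub>\<mu> t\<^sub>\<nu>\<^sup>*\<close> with \<open>d(\<mu>) = d(\<nu>) = N\<close> (\<open>homogeneous_normal_form\<close>). All \<open>a\<^sub>m\<close> are
    matrices of the same size, and the entries of a matrix are matrix coefficients of the
    represented operator, because strong connectedness makes every vertex the range of an element
    of \<open>X\<close> (\<open>matrix_entries_bound\<close>).

  \<^item> In general \<open>a\<^sub>m\<close> is the sum of its homogeneous components. Their number grows like \<open>(2\<^sup>m)\<^sup>k\<close>.
    For a component \<open>c\<close> the element \<open>c\<^sup>* c\<close> has degree \<open>0\<close>, so \<open>p(c) \<le> q(c)\<close>, and \<open>q(c) \<le> q(a\<^sub>m)\<close>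
    because \<open>c\<close> is represented by a block diagonal of the operator of \<open>a\<^sub>m\<close>
    (\<open>norm_component_le\<close>, \<open>box_bound\<close>).

  The relations do not mention that \<open>t\<^sub>\<alpha>\<^sup>* t\<^sub>\<beta> = 0\<close> for distinct paths of the same degree, which the
  normal form requires. It holds because projections that sum to a projection are orthogonal; in
  terms of a \<open>C\<^sup>*\<close>-seminorm this follows from extremality of the unit in the unit ball
  (\<open>unit_extreme\<close>, \<open>projections_orthogonal\<close>).

  Finally both completions, the one that defines \<open>C\<^sup>*(\<Lambda>)\<close> and the one that defines \<open>\<H>\<^sub>x\<close>, are
  identified with concrete spaces: an isometry of a seminormed space into a Banach space carries
  the Hausdorff completion onto the closure of its range (\<open>completion_model\<close>).
\<close>

section \<open>The Hilbert space of square-summable functions\<close>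

text \<open>
  The Hilbert space lives on all functions on a type, so that the library of Banach spaces and bounded
  operators applies to it. The spaces of the theorem correspond to the closed subspaces of functions
  with support in a given set.
\<close>

typedef 'a l2 = "{f :: 'a \<Rightarrow> complex. (\<lambda>a. (cmod (f a))\<^sup>2) summable_on UNIV}"
  morphisms coord Abs_l2
proof
  show "(\<lambda>_. 0) \<in> {f :: 'a \<Rightarrow> complex. (\<lambda>a. (cmod (f a))\<^sup>2) summable_on UNIV}" by simp
qed

setup_lifting type_definition_l2

lemma square_summable_coord: "(\<lambda>a. (cmod (coord \<xi> a))\<^sup>2) summable_on UNIV"
  using coord[of \<xi>] by simp

lemma summable_on_comparison:
  fixes f g :: "'a \<Rightarrow> real"
  assumes "g summable_on A" "\<And>x. x \<in> A \<Longrightarrow> 0 \<le> f x" "\<And>x. x \<in> A \<Longrightarrow> f x \<le> g x"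
  shows "f summable_on A"
proof (rule nonneg_bdd_above_summable_on)
  show "bdd_above (sum f ` {F. F \<subseteq> A \<and> finite F})"
  proof (rule bdd_aboveI2)
    fix F assume "F \<in> {F. F \<subseteq> A \<and> finite F}"
    then have F: "F \<subseteq> A" "finite F" by auto
    have "sum f F \<le> sum g F" using F assms(3) by (intro sum_mono) auto
    also have "\<dots> \<le> infsum g A"
    proof (rule finite_sum_le_infsum[OF assms(1) F(2,1)])
      show "\<And>x. x \<in> A - F \<Longrightarrow> 0 \<le> g x" using assms(2,3) by (meson DiffD1 order_trans)
    qed
    finally show "sum f F \<le> infsum g A" .
  qed
qed (use assms(2) in auto)

lemma square_add_le: "(cmod (a + b))\<^sup>2 \<le> 2 * (cmod a)\<^sup>2 + 2 * (cmod b)\<^sup>2"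
proof -
  have "(cmod (a + b))\<^sup>2 \<le> (cmod a + cmod b)\<^sup>2" by (intro power_mono norm_triangle_ineq) auto
  also have "\<dots> \<le> 2 * (cmod a)\<^sup>2 + 2 * (cmod b)\<^sup>2"
    using sum_squares_bound[of "cmod a" "cmod b"] by (simp add: power2_sum)
  finally show ?thesis .
qed

lemma square_summable_add:
  assumes "(\<lambda>a. (cmod (f a))\<^sup>2) summable_on A" "(\<lambda>a. (cmod (g a))\<^sup>2) summable_on A"
  shows "(\<lambda>a. (cmod (f a + g a))\<^sup>2) summable_on A"
proof (rule summable_on_comparison)
  show "(\<lambda>a. 2 * (cmod (f a))\<^sup>2 + 2 * (cmod (g a))\<^sup>2) summable_on A"
    using assms by (intro summable_on_add summable_on_cmult_right) auto
qed (auto intro: square_add_le)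

lemma square_summable_mult:
  assumes "(\<lambda>a. (cmod (f a))\<^sup>2) summable_on A"
  shows "(\<lambda>a. (cmod (c * f a))\<^sup>2) summable_on A"
  using summable_on_cmult_right[OF assms, of "(cmod c)\<^sup>2"]
  by (simp add: norm_mult power_mult_distrib)

lemma summable_on_mult_cnj:
  assumes "(\<lambda>a. (cmod (f a))\<^sup>2) summable_on A" "(\<lambda>a. (cmod (g a))\<^sup>2) summable_on A"
  shows "(\<lambda>a. f a * cnj (g a)) summable_on A"
proof -
  have "(\<lambda>a. norm (f a * cnj (g a))) summable_on A"
    by (rule abs_summable_product) (use assms in \<open>simp_all add: norm_mult power2_eq_square\<close>)
  then show ?thesis by (rule abs_summable_summable)
qed

instantiation l2 :: (type) real_vector
begin
lift_definition zero_l2 :: "'a l2" is "\<lambda>_. 0" by simp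
lift_definition plus_l2 :: "'a l2 \<Rightarrow> 'a l2 \<Rightarrow> 'a l2" is "\<lambda>f g a. f a + g a"
  by (rule square_summable_add)
lift_definition uminus_l2 :: "'a l2 \<Rightarrow> 'a l2" is "\<lambda>f a. - f a" by simp
lift_definition minus_l2 :: "'a l2 \<Rightarrow> 'a l2 \<Rightarrow> 'a l2" is "\<lambda>f g a. f a - g a"
  using square_summable_add[where g = "\<lambda>a. - g a" for g] by auto
lift_definition scaleR_l2 :: "real \<Rightarrow> 'a l2 \<Rightarrow> 'a l2" is "\<lambda>r f a. of_real r * f a"
  by (rule square_summable_mult)
instance by standard (transfer, simp add: algebra_simps)+
end

lift_definition cinner :: "'a l2 \<Rightarrow> 'a l2 \<Rightarrow> complex" is "\<lambda>f g. \<Sum>\<^sub>\<infinity>a. f a * cnj (g a)" .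

lemma coord_simps [simp]:
  "coord 0 a = 0" "coord (\<xi> + \<eta>) a = coord \<xi> a + coord \<eta> a"
  "coord (- \<xi>) a = - coord \<xi> a" "coord (\<xi> - \<eta>) a = coord \<xi> a - coord \<eta> a"
  "coord (r *\<^sub>R \<xi>) a = of_real r * coord \<xi> a"
  by (transfer; simp)+

lemma coord_sum [simp]: "coord (sum f A) a = (\<Sum>i\<in>A. coord (f i) a)"
  by (induction A rule: infinite_finite_induct) auto

lemma l2_eqI: "(\<And>a. coord \<xi> a = coord \<eta> a) \<Longrightarrow> \<xi> = \<eta>"
  by (metis coord_inject ext)

lemma summable_cinner: "(\<lambda>a. coord \<xi> a * cnj (coord \<eta> a)) summable_on UNIV"
  by (intro summable_on_mult_cnj square_summable_coord)

lemma cinner_self: "cinner \<xi> \<xi> = of_real (\<Sum>\<^sub>\<infinity>a. (cmod (coord \<xi> a))\<^sup>2)"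
proof -
  have "((\<lambda>a. complex_of_real ((cmod (coord \<xi> a))\<^sup>2)) has_sum of_real (\<Sum>\<^sub>\<infinity>a. (cmod (coord \<xi> a))\<^sup>2)) UNIV"
    using square_summable_coord[of \<xi>] by (intro has_sum_of_real has_sum_infsum)
  then show ?thesis
    unfolding cinner.rep_eq complex_norm_square[symmetric] by (rule infsumI)
qed

lemma cinner_add_left: "cinner (\<xi> + \<eta>) \<zeta> = cinner \<xi> \<zeta> + cinner \<eta> \<zeta>"
  unfolding cinner.rep_eq by (simp add: distrib_right infsum_add summable_cinner)

lemma cinner_commute: "cinner \<xi> \<eta> = cnj (cinner \<eta> \<xi>)"
  unfolding cinner.rep_eq infsum_cnj[symmetric] by (simp add: mult.commute)

lemma cinner_scaleR_left: "cinner (r *\<^sub>R \<xi>) \<eta> = of_real r * cinner \<xi> \<eta>"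
  unfolding cinner.rep_eq by (simp add: mult.assoc infsum_cmult_right')

instantiation l2 :: (type) real_inner
begin
definition "inner_l2 \<xi> \<eta> = Re (cinner \<xi> \<eta>)"
definition "norm_l2 (\<xi> :: 'a l2) = sqrt (Re (cinner \<xi> \<xi>))"
definition "dist_l2 (\<xi> :: 'a l2) \<eta> = norm (\<xi> - \<eta>)"
definition "sgn_l2 (\<xi> :: 'a l2) = \<xi> /\<^sub>R norm \<xi>"
definition uniformity_l2 :: "('a l2 \<times> 'a l2) filter"
  where "uniformity_l2 = (INF e\<in>{0<..}. principal {(x, y). dist x y < e})"
definition open_l2 :: "'a l2 set \<Rightarrow> bool"
  where "open_l2 U = (\<forall>x\<in>U. eventually (\<lambda>(x', y). x' = x \<longrightarrow> y \<in> U) uniformity)"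
instance
proof
  fix \<xi> \<eta> \<zeta> :: "'a l2" and r :: real
  show "inner \<xi> \<eta> = inner \<eta> \<xi>" unfolding inner_l2_def by (subst cinner_commute) simp
  show "inner (\<xi> + \<eta>) \<zeta> = inner \<xi> \<zeta> + inner \<eta> \<zeta>" by (simp add: inner_l2_def cinner_add_left)
  show "inner (r *\<^sub>R \<xi>) \<eta> = r * inner \<xi> \<eta>" by (simp add: inner_l2_def cinner_scaleR_left)
  show "0 \<le> inner \<xi> \<xi>" by (simp add: inner_l2_def cinner_self infsum_nonneg)
  show "(inner \<xi> \<xi> = 0) = (\<xi> = 0)"
  proof
    assume "inner \<xi> \<xi> = 0"
    then have *: "(\<Sum>\<^sub>\<infinity>a. (cmod (coord \<xi> a))\<^sup>2) \<le> 0" by (simp add: inner_l2_def cinner_self)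
    have "(cmod (coord \<xi> a))\<^sup>2 = 0" for a
      using nonneg_infsum_le_0D[OF * square_summable_coord] by simp
    then show "\<xi> = 0" by (intro l2_eqI) simp
  qed (simp add: inner_l2_def cinner.rep_eq)
  show "norm \<xi> = sqrt (inner \<xi> \<xi>)" by (simp add: norm_l2_def inner_l2_def)
qed (rule dist_l2_def sgn_l2_def uniformity_l2_def open_l2_def)+
end

lemma norm_square_l2: "(norm (\<xi> :: 'a l2))\<^sup>2 = (\<Sum>\<^sub>\<infinity>a. (cmod (coord \<xi> a))\<^sup>2)"
  by (simp add: norm_l2_def cinner_self infsum_nonneg)

lemma sum_coord_le_norm: "finite F \<Longrightarrow> (\<Sum>a\<in>F. (cmod (coord \<xi> a))\<^sup>2) \<le> (norm \<xi>)\<^sup>2"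
  unfolding norm_square_l2 by (rule finite_sum_le_infsum) (auto intro: square_summable_coord)

lemma norm_coord_le: "cmod (coord \<xi> a) \<le> norm \<xi>"
  using sum_coord_le_norm[of "{a}" \<xi>] by (simp add: power2_le_iff_abs_le)

text \<open>
  Both completeness and the boundedness of operators reduce to finite partial sums through this
  criterion for membership.
\<close>

lemma l2_bounded_sums:
  assumes "\<And>F. finite F \<Longrightarrow> (\<Sum>a\<in>F. (cmod (f a))\<^sup>2) \<le> e\<^sup>2" "0 \<le> e"
  obtains \<xi> where "coord \<xi> = f" "norm \<xi> \<le> e"
proof -
  have *: "(\<lambda>a. (cmod (f a))\<^sup>2) summable_on UNIV"
    by (rule nonneg_bdd_above_summable_on) (use assms in \<open>auto intro!: bdd_aboveI2[where M = "e\<^sup>2"]\<close>)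
  then have c: "coord (Abs_l2 f) = f" by (simp add: Abs_l2_inverse)
  have "(norm (Abs_l2 f))\<^sup>2 \<le> e\<^sup>2"
    unfolding norm_square_l2 c by (rule infsum_le_finite_sums[OF *]) (use assms in auto)
  then have "norm (Abs_l2 f) \<le> e" using assms(2) by (rule power2_le_imp_le)
  with c show thesis by (rule that)
qed

lemma bounded_linear_coord: "bounded_linear (\<lambda>\<xi>. coord \<xi> a)"
  by (rule bounded_linear_intro[where K = 1]) (auto simp: norm_coord_le scaleR_conv_of_real)

instance l2 :: (type) complete_space
proof
  fix X :: "nat \<Rightarrow> 'a l2" assume X: "Cauchy X"
  have "convergent (\<lambda>n. coord (X n) a)" for a
    using bounded_linear.Cauchy[OF bounded_linear_coord X] by (rule Cauchy_convergent)
  then obtain g where g: "\<And>a. (\<lambda>n. coord (X n) a) \<longlonglongrightarrow> g a" unfolding convergent_def by metis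
  have main: "\<exists>\<zeta>. coord \<zeta> = (\<lambda>a. coord (X m) a - g a) \<and> norm \<zeta> \<le> e"
    if e: "0 \<le> e" and N: "\<And>n. n \<ge> N \<Longrightarrow> norm (X m - X n) \<le> e" for m N e
  proof -
    have sums: "(\<Sum>a\<in>F. (cmod (coord (X m) a - g a))\<^sup>2) \<le> e\<^sup>2" if "finite F" for F
    proof (rule tendsto_upperbound)
      show "(\<lambda>n. \<Sum>a\<in>F. (cmod (coord (X m) a - coord (X n) a))\<^sup>2) \<longlonglongrightarrow> (\<Sum>a\<in>F. (cmod (coord (X m) a - g a))\<^sup>2)"
        by (intro tendsto_intros g)
      show "\<forall>\<^sub>F n in sequentially. (\<Sum>a\<in>F. (cmod (coord (X m) a - coord (X n) a))\<^sup>2) \<le> e\<^sup>2"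
        using eventually_ge_at_top[of N]
      proof eventually_elim
        case (elim n)
        have "(\<Sum>a\<in>F. (cmod (coord (X m) a - coord (X n) a))\<^sup>2) \<le> (norm (X m - X n))\<^sup>2"
          using sum_coord_le_norm[OF that, of "X m - X n"] by simp
        also have "\<dots> \<le> e\<^sup>2" by (intro power_mono N elim) auto
        finally show ?case .
      qed
    qed simp
    show ?thesis by (rule l2_bounded_sums[OF sums e]) blast+
  qed
  obtain N where N: "\<And>m n. m \<ge> N \<Longrightarrow> n \<ge> N \<Longrightarrow> norm (X m - X n) < 1"
    using X unfolding Cauchy_iff by (meson zero_less_one)
  obtain \<zeta> where \<zeta>: "coord \<zeta> = (\<lambda>a. coord (X N) a - g a)" using main[of 1 N N] N[of N] by force
  define \<xi> where "\<xi> = X N - \<zeta>"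
  have \<xi>: "coord \<xi> = g" unfolding \<xi>_def by (rule ext) (simp add: \<zeta>)
  have "X \<longlonglongrightarrow> \<xi>"
  proof (rule LIMSEQ_I)
    fix r :: real assume r: "0 < r"
    obtain N where N: "\<And>m n. m \<ge> N \<Longrightarrow> n \<ge> N \<Longrightarrow> norm (X m - X n) < r / 2"
      using X r unfolding Cauchy_iff by (meson half_gt_zero)
    have "norm (X m - \<xi>) < r" if m: "m \<ge> N" for m
    proof -
      obtain \<zeta> where z: "coord \<zeta> = (\<lambda>a. coord (X m) a - g a)" "norm \<zeta> \<le> r / 2"
        using main[of "r / 2" N m] N[OF m] r by force
      have "X m - \<xi> = \<zeta>" by (rule l2_eqI) (simp add: z \<xi>)
      then show ?thesis using z r by simp
    qed
    then show "\<exists>N. \<forall>m\<ge>N. norm (X m - \<xi>) < r" by blast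
  qed
  then show "convergent X" by (rule convergentI)
qed

instance l2 :: (type) banach ..

subsection \<open>Complex scalars and basis vectors\<close>

lift_definition scaleC_l2 :: "complex \<Rightarrow> 'a l2 \<Rightarrow> 'a l2" is "\<lambda>c f a. c * f a"
  by (rule square_summable_mult)

lemma coord_scaleC [simp]: "coord (scaleC_l2 c \<xi>) a = c * coord \<xi> a"
  by (simp add: scaleC_l2.rep_eq)

lemma norm_scaleC: "norm (scaleC_l2 c \<xi>) = cmod c * norm \<xi>"
proof -
  have "(norm (scaleC_l2 c \<xi>))\<^sup>2 = (cmod c * norm \<xi>)\<^sup>2"
    by (simp add: norm_square_l2 norm_mult power_mult_distrib infsum_cmult_right')
  then show ?thesis by (simp add: power2_eq_iff_nonneg)
qed

lemma bounded_linear_scaleC: "bounded_linear (scaleC_l2 c)"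
  by (rule bounded_linear_intro[where K = "cmod c"])
     (auto intro!: l2_eqI simp: norm_scaleC algebra_simps)

lemma cinner_scaleC_left: "cinner (scaleC_l2 c \<xi>) \<eta> = c * cinner \<xi> \<eta>"
  unfolding cinner.rep_eq by (simp add: mult.assoc infsum_cmult_right')

lemma cinner_scaleC_right: "cinner \<xi> (scaleC_l2 c \<eta>) = cnj c * cinner \<xi> \<eta>"
  by (subst (1 2) cinner_commute) (simp add: cinner_scaleC_left)

lemma cinner_add_right: "cinner \<xi> (\<eta> + \<zeta>) = cinner \<xi> \<eta> + cinner \<xi> \<zeta>"
  by (subst (1 2 3) cinner_commute) (simp add: cinner_add_left)

lemma cinner_via_inner:
  "cinner \<xi> \<eta> = Complex (inner \<xi> \<eta>) (inner \<xi> (scaleC_l2 \<i> \<eta>))"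
  by (simp add: inner_l2_def cinner_scaleC_right complex_eq_iff)

lemma cinner_diff_right: "cinner \<xi> (\<eta> - \<zeta>) = cinner \<xi> \<eta> - cinner \<xi> \<zeta>"
  using cinner_add_right[of \<xi> "\<eta> - \<zeta>" \<zeta>] by simp

lemma Re_cinner_self: "Re (cinner \<xi> \<xi>) = (norm \<xi>)\<^sup>2"
  by (simp add: norm_square_l2 cinner_self)

lemma tendsto_cinner:
  assumes "(f \<longlongrightarrow> \<xi>) F" "(g \<longlongrightarrow> \<eta>) F"
  shows "((\<lambda>n. cinner (f n) (g n)) \<longlongrightarrow> cinner \<xi> \<eta>) F"
  unfolding cinner_via_inner
  by (intro tendsto_Complex tendsto_inner assms bounded_linear.tendsto[OF bounded_linear_scaleC])

lift_definition basis_l2 :: "'a \<Rightarrow> 'a l2" is "\<lambda>x a. if a = x then 1 else 0"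
proof -
  fix x :: 'a
  show "(\<lambda>a. (cmod (if a = x then 1 else 0))\<^sup>2) summable_on UNIV"
    by (rule summable_on_cong_neutral[where S = "{x}", THEN iffD1]) auto
qed

lemma coord_basis: "coord (basis_l2 x) a = (if a = x then 1 else 0)"
  by (simp add: basis_l2.rep_eq)

lemma norm_basis [simp]: "norm (basis_l2 x) = 1"
proof -
  have "(norm (basis_l2 x))\<^sup>2 = (\<Sum>\<^sub>\<infinity>a\<in>{x}. 1)"
    unfolding norm_square_l2 coord_basis by (rule infsum_cong_neutral) auto
  then show ?thesis using norm_ge_zero[of "basis_l2 x"] unfolding power2_eq_1_iff[symmetric] by (auto simp: power2_eq_1_iff)
qed

definition supported :: "'a set \<Rightarrow> 'a l2 set" where
  "supported X = {\<xi>. \<forall>a. a \<notin> X \<longrightarrow> coord \<xi> a = 0}"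

lemma closed_supported: "closed (supported X)"
proof -
  have "closed {\<xi>. coord \<xi> a = 0}" for a
    by (rule closed_Collect_eq[OF linear_continuous_on[OF bounded_linear_coord] continuous_on_const])
  then have "closed (\<Inter>a\<in>-X. {\<xi>. coord \<xi> a = 0})" by (intro closed_INT ballI)
  also have "(\<Inter>a\<in>-X. {\<xi>. coord \<xi> a = 0}) = supported X" by (auto simp: supported_def)
  finally show ?thesis .
qed

lemma finite_support_approximation:
  assumes "0 < e"
  obtains F where "finite F" "norm (\<xi> - (\<Sum>x\<in>F. scaleC_l2 (coord \<xi> x) (basis_l2 x))) < e"
proof -
  obtain F where F: "finite F" and
    approx: "dist (\<Sum>a\<in>F. (cmod (coord \<xi> a))\<^sup>2) (\<Sum>\<^sub>\<infinity>a. (cmod (coord \<xi> a))\<^sup>2) \<le> (e/2)\<^sup>2"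
    using infsum_finite_approximation[OF square_summable_coord, of "(e/2)\<^sup>2"] assms by auto
  define \<eta> where "\<eta> = (\<Sum>x\<in>F. scaleC_l2 (coord \<xi> x) (basis_l2 x))"
  have c: "coord \<eta> a = (if a \<in> F then coord \<xi> a else 0)" for a
  proof -
    have "coord \<eta> a = (\<Sum>x\<in>F. if a = x then coord \<xi> x else 0)"
      unfolding \<eta>_def by (auto simp: coord_basis intro!: sum.cong)
    then show ?thesis using F by simp
  qed
  have split: "(\<Sum>\<^sub>\<infinity>a. (cmod (coord \<xi> a))\<^sup>2) =
      (\<Sum>a\<in>F. (cmod (coord \<xi> a))\<^sup>2) + (\<Sum>\<^sub>\<infinity>a\<in>-F. (cmod (coord \<xi> a))\<^sup>2)"
    using infsum_Un_disjoint[of "\<lambda>a. (cmod (coord \<xi> a))\<^sup>2" F "-F"] F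
    by (simp add: summable_on_subset_banach[OF square_summable_coord])
  have "(norm (\<xi> - \<eta>))\<^sup>2 = (\<Sum>\<^sub>\<infinity>a\<in>-F. (cmod (coord \<xi> a))\<^sup>2)"
    unfolding norm_square_l2 by (rule infsum_cong_neutral) (auto simp: c)
  also have "\<dots> \<le> (e/2)\<^sup>2" using approx unfolding split by (simp add: dist_real_def)
  finally have "norm (\<xi> - \<eta>) \<le> e/2" by (rule power2_le_imp_le) (use assms in simp)
  then have "norm (\<xi> - \<eta>) < e" using assms by simp
  with F show thesis unfolding \<eta>_def by (rule that)
qed

text \<open>
  Finite sections of a square-summable function converge to it. This is the form in which density of
  the span of the basis vectors is used below, with \<open>E\<close> the set where two operators agree or the range
  of an isometry.
\<close>

lemma supported_in_closed_span:
  assumes "closed E" "0 \<in> E" "\<And>\<xi> \<eta>. \<xi> \<in> E \<Longrightarrow> \<eta> \<in> E \<Longrightarrow> \<xi> + \<eta> \<in> E"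
    and "\<And>c x. x \<in> X \<Longrightarrow> scaleC_l2 c (basis_l2 x) \<in> E"
  shows "supported X \<subseteq> E"
proof
  fix \<xi> :: "'a l2" assume \<xi>: "\<xi> \<in> supported X"
  have part: "(\<Sum>x\<in>F. scaleC_l2 (coord \<xi> x) (basis_l2 x)) \<in> E" if "finite F" for F
    using that
  proof (induction F)
    case (insert x F)
    have "scaleC_l2 (coord \<xi> x) (basis_l2 x) \<in> E"
    proof (cases "x \<in> X")
      case False
      then have "scaleC_l2 (coord \<xi> x) (basis_l2 x) = 0"
        using \<xi> by (intro l2_eqI) (auto simp: supported_def)
      then show ?thesis using assms by simp
    qed (use assms in auto)
    then show ?case using insert assms by auto
  qed (use assms in auto)
  have "\<xi> \<in> closure E"
    unfolding closure_approachable
  proof (intro allI impI)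
    fix e :: real assume "0 < e"
    then obtain F where F: "finite F" "norm (\<xi> - (\<Sum>x\<in>F. scaleC_l2 (coord \<xi> x) (basis_l2 x))) < e"
      by (rule finite_support_approximation)
    show "\<exists>\<eta>\<in>E. dist \<eta> \<xi> < e"
      by (rule bexI[OF _ part[OF F(1)]]) (use F(2) in \<open>simp add: dist_norm norm_minus_commute\<close>)
  qed
  then show "\<xi> \<in> E" using assms(1) by simp
qed

subsection \<open>Operators given by partial injections\<close>

text \<open>
  Every generator of the algebra, and its adjoint, moves basis vectors along a partial injection.
  Such an operator composes functions with the inverse partial injection, so \<open>pull\<close> reverses arrows.
\<close>

definition partial_injection :: "('a \<Rightarrow> 'b option) \<Rightarrow> bool" where
  "partial_injection \<tau> \<longleftrightarrow> inj_on \<tau> (dom \<tau>)"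

definition pull_fun :: "('a \<Rightarrow> 'b option) \<Rightarrow> ('b \<Rightarrow> complex) \<Rightarrow> 'a \<Rightarrow> complex" where
  "pull_fun \<tau> f y = (case \<tau> y of None \<Rightarrow> 0 | Some x \<Rightarrow> f x)"

text \<open>
  Every coordinate of \<open>\<xi>\<close> is read at most once.
\<close>

lemma partial_injection_finite_sum:
  assumes "partial_injection \<tau>" "finite F"
  shows "(\<Sum>y\<in>F. (cmod (pull_fun \<tau> (coord \<xi>) y))\<^sup>2) \<le> (norm \<xi>)\<^sup>2"
proof -
  let ?D = "F \<inter> dom \<tau>"
  have inj: "inj_on (the \<circ> \<tau>) ?D"
    using assms(1) unfolding partial_injection_def inj_on_def by (force simp: dom_def)
  have "(\<Sum>y\<in>F. (cmod (pull_fun \<tau> (coord \<xi>) y))\<^sup>2) = (\<Sum>y\<in>?D. (cmod (coord \<xi> ((the \<circ> \<tau>) y)))\<^sup>2)"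
    by (rule sum.mono_neutral_cong_right) (use assms(2) in \<open>auto simp: pull_fun_def split: option.splits\<close>)
  also have "\<dots> = (\<Sum>x\<in>(the \<circ> \<tau>) ` ?D. (cmod (coord \<xi> x))\<^sup>2)"
    by (subst sum.reindex[OF inj]) (simp add: o_def)
  also have "\<dots> \<le> (norm \<xi>)\<^sup>2" by (rule sum_coord_le_norm) (use assms(2) in auto)
  finally show ?thesis .
qed

definition pull :: "('a \<Rightarrow> 'b option) \<Rightarrow> 'b l2 \<Rightarrow>\<^sub>L 'a l2" where
  "pull \<tau> = Blinfun (\<lambda>\<xi>. Abs_l2 (pull_fun \<tau> (coord \<xi>)))"

lemma
  assumes "partial_injection \<tau>"
  shows coord_pull: "coord (pull \<tau> \<xi>) y = (case \<tau> y of None \<Rightarrow> 0 | Some x \<Rightarrow> coord \<xi> x)"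
    and norm_pull_le: "norm (pull \<tau> \<xi>) \<le> norm \<xi>"
proof -
  have ex: "\<exists>\<eta>. coord \<eta> = pull_fun \<tau> (coord \<xi>) \<and> norm \<eta> \<le> norm \<xi>" for \<xi>
    using l2_bounded_sums[OF partial_injection_finite_sum[OF assms, of _ \<xi>] norm_ge_zero] by metis
  have c: "coord (Abs_l2 (pull_fun \<tau> (coord \<xi>))) = pull_fun \<tau> (coord \<xi>)"
    and n: "norm (Abs_l2 (pull_fun \<tau> (coord \<xi>))) \<le> norm \<xi>" for \<xi>
    using ex[of \<xi>] by (metis coord_inverse)+
  have "bounded_linear (\<lambda>\<xi>. Abs_l2 (pull_fun \<tau> (coord \<xi>)))"
    by (rule bounded_linear_intro[where K = 1])
       (auto intro!: l2_eqI n simp: c pull_fun_def split: option.splits)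
  then have ap: "blinfun_apply (pull \<tau>) = (\<lambda>\<xi>. Abs_l2 (pull_fun \<tau> (coord \<xi>)))"
    unfolding pull_def by (rule bounded_linear_Blinfun_apply)
  show "coord (pull \<tau> \<xi>) y = (case \<tau> y of None \<Rightarrow> 0 | Some x \<Rightarrow> coord \<xi> x)"
    unfolding ap c by (simp add: pull_fun_def)
  show "norm (pull \<tau> \<xi>) \<le> norm \<xi>" unfolding ap by (rule n)
qed

lemma partial_injectionI:
  "(\<And>x y. \<tau> y = Some x \<Longrightarrow> \<sigma> x = Some y) \<Longrightarrow> partial_injection \<tau>"
  unfolding partial_injection_def inj_on_def by (metis domD option.inject)

text \<open>
  Both sides are the sum over the graph of the partial injection.
\<close>

lemma cinner_pull:
  assumes inv: "\<And>x y. \<tau> y = Some x \<longleftrightarrow> \<sigma> x = Some y"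
  shows "cinner (pull \<tau> \<xi>) \<eta> = cinner \<xi> (pull \<sigma> \<eta>)"
proof -
  have \<tau>: "partial_injection \<tau>" by (rule partial_injectionI[of \<tau> \<sigma>]) (simp add: inv)
  have \<sigma>: "partial_injection \<sigma>" by (rule partial_injectionI[of \<sigma> \<tau>]) (simp add: inv)
  have bij: "bij_betw (the \<circ> \<tau>) (dom \<tau>) (dom \<sigma>)"
  proof (rule bij_betwI[where g = "the \<circ> \<sigma>"])
    show "the \<circ> \<tau> \<in> dom \<tau> \<rightarrow> dom \<sigma>" using inv by fastforce
    show "the \<circ> \<sigma> \<in> dom \<sigma> \<rightarrow> dom \<tau>" using inv by fastforce
    show "(the \<circ> \<sigma>) ((the \<circ> \<tau>) y) = y" if "y \<in> dom \<tau>" for y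
      using that inv by (metis comp_apply domD option.sel)
    show "(the \<circ> \<tau>) ((the \<circ> \<sigma>) x) = x" if "x \<in> dom \<sigma>" for x
      using that inv by (metis comp_apply domD option.sel)
  qed
  have "cinner (pull \<tau> \<xi>) \<eta> =
      (\<Sum>\<^sub>\<infinity>y\<in>dom \<tau>. coord \<xi> (the (\<tau> y)) * cnj (coord \<eta> y))"
    unfolding cinner.rep_eq
    by (rule infsum_cong_neutral) (auto simp: coord_pull[OF \<tau>] split: option.splits)
  also have "\<dots> = (\<Sum>\<^sub>\<infinity>y\<in>dom \<tau>. coord \<xi> ((the \<circ> \<tau>) y) * cnj (coord \<eta> (the (\<sigma> ((the \<circ> \<tau>) y)))))"
  proof (rule infsum_cong)
    fix y assume "y \<in> dom \<tau>"
    then obtain x where "\<tau> y = Some x" by auto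
    moreover from this have "\<sigma> x = Some y" by (simp add: inv)
    ultimately show "coord \<xi> (the (\<tau> y)) * cnj (coord \<eta> y) =
        coord \<xi> ((the \<circ> \<tau>) y) * cnj (coord \<eta> (the (\<sigma> ((the \<circ> \<tau>) y))))" by simp
  qed
  also have "\<dots> = (\<Sum>\<^sub>\<infinity>x\<in>dom \<sigma>. coord \<xi> x * cnj (coord \<eta> (the (\<sigma> x))))"
    by (rule infsum_reindex_bij_betw[OF bij])
  also have "\<dots> = cinner \<xi> (pull \<sigma> \<eta>)"
    unfolding cinner.rep_eq
    by (rule infsum_cong_neutral) (auto simp: coord_pull[OF \<sigma>] split: option.splits)
  finally show ?thesis .
qed

definition scaleC_op :: "complex \<Rightarrow> 'a l2 \<Rightarrow>\<^sub>L 'a l2" where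
  "scaleC_op c = Blinfun (scaleC_l2 c)"

lemma scaleC_op_apply [simp]: "blinfun_apply (scaleC_op c) = scaleC_l2 c"
  unfolding scaleC_op_def by (rule bounded_linear_Blinfun_apply[OF bounded_linear_scaleC])

lemma norm_scaleC_compose:
  "norm (scaleC_op c o\<^sub>L S) = cmod c * norm (S :: 'b::real_normed_vector \<Rightarrow>\<^sub>L 'a l2)"
proof (rule antisym)
  show le: "norm (scaleC_op c o\<^sub>L S) \<le> cmod c * norm S" for c :: complex and S :: "'b \<Rightarrow>\<^sub>L 'a l2"
  proof (rule norm_blinfun_bound)
    show "norm ((scaleC_op c o\<^sub>L S) x) \<le> cmod c * norm S * norm x" for x
      by (simp add: norm_scaleC mult.assoc mult_left_mono norm_blinfun)
  qed simp
  show "cmod c * norm S \<le> norm (scaleC_op c o\<^sub>L S)"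
  proof (cases "c = 0")
    case False
    have "S = scaleC_op (inverse c) o\<^sub>L (scaleC_op c o\<^sub>L S)"
      by (rule blinfun_eqI, rule l2_eqI) (use False in simp)
    then have "norm S \<le> cmod (inverse c) * norm (scaleC_op c o\<^sub>L S)" using le by metis
    then show ?thesis using False by (simp add: norm_divide field_simps)
  qed simp
qed

section \<open>The free star-algebra and its representations\<close>

text \<open>
  Elements of the free algebra are functions on words, but are treated as elements of an algebra;
  their values at words are exposed only on demand.
\<close>

declare plus_fun_apply [simp del] zero_fun_apply [simp del] minus_apply [simp del]
  uminus_apply [simp del]

lemmas pointwise = plus_fun_apply zero_fun_apply minus_apply uminus_apply

definition cscale :: "complex \<Rightarrow> 'g free \<Rightarrow> 'g free" where
  "cscale c a = (\<lambda>w. c * a w)"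

definition word_elt :: "('g \<times> bool) list \<Rightarrow> 'g free" where
  "word_elt w = (\<lambda>u. if u = w then 1 else 0)"

definition words_over :: "'g set \<Rightarrow> ('g \<times> bool) list set" where
  "words_over G = {w. w \<noteq> [] \<and> fst ` set w \<subseteq> G}"

definition flip_word :: "('g \<times> bool) list \<Rightarrow> ('g \<times> bool) list" where
  "flip_word w = rev (map (\<lambda>(g, e). (g, \<not> e)) w)"

abbreviation FA :: "'g set \<Rightarrow> 'g free set" where
  "FA G \<equiv> car (free_star_alg G)"

lemma FA_def: "FA G = {a. finite {w. a w \<noteq> 0} \<and> {w. a w \<noteq> 0} \<subseteq> words_over G}"
  by (auto simp: free_star_alg_def words_over_def)

lemma free_star_alg_simps [simp]:
  "add (free_star_alg G) a b = a + b" "zer (free_star_alg G) = 0"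
  "scl (free_star_alg G) c a = cscale c a" "mul (free_star_alg G) a b = fmul a b"
  "star (free_star_alg G) a = fstar a"
  by (auto simp: free_star_alg_def cscale_def)

lemma fgen_eq_word: "fgen g = word_elt [(g, False)]"
  by (simp add: fgen_def word_elt_def)

lemma cscale_simps [simp]:
  "cscale c 0 = 0" "cscale 0 a = 0" "cscale 1 a = a" "cscale c (cscale d a) = cscale (c * d) a"
  by (auto simp: cscale_def pointwise fun_eq_iff)

lemma cscale_distrib:
  "cscale c (a + b) = cscale c a + cscale c b" "cscale c (a - b) = cscale c a - cscale c b" "cscale (c + d) a = cscale c a + cscale d a"
  by (auto simp: pointwise cscale_def algebra_simps fun_eq_iff)

lemma cscale_sum: "cscale c (sum f A) = (\<Sum>i\<in>A. cscale c (f i))"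
  by (induction A rule: infinite_finite_induct) (simp_all add: cscale_distrib)

lemma fmul_distrib:
  "fmul (a + b) c = fmul a c + fmul b c" "fmul c (a + b) = fmul c a + fmul c b"
  "fmul (a - b) c = fmul a c - fmul b c" "fmul c (a - b) = fmul c a - fmul c b"
  by (auto simp: pointwise fmul_def fun_eq_iff algebra_simps sum.distrib sum_subtractf)

lemma fmul_zero [simp]: "fmul 0 a = 0" "fmul a 0 = 0"
  by (auto simp: pointwise fmul_def fun_eq_iff)

lemma fmul_cscale [simp]: "fmul (cscale c a) b = cscale c (fmul a b)" "fmul a (cscale c b) = cscale c (fmul a b)"
  by (auto simp: fmul_def cscale_def fun_eq_iff sum_distrib_left mult_ac)

lemma fmul_sum:
  "fmul (sum f A) b = (\<Sum>i\<in>A. fmul (f i) b)" "fmul b (sum f A) = (\<Sum>i\<in>A. fmul b (f i))"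
  by (induction A rule: infinite_finite_induct) (simp_all add: fmul_distrib)

lemma fmul_word [simp]: "fmul (word_elt u) (word_elt v) = word_elt (u @ v)"
proof
  fix w :: "('a \<times> bool) list"
  have "fmul (word_elt u) (word_elt v) w =
      (\<Sum>i\<le>length w. if i = length u then (if w = u @ v then 1 else 0) else 0)"
    unfolding fmul_def word_elt_def
  proof (rule sum.cong[OF refl])
    fix i assume "i \<in> {..length w}"
    then have "length (take i w) = i" by simp
    then have "take i w = u \<and> drop i w = v \<longleftrightarrow> i = length u \<and> w = u @ v"
      by (metis append_eq_conv_conj)
    moreover have "(if take i w = u then 1 else 0) * (if drop i w = v then 1 else 0) =
        (if take i w = u \<and> drop i w = v then 1 else (0::complex))" by simp
    ultimately show "(if take i w = u then 1 else 0) * (if drop i w = v then 1 else 0) =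
        (if i = length u then if w = u @ v then 1 else 0 else (0::complex))" by simp
  qed
  then show "fmul (word_elt u) (word_elt v) w = word_elt (u @ v) w"
    by (auto simp: word_elt_def)
qed

lemma fstar_simps [simp]:
  "fstar 0 = 0" "fstar (a + b) = fstar a + fstar b" "fstar (a - b) = fstar a - fstar b"
  "fstar (cscale c a) = cscale (cnj c) (fstar a)"
  by (auto simp: pointwise fstar_def cscale_def fun_eq_iff)

lemma flip_word_involutive [simp]: "flip_word (flip_word w) = w"
  by (auto simp: flip_word_def rev_map o_def case_prod_beta)

lemma flip_word_simps [simp]: "flip_word [] = []" "flip_word (u @ v) = flip_word v @ flip_word u"
  "flip_word [(g, e)] = [(g, \<not> e)]"
  by (auto simp: flip_word_def)

lemma fstar_apply: "fstar a w = cnj (a (flip_word w))"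
  by (simp add: fstar_def flip_word_def)

lemma fstar_involutive [simp]: "fstar (fstar a) = a"
  by (simp add: fun_eq_iff fstar_apply)

lemma fstar_word [simp]: "fstar (word_elt w) = word_elt (flip_word w)"
  by (auto simp: fstar_apply word_elt_def fun_eq_iff)

lemma flip_word_in_words_over [simp]: "flip_word w \<in> words_over G \<longleftrightarrow> w \<in> words_over G"
  by (auto simp: words_over_def flip_word_def case_prod_beta image_image)

lemma append_in_words_over: "u \<in> words_over G \<Longrightarrow> v \<in> words_over G \<Longrightarrow> u @ v \<in> words_over G"
  by (auto simp: words_over_def)

lemma sum_fun_apply: "(\<Sum>i\<in>A. f i) x = (\<Sum>i\<in>A. f i x)"
  for f :: "'i \<Rightarrow> 'a \<Rightarrow> 'b::comm_monoid_add"
  by (induction A rule: infinite_finite_induct) (simp_all add: pointwise)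

lemma FA_expand:
  assumes "finite F" "{w. a w \<noteq> 0} \<subseteq> F"
  shows "a = (\<Sum>w\<in>F. cscale (a w) (word_elt w))"
proof
  fix u
  have "(\<Sum>w\<in>F. cscale (a w) (word_elt w)) u = (\<Sum>w\<in>F. if w = u then a w else 0)"
    unfolding sum_fun_apply by (rule sum.cong) (auto simp: cscale_def word_elt_def)
  also have "\<dots> = a u" using assms by (auto simp: sum.delta)
  finally show "a u = (\<Sum>w\<in>F. cscale (a w) (word_elt w)) u" ..
qed

lemma FA_finite_support: "a \<in> FA G \<Longrightarrow> finite {w. a w \<noteq> 0}"
  by (simp add: FA_def)

lemma FA_zero [simp, intro]: "0 \<in> FA G" by (simp add: FA_def pointwise)

lemma FA_add [simp, intro]: "a \<in> FA G \<Longrightarrow> b \<in> FA G \<Longrightarrow> a + b \<in> FA G"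
proof -
  assume "a \<in> FA G" "b \<in> FA G"
  moreover have "{w. (a + b) w \<noteq> 0} \<subseteq> {w. a w \<noteq> 0} \<union> {w. b w \<noteq> 0}" by (auto simp: pointwise)
  ultimately show "a + b \<in> FA G" unfolding FA_def by (auto intro: finite_subset)
qed

lemma FA_cscale [simp, intro]: "a \<in> FA G \<Longrightarrow> cscale c a \<in> FA G"
proof -
  assume "a \<in> FA G"
  moreover have "{w. cscale c a w \<noteq> 0} \<subseteq> {w. a w \<noteq> 0}" by (auto simp: cscale_def)
  ultimately show "cscale c a \<in> FA G" unfolding FA_def by (auto intro: finite_subset)
qed

lemma diff_eq_cscale: "a - b = a + cscale (-1) b"
  by (auto simp: cscale_def pointwise fun_eq_iff)

lemma FA_diff [simp, intro]: "a \<in> FA G \<Longrightarrow> b \<in> FA G \<Longrightarrow> a - b \<in> FA G"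
  by (simp add: diff_eq_cscale)

lemma FA_sum [intro]: "(\<And>i. i \<in> A \<Longrightarrow> f i \<in> FA G) \<Longrightarrow> sum f A \<in> FA G"
  by (induction A rule: infinite_finite_induct) simp_all

lemma FA_word [simp]: "word_elt w \<in> FA G \<longleftrightarrow> w \<in> words_over G"
proof -
  have "{u. word_elt w u \<noteq> 0} = {w}" by (auto simp: word_elt_def)
  then show ?thesis by (simp add: FA_def)
qed

lemma FA_fgen [simp]: "fgen g \<in> FA G \<longleftrightarrow> g \<in> G"
  by (simp add: fgen_eq_word words_over_def)

lemma FA_induct [consumes 1, case_names zero word add]:
  assumes "a \<in> FA G" "P 0" "\<And>c w. w \<in> words_over G \<Longrightarrow> P (cscale c (word_elt w))"
    "\<And>a b. a \<in> FA G \<Longrightarrow> b \<in> FA G \<Longrightarrow> P a \<Longrightarrow> P b \<Longrightarrow> P (a + b)"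
  shows "P a"
proof -
  have *: "(\<Sum>w\<in>F. cscale (a w) (word_elt w)) \<in> FA G \<and> P (\<Sum>w\<in>F. cscale (a w) (word_elt w))"
    if "finite F" "F \<subseteq> words_over G" for F
    using that
  proof (induction F)
    case (insert w F)
    then have "P (cscale (a w) (word_elt w) + (\<Sum>w\<in>F. cscale (a w) (word_elt w)))"
      by (intro assms(4) assms(3)) auto
    then show ?case using insert by simp
  qed (use assms(2) in auto)
  have "finite {w. a w \<noteq> 0}" "{w. a w \<noteq> 0} \<subseteq> words_over G" using assms(1) by (auto simp: FA_def)
  from *[OF this] FA_expand[OF this(1) order_refl] show ?thesis by metis
qed

lemma FA_fmul [simp, intro]: "a \<in> FA G \<Longrightarrow> b \<in> FA G \<Longrightarrow> fmul a b \<in> FA G"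
proof (induction a rule: FA_induct)
  case (word c u)
  from word(2) show ?case
    by (induction b rule: FA_induct) (use word(1) in \<open>simp_all add: fmul_distrib append_in_words_over cscale_distrib\<close>)
qed (simp_all add: fmul_distrib)

lemma FA_fstar [simp, intro]: "a \<in> FA G \<Longrightarrow> fstar a \<in> FA G"
  by (induction a rule: FA_induct) simp_all

lemma fmul_assoc:
  assumes "a \<in> FA G" "b \<in> FA G" "c \<in> FA G"
  shows "fmul (fmul a b) c = fmul a (fmul b c)"
  using assms(1)
proof (induction a rule: FA_induct)
  case (word x u)
  from assms(2) show ?case
  proof (induction b rule: FA_induct)
    case (word y v)
    from assms(3) show ?case
      by (induction c rule: FA_induct) (simp_all add: fmul_distrib cscale_distrib mult_ac)
  qed (simp_all add: fmul_distrib cscale_distrib)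
qed (simp_all add: fmul_distrib)

lemma fstar_fmul:
  assumes "a \<in> FA G" "b \<in> FA G"
  shows "fstar (fmul a b) = fmul (fstar b) (fstar a)"
  using assms(1)
proof (induction a rule: FA_induct)
  case (word x u)
  from assms(2) show ?case
    by (induction b rule: FA_induct) (simp_all add: fmul_distrib cscale_distrib mult.commute)
qed (simp_all add: fmul_distrib)

lemma cstar_seminorm_free:
  "cstar_seminorm (free_star_alg G) p \<longleftrightarrow>
     (\<forall>a\<in>FA G. 0 \<le> p a) \<and>
     (\<forall>a\<in>FA G. \<forall>b\<in>FA G. p (a + b) \<le> p a + p b) \<and>
     (\<forall>c. \<forall>a\<in>FA G. p (cscale c a) = cmod c * p a) \<and>
     (\<forall>a\<in>FA G. \<forall>b\<in>FA G. p (fmul a b) \<le> p a * p b) \<and>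
     (\<forall>a\<in>FA G. p (fstar a) = p a) \<and>
     (\<forall>a\<in>FA G. p (fmul (fstar a) a) = (p a)\<^sup>2)"
  by (simp add: cstar_seminorm_def)

lemma cinner_zero: "cinner 0 \<xi> = 0" "cinner \<xi> 0 = 0"
  by (simp_all add: cinner.rep_eq)

text \<open>
  A \<open>*\<close>-representation of the free algebra on a set of letters is determined by the operators of the
  letters.
\<close>

locale star_letters =
  fixes V :: "'g \<times> bool \<Rightarrow> 'x l2 \<Rightarrow>\<^sub>L 'x l2"
  assumes adjoint_letters:
    "cinner (V (g, e) \<xi>) \<eta> = cinner \<xi> (V (g, \<not> e) \<eta>)"
begin

fun word_op :: "('g \<times> bool) list \<Rightarrow> 'x l2 \<Rightarrow>\<^sub>L 'x l2" where
  "word_op [] = id_blinfun"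
| "word_op (l # w) = V l o\<^sub>L word_op w"

lemma word_op_append: "word_op (u @ v) = word_op u o\<^sub>L word_op v"
  by (induction u) (auto intro!: blinfun_eqI)

lemma cinner_eqI: "(\<And>\<zeta>. cinner \<zeta> \<xi> = cinner \<zeta> \<eta>) \<Longrightarrow> \<xi> = \<eta>"
  using cinner_diff_right[of "\<xi> - \<eta>" \<xi> \<eta>] Re_cinner_self[of "\<xi> - \<eta>"] by simp

text \<open>
  The letters are bounded operators over the reals; having an adjoint for the complex inner product
  forces complex linearity.
\<close>

lemma letter_scaleC: "V l (scaleC_l2 c \<xi>) = scaleC_l2 c (V l \<xi>)"
proof (rule cinner_eqI)
  fix \<zeta>
  obtain g e where "l = (g, e)" by fastforce
  then show "cinner \<zeta> (V l (scaleC_l2 c \<xi>)) = cinner \<zeta> (scaleC_l2 c (V l \<xi>))"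
    using adjoint_letters[of g "\<not> e", symmetric] by (simp add: cinner_scaleC_right)
qed

lemma word_scaleC:
  "word_op w (scaleC_l2 c \<xi>) = scaleC_l2 c (word_op w \<xi>)"
  by (induction w arbitrary: \<xi>) (auto simp: letter_scaleC)

lemma cinner_word: "cinner (word_op w \<xi>) \<eta> =
    cinner \<xi> (word_op (flip_word w) \<eta>)"
proof (induction w arbitrary: \<xi> \<eta>)
  case (Cons l w)
  obtain g e where l: "l = (g, e)" by fastforce
  have "flip_word (l # w) = flip_word w @ [(g, \<not> e)]" by (simp add: l flip_word_def)
  then show ?case using Cons by (simp add: l adjoint_letters word_op_append)
qed simp

definition lin_op :: "'g free \<Rightarrow> 'x l2 \<Rightarrow>\<^sub>L 'x l2" where
  "lin_op a = (\<Sum>w | a w \<noteq> 0. scaleC_op (a w) o\<^sub>L word_op w)"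

lemma lin_op_apply:
  assumes "finite F" "{w. a w \<noteq> 0} \<subseteq> F"
  shows "lin_op a \<xi> = (\<Sum>w\<in>F. scaleC_l2 (a w) (word_op w \<xi>))"
proof -
  have z: "scaleC_l2 0 \<eta> = 0" for \<eta> :: "'x l2" by (rule l2_eqI) simp
  have "lin_op a \<xi> = (\<Sum>w | a w \<noteq> 0. scaleC_l2 (a w) (word_op w \<xi>))"
    by (simp add: lin_op_def blinfun.sum_left)
  also have "\<dots> = (\<Sum>w\<in>F. scaleC_l2 (a w) (word_op w \<xi>))"
    by (rule sum.mono_neutral_left) (use assms in \<open>auto simp: z\<close>)
  finally show ?thesis .
qed

lemma lin_op_zero [simp]: "lin_op 0 = 0"
  by (simp add: lin_op_def pointwise)

lemma lin_op_word [simp]: "lin_op (word_elt w) = word_op w"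
proof (rule blinfun_eqI)
  fix \<xi> :: "'x l2"
  show "lin_op (word_elt w) \<xi> = word_op w \<xi>"
    by (subst lin_op_apply[of "{w}"]) (auto simp: word_elt_def intro: l2_eqI)
qed

lemma lin_op_add:
  assumes "a \<in> FA G" "b \<in> FA G"
  shows "lin_op (a + b) = lin_op a + lin_op b"
proof (rule blinfun_eqI)
  fix \<xi> :: "'x l2"
  let ?F = "{w. a w \<noteq> 0} \<union> {w. b w \<noteq> 0}"
  have "finite ?F" using assms by (auto dest: FA_finite_support)
  moreover have "scaleC_l2 (c + d) \<eta> = scaleC_l2 c \<eta> + scaleC_l2 d \<eta>" for c d and \<eta> :: "'x l2"
    by (rule l2_eqI) (simp add: algebra_simps)
  ultimately show "(lin_op (a + b)) \<xi> = (lin_op a + lin_op b) \<xi>"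
    by (subst lin_op_apply[of ?F "a + b"], simp, force simp: pointwise)
       (simp add: pointwise plus_blinfun.rep_eq lin_op_apply[of ?F a] lin_op_apply[of ?F b] sum.distrib)
qed

lemma lin_op_cscale:
  assumes "a \<in> FA G"
  shows "lin_op (cscale c a) = scaleC_op c o\<^sub>L lin_op a"
proof (rule blinfun_eqI)
  fix \<xi> :: "'x l2"
  let ?F = "{w. a w \<noteq> 0}"
  have F: "finite ?F" using assms by (auto dest: FA_finite_support)
  have s: "scaleC_l2 c (sum f A) = (\<Sum>i\<in>A. scaleC_l2 c (f i))" for f :: "'y \<Rightarrow> 'x l2" and A
    by (rule l2_eqI) (simp add: sum_distrib_left)
  have m: "scaleC_l2 (c * d) \<eta> = scaleC_l2 c (scaleC_l2 d \<eta>)" for d and \<eta> :: "'x l2"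
    by (rule l2_eqI) simp
  show "lin_op (cscale c a) \<xi> = (scaleC_op c o\<^sub>L lin_op a) \<xi>"
    by (subst lin_op_apply[of ?F "cscale c a"], rule F, force simp: cscale_def)
       (simp add: lin_op_apply[OF F order_refl] s cscale_def m)
qed

lemma lin_op_diff:
  assumes "a \<in> FA G" "b \<in> FA G"
  shows "lin_op (a - b) = lin_op a - lin_op b"
  using lin_op_add[of "a - b" G b] assms by (simp add: algebra_simps)

lemma lin_op_sum: "(\<And>i. i \<in> A \<Longrightarrow> f i \<in> FA G) \<Longrightarrow> lin_op (sum f A) = (\<Sum>i\<in>A. lin_op (f i))"
  by (induction A rule: infinite_finite_induct) (simp_all add: lin_op_add[where G = G] FA_sum)

lemma lin_op_scaleC:
  assumes "a \<in> FA G"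
  shows "lin_op a (scaleC_l2 c \<xi>) = scaleC_l2 c (lin_op a \<xi>)"
  using assms
proof (induction a rule: FA_induct)
  case (word d w)
  then show ?case by (simp add: lin_op_cscale[where G = G] word_scaleC) (rule l2_eqI, simp add: mult_ac)
next
  case (add a b)
  then show ?case
    by (simp add: lin_op_add[where G = G] plus_blinfun.rep_eq) (rule l2_eqI, simp add: algebra_simps)
qed (auto intro: l2_eqI)

lemma lin_op_fmul:
  assumes "a \<in> FA G" "b \<in> FA G"
  shows "lin_op (fmul a b) = lin_op a o\<^sub>L lin_op b"
  using assms(1)
proof (induction a rule: FA_induct)
  case (word c u)
  from assms(2) show ?case
  proof (induction b rule: FA_induct)
    case (word d v)
    then have "lin_op (fmul (cscale c (word_elt u)) (cscale d (word_elt v))) = scaleC_op (c * d) o\<^sub>L word_op (u @ v)"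
      using \<open>u \<in> words_over G\<close>
      by (simp add: lin_op_cscale[where G = G] append_in_words_over mult.commute)
    moreover have "\<dots> = lin_op (cscale c (word_elt u)) o\<^sub>L lin_op (cscale d (word_elt v))"
      using \<open>u \<in> words_over G\<close> word
      by (intro blinfun_eqI l2_eqI) (simp add: lin_op_cscale[where G = G] word_op_append word_scaleC)
    ultimately show ?case by simp
  next
    case (add a b)
    then show ?case using \<open>u \<in> words_over G\<close>
      by (simp add: fmul_distrib cscale_distrib lin_op_add[where G = G] del: fmul_cscale)
         (simp add: bounded_bilinear.add_right[OF bounded_bilinear_blinfun_compose])
  qed (auto intro: blinfun_eqI)
next
  case (add a b)
  then show ?case using assms(2)
    by (simp add: fmul_distrib lin_op_add[where G = G] bounded_bilinear.add_left[OF bounded_bilinear_blinfun_compose])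
qed (auto intro: blinfun_eqI)

lemma cinner_lin_op:
  assumes "a \<in> FA G"
  shows "cinner (lin_op a \<xi>) \<eta> = cinner \<xi> (lin_op (fstar a) \<eta>)"
  using assms
proof (induction a rule: FA_induct)
  case (word c w)
  then show ?case
    by (simp add: lin_op_cscale[where G = G] cinner_scaleC_left cinner_scaleC_right cinner_word)
qed (auto simp: lin_op_add[where G = G] plus_blinfun.rep_eq cinner_add_left cinner_add_right cinner_zero)

text \<open>
  This half of the \<open>C\<^sup>*\<close>-identity is \<open>\<parallel>T \<xi>\<parallel>\<^sup>2 = \<langle>\<xi>, T\<^sup>* T \<xi>\<rangle>\<close> together with the Cauchy-Schwarz
  inequality; the other half is submultiplicativity.
\<close>

lemma norm_lin_op_square_le:
  assumes "a \<in> FA G"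
  shows "(norm (lin_op a))\<^sup>2 \<le> norm (lin_op (fmul (fstar a) a))"
proof -
  let ?c = "norm (lin_op (fmul (fstar a) a))"
  have "norm (lin_op a) \<le> sqrt ?c"
  proof (rule norm_blinfun_bound)
    fix \<xi>
    have "(norm (lin_op a \<xi>))\<^sup>2 = Re (cinner \<xi> (lin_op (fmul (fstar a) a) \<xi>))"
      unfolding Re_cinner_self[symmetric] using assms
      by (simp add: cinner_lin_op[OF assms] lin_op_fmul[where G = G])
    also have "\<dots> = inner \<xi> (lin_op (fmul (fstar a) a) \<xi>)" by (simp add: inner_l2_def)
    also have "\<dots> \<le> norm \<xi> * norm (lin_op (fmul (fstar a) a) \<xi>)"
      by (rule norm_cauchy_schwarz)
    also have "\<dots> \<le> norm \<xi> * (?c * norm \<xi>)" by (intro mult_left_mono norm_blinfun) auto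
    also have "\<dots> = (sqrt ?c * norm \<xi>)\<^sup>2" by (simp add: power2_eq_square)
    finally show "norm (lin_op a \<xi>) \<le> sqrt ?c * norm \<xi>"
      by (rule power2_le_imp_le) simp
  qed simp
  then have "(norm (lin_op a))\<^sup>2 \<le> (sqrt ?c)\<^sup>2" by (rule power_mono) simp
  then show ?thesis by simp
qed

lemma norm_lin_op_fstar:
  assumes "a \<in> FA G"
  shows "norm (lin_op (fstar a)) = norm (lin_op a)"
proof -
  have "norm (lin_op a) \<le> norm (lin_op (fstar a))" if "a \<in> FA G" for a
  proof (cases "lin_op a = 0")
    case False
    have "norm (lin_op a) * norm (lin_op a) \<le> norm (lin_op (fstar a)) * norm (lin_op a)"
      using norm_lin_op_square_le[OF that] norm_blinfun_compose[of "lin_op (fstar a)" "lin_op a"] that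
      by (simp add: lin_op_fmul[where G = G] power2_eq_square)
    then show ?thesis using False by simp
  qed simp
  from this[of a] this[of "fstar a"] assms show ?thesis by simp
qed

lemma cstar_seminorm_lin_op: "cstar_seminorm (free_star_alg G) (\<lambda>a. norm (lin_op a))"
  unfolding cstar_seminorm_free
proof (intro conjI ballI allI)
  fix a b c assume a: "a \<in> FA G" and b: "b \<in> FA G"
  show "norm (lin_op (a + b)) \<le> norm (lin_op a) + norm (lin_op b)"
    by (simp add: lin_op_add[OF a b] norm_triangle_ineq)
  show "norm (lin_op (fmul a b)) \<le> norm (lin_op a) * norm (lin_op b)"
    by (simp add: lin_op_fmul[OF a b] norm_blinfun_compose)
next
  fix a c assume a: "a \<in> FA G"
  show "norm (lin_op (cscale c a)) = cmod c * norm (lin_op a)"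
    by (simp add: lin_op_cscale[OF a] norm_scaleC_compose)
  show "norm (lin_op (fstar a)) = norm (lin_op a)" by (rule norm_lin_op_fstar[OF a])
  show "norm (lin_op (fmul (fstar a) a)) = (norm (lin_op a))\<^sup>2"
  proof (rule antisym[OF _ norm_lin_op_square_le[OF a]])
    show "norm (lin_op (fmul (fstar a) a)) \<le> (norm (lin_op a))\<^sup>2"
      using norm_blinfun_compose[of "lin_op (fstar a)" "lin_op a"] a
      by (simp add: lin_op_fmul[where G = G] norm_lin_op_fstar[OF a] power2_eq_square)
  qed
qed auto

end

section \<open>Orthogonality of projections that sum to a projection\<close>

text \<open>
  Passing to the \<open>C\<^sup>*\<close>-algebra of a \<open>C\<^sup>*\<close>-seminorm is replaced by computing modulo the kernel of the
  seminorm, which is a \<open>*\<close>-ideal: \<open>a \<doteq> b\<close> stands for equality of the images of \<open>a\<close> and \<open>b\<close>.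
\<close>

locale free_cstar_seminorm =
  fixes G :: "'g set" and p :: "'g free \<Rightarrow> real"
  assumes cstar_seminorm: "cstar_seminorm (free_star_alg G) p"
begin

lemma
  shows p_nonneg: "a \<in> FA G \<Longrightarrow> 0 \<le> p a"
    and p_add: "a \<in> FA G \<Longrightarrow> b \<in> FA G \<Longrightarrow> p (a + b) \<le> p a + p b"
    and p_cscale: "a \<in> FA G \<Longrightarrow> p (cscale c a) = cmod c * p a"
    and p_fmul: "a \<in> FA G \<Longrightarrow> b \<in> FA G \<Longrightarrow> p (fmul a b) \<le> p a * p b"
    and p_fstar: "a \<in> FA G \<Longrightarrow> p (fstar a) = p a"
    and p_cstar: "a \<in> FA G \<Longrightarrow> p (fmul (fstar a) a) = (p a)\<^sup>2"
  using cstar_seminorm unfolding cstar_seminorm_free by blast+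

lemma p_zero [simp]: "p 0 = 0"
  using p_cscale[of 0 0] by simp

lemma p_cscale_real: "a \<in> FA G \<Longrightarrow> 0 \<le> r \<Longrightarrow> p (cscale (complex_of_real r) a) = r * p a"
  by (simp add: p_cscale)

lemma p_sum: "(\<And>i. i \<in> A \<Longrightarrow> f i \<in> FA G) \<Longrightarrow> p (sum f A) \<le> (\<Sum>i\<in>A. p (f i))"
proof (induction A rule: infinite_finite_induct)
  case (insert x F)
  then have "p (f x + sum f F) \<le> p (f x) + p (sum f F)" by (intro p_add FA_sum) auto
  with insert show ?case by simp
qed simp_all

definition cong :: "'g free \<Rightarrow> 'g free \<Rightarrow> bool" (infix \<open>\<doteq>\<close> 50) where
  "a \<doteq> b \<longleftrightarrow> a \<in> FA G \<and> b \<in> FA G \<and> p (a - b) = 0"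

lemma cong_FA: "a \<doteq> b \<Longrightarrow> a \<in> FA G" "a \<doteq> b \<Longrightarrow> b \<in> FA G"
  by (auto simp: cong_def)

lemma cong_refl [simp]: "a \<in> FA G \<Longrightarrow> a \<doteq> a"
  by (simp add: cong_def)

lemma null_add:
  assumes "a \<in> FA G" "b \<in> FA G" "p a = 0" "p b = 0"
  shows "p (a + b) = 0"
  using p_add[OF assms(1,2)] p_nonneg[of "a + b"] assms by simp

lemma cong_sym: "a \<doteq> b \<Longrightarrow> b \<doteq> a"
proof -
  assume "a \<doteq> b"
  moreover have "b - a = cscale (-1) (a - b)" by (auto simp: cscale_def pointwise)
  ultimately show "b \<doteq> a" using p_cscale[of "a - b" "-1"] by (simp add: cong_def)
qed

lemma cong_trans [trans]: "a \<doteq> b \<Longrightarrow> b \<doteq> c \<Longrightarrow> a \<doteq> c"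
  using null_add[of "a - b" "b - c"] by (simp add: cong_def)

lemma cong_eq_trans [trans]: "a \<doteq> b \<Longrightarrow> b = c \<Longrightarrow> a \<doteq> c" "a = b \<Longrightarrow> b \<doteq> c \<Longrightarrow> a \<doteq> c"
  by auto

lemma cong_zero_iff: "a \<doteq> 0 \<longleftrightarrow> a \<in> FA G \<and> p a = 0"
  by (simp add: cong_def)

lemma cong_p: "a \<doteq> b \<Longrightarrow> p a = p b"
proof -
  have "p a \<le> p b" if "a \<doteq> b" for a b
    using p_add[of "a - b" b] that by (simp add: cong_def)
  then show "a \<doteq> b \<Longrightarrow> p a = p b" using cong_sym by (metis antisym)
qed

lemma cong_add: "a \<doteq> b \<Longrightarrow> c \<doteq> d \<Longrightarrow> a + c \<doteq> b + d"
  using null_add[of "a - b" "c - d"] by (simp add: cong_def algebra_simps)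

lemma cong_cscale: "a \<doteq> b \<Longrightarrow> cscale c a \<doteq> cscale c b"
  using p_cscale[of "a - b" c] by (simp add: cong_def cscale_distrib)

lemma cong_diff: "a \<doteq> b \<Longrightarrow> c \<doteq> d \<Longrightarrow> a - c \<doteq> b - d"
  unfolding diff_eq_cscale by (intro cong_add cong_cscale)

lemma cong_fstar: "a \<doteq> b \<Longrightarrow> fstar a \<doteq> fstar b"
  using p_fstar[of "a - b"] by (simp add: cong_def)

lemma cong_fmul:
  assumes "a \<doteq> b" "c \<doteq> d"
  shows "fmul a c \<doteq> fmul b d"
proof -
  have FA: "a \<in> FA G" "b \<in> FA G" "c \<in> FA G" "d \<in> FA G" using assms cong_FA by auto
  have "p (fmul (a - b) c) = 0" "p (fmul b (c - d)) = 0"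
    using p_fmul[of "a - b" c] p_fmul[of b "c - d"] p_nonneg[of "fmul (a - b) c"]
      p_nonneg[of "fmul b (c - d)"] assms FA by (simp_all add: cong_def)
  moreover have "fmul a c - fmul b d = fmul (a - b) c + fmul b (c - d)" by (simp add: fmul_distrib)
  ultimately show ?thesis using null_add[of "fmul (a - b) c" "fmul b (c - d)"] FA
    by (simp add: cong_def)
qed

text \<open>
  The unit of a \<open>C\<^sup>*\<close>-algebra is an extreme point of the unit ball. Let \<open>S\<^sub>M\<close> be the simple random walk
  with \<open>M\<close> steps, and take the factor \<open>e + g\<close> for every step \<open>+ 1\<close> and \<open>e - g\<close> for every step \<open>- 1\<close>.
  The expectation of \<open>(c + S\<^sub>M)\<^sup>2\<close> times the product of these factors is the element \<open>A M c\<close> below, by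
  conditioning on one step, and it is bounded by the expectation \<open>c\<^sup>2 + M\<close> of \<open>(c + S\<^sub>M)\<^sup>2\<close> since the
  factors have norm at most \<open>1\<close>. For \<open>c = 0\<close> this says that \<open>M e + M (M - 1) g\<^sup>2\<close> has norm at most
  \<open>M\<close>, for all \<open>M\<close>, hence \<open>g\<^sup>2 = 0\<close>.
\<close>

lemma unit_extreme:
  assumes e: "e \<in> FA G" "fmul e e \<doteq> e"
    and g: "g \<in> FA G" "fmul e g \<doteq> g" "fmul g e \<doteq> g" "fstar g \<doteq> g"
    and le: "p (e + g) \<le> 1" "p (e - g) \<le> 1"
  shows "p g = 0"
proof -
  let ?r = "\<lambda>x::real. complex_of_real x"
  define A where "A M c = cscale (?r (c\<^sup>2 + real M)) e + cscale (?r (2 * c * real M)) g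
      + cscale (?r (real M * (real M - 1))) (fmul g g)" for M c
  define B where "B M c = cscale (?r (c\<^sup>2 + real M)) g + cscale (?r (2 * c * real M)) (fmul g g)
      + cscale (?r (real M * (real M - 1))) (fmul g (fmul g g))" for M c
  have AF: "A M c \<in> FA G" for M c unfolding A_def using e g by auto
  have pe: "p e \<le> 1"
  proof -
    have "cscale 2 e = (e + g) + (e - g)" by (auto simp: cscale_def pointwise)
    then have "2 * p e \<le> p (e + g) + p (e - g)"
      using p_add[of "e + g" "e - g"] p_cscale[OF e(1), of 2] e g by simp
    with le show ?thesis by simp
  qed
  have egg: "fmul e (fmul g g) \<doteq> fmul g g"
    using cong_fmul[OF g(2) cong_refl[OF g(1)]] by (simp add: fmul_assoc[where G = G] e g)
  have eA: "fmul e (A M c) \<doteq> A M c" for M c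
    unfolding A_def fmul_distrib fmul_cscale by (intro cong_add cong_cscale e g egg)
  have gA: "fmul g (A M c) \<doteq> B M c" for M c
    unfolding A_def B_def fmul_distrib fmul_cscale by (intro cong_add cong_cscale g cong_refl FA_fmul)
  \<comment> \<open>Conditioning on the first step of the walk.\<close>
  have step: "A (Suc M) c \<doteq> cscale (1/2) (fmul (e + g) (A M (c + 1)) + fmul (e - g) (A M (c - 1)))" for M c
  proof (rule cong_sym)
    have "cscale (1/2) (fmul (e + g) (A M (c + 1)) + fmul (e - g) (A M (c - 1)))
        \<doteq> cscale (1/2) ((A M (c + 1) + B M (c + 1)) + (A M (c - 1) - B M (c - 1)))"
      unfolding fmul_distrib by (intro cong_cscale cong_add cong_diff eA gA)
    also have "\<dots> = A (Suc M) c"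
      unfolding A_def B_def
      by (rule ext) (simp add: pointwise cscale_def field_simps power2_eq_square)
    finally show "cscale (1/2) (fmul (e + g) (A M (c + 1)) + fmul (e - g) (A M (c - 1))) \<doteq> A (Suc M) c" .
  qed
  have bound: "p (A M c) \<le> c\<^sup>2 + real M" for M c
  proof (induction M arbitrary: c)
    case 0
    have "A 0 c = cscale (?r (c\<^sup>2)) e" by (simp add: A_def)
    then have "p (A 0 c) = c\<^sup>2 * p e" using p_cscale[OF e(1)] by (simp add: norm_power)
    then show ?case using pe mult_left_mono[of "p e" 1 "c\<^sup>2"] by simp
  next
    case (Suc M)
    let ?u = "fmul (e + g) (A M (c + 1))" and ?v = "fmul (e - g) (A M (c - 1))"
    have F: "?u \<in> FA G" "?v \<in> FA G" using e g AF by auto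
    have prod: "p (fmul x (A M d)) \<le> d\<^sup>2 + real M" if "x \<in> FA G" "p x \<le> 1" for x d
    proof -
      have "p (fmul x (A M d)) \<le> p x * p (A M d)" by (rule p_fmul[OF that(1) AF])
      also have "\<dots> \<le> 1 * (d\<^sup>2 + real M)" by (intro mult_mono Suc.IH that p_nonneg AF) auto
      finally show ?thesis by simp
    qed
    have "p (A (Suc M) c) = 1/2 * p (?u + ?v)"
      using cong_p[OF step] p_cscale[of "?u + ?v" "1/2"] F by simp
    also have "\<dots> \<le> 1/2 * (p ?u + p ?v)" using p_add[OF F] by simp
    also have "\<dots> \<le> 1/2 * (((c + 1)\<^sup>2 + real M) + ((c - 1)\<^sup>2 + real M))"
      using prod[of "e + g" "c + 1"] prod[of "e - g" "c - 1"] le e g by simp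
    also have "\<dots> = c\<^sup>2 + real (Suc M)" by (simp add: power2_eq_square field_simps)
    finally show ?case .
  qed
  have gg: "p (fmul g g) = (p g)\<^sup>2"
    using cong_p[OF cong_fmul[OF g(4) cong_refl[OF g(1)]]] p_cstar[OF g(1)] by simp
  have small: "real N * (p g)\<^sup>2 \<le> 2" for N
  proof -
    let ?M = "real (Suc N)"
    have eq: "cscale (?r (?M * (?M - 1))) (fmul g g) = A (Suc N) 0 + cscale (- ?r ?M) e"
      by (rule ext) (simp add: A_def pointwise cscale_def algebra_simps)
    have "?M * (?M - 1) * (p g)\<^sup>2 = p (cscale (?r (?M * (?M - 1))) (fmul g g))"
      unfolding gg[symmetric] by (rule p_cscale_real[symmetric]) (use g(1) in auto)
    also have "\<dots> = p (A (Suc N) 0 + cscale (- ?r ?M) e)" by (simp only: eq)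
    also have "\<dots> \<le> p (A (Suc N) 0) + p (cscale (- ?r ?M) e)" by (intro p_add AF FA_cscale e)
    also have "\<dots> \<le> ?M + ?M * 1"
    proof (rule add_mono)
      show "p (A (Suc N) 0) \<le> ?M" using bound[of "Suc N" 0] by simp
      have "p (cscale (- ?r ?M) e) = ?M * p e" using p_cscale[OF e(1), of "- ?r ?M"] by (simp only: norm_minus_cancel norm_of_real)
      also have "\<dots> \<le> ?M * 1" by (intro mult_left_mono pe) simp
      finally show "p (cscale (- ?r ?M) e) \<le> ?M * 1" .
    qed
    finally have "?M * (real N * (p g)\<^sup>2) \<le> ?M * 2" by (simp add: mult.assoc)
    then show ?thesis by (rule mult_left_le_imp_le) simp
  qed
  have "(p g)\<^sup>2 \<le> 0"
  proof (rule ccontr)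
    assume "\<not> (p g)\<^sup>2 \<le> 0"
    then obtain N where "real N * (p g)\<^sup>2 > 2" using reals_Archimedean3[of "(p g)\<^sup>2"] by force
    with small[of N] show False by simp
  qed
  then show ?thesis by simp
qed

text \<open>
  Write \<open>h\<^sub>i = e f\<^sub>i e\<close> and \<open>y = (1 - f\<^sub>i) e\<close>. Then \<open>y\<^sup>* y = e y = e - h\<^sub>i\<close>, so \<open>\<parallel>y\<parallel>\<^sup>2 \<le> \<parallel>y\<parallel>\<close>
  and \<open>e - h\<^sub>i\<close> lies in the unit ball. As the \<open>h\<^sub>i\<close> sum to zero, \<open>e\<close> is the average of the elements
  \<open>e - h\<^sub>i\<close> of the unit ball, and extremality of the unit \<open>e\<close> of its corner forces \<open>h\<^sub>j = 0\<close>, that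
  is, \<open>f\<^sub>j e = 0\<close>.
\<close>

lemma projections_orthogonal:
  assumes I: "finite I" "j \<in> I"
    and e: "e \<in> FA G" "fstar e \<doteq> e" "fmul e e \<doteq> e"
    and f: "\<And>i. i \<in> I \<Longrightarrow> f i \<in> FA G" "\<And>i. i \<in> I \<Longrightarrow> fstar (f i) \<doteq> f i"
      "\<And>i. i \<in> I \<Longrightarrow> fmul (f i) (f i) \<doteq> f i"
    and zero: "(\<Sum>i\<in>I. fmul e (fmul (f i) e)) \<doteq> 0"
  shows "fmul (f j) e \<doteq> 0"
proof -
  define h where "h i = fmul e (fmul (f i) e)" for i
  have hF: "h i \<in> FA G" if "i \<in> I" for i using e f that by (auto simp: h_def)
  note assoc = fmul_assoc[where G = G]
  have pe: "p e \<le> 1"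
  proof -
    have "fmul (fstar e) e \<doteq> e" using cong_fmul[OF e(2) cong_refl[OF e(1)]] e(3) by (rule cong_trans)
    then have "p e * p e = p e" using cong_p p_cstar[OF e(1)] by (simp add: power2_eq_square)
    then have "p e = 0 \<or> p e = 1" by simp
    then show ?thesis by auto
  qed
  have fe: "fmul (fmul (fstar e) (fstar (f i))) (fmul (f i) e) \<doteq> h i" if i: "i \<in> I" for i
  proof -
    have "fmul (fmul (fstar e) (fstar (f i))) (fmul (f i) e) \<doteq> fmul (fmul e (f i)) (fmul (f i) e)"
      by (intro cong_fmul e f i cong_refl FA_fmul)
    also have "\<dots> = fmul e (fmul (fmul (f i) (f i)) e)" using e f i by (simp add: assoc)
    also have "\<dots> \<doteq> h i" unfolding h_def by (intro cong_fmul e f i cong_refl)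
    finally show ?thesis .
  qed
  have le: "p (e - h i) \<le> 1" if i: "i \<in> I" for i
  proof -
    define y where "y = e - fmul (f i) e"
    have yF: "y \<in> FA G" using e f i by (auto simp: y_def)
    have ey: "fmul e y \<doteq> e - h i"
      unfolding y_def h_def fmul_distrib by (intro cong_diff e f i cong_refl FA_fmul)
    have sy: "fstar y \<doteq> e - fmul e (f i)"
      using e f i unfolding y_def by (simp add: fstar_fmul[where G = G]) (intro cong_diff cong_fmul cong_refl e f i)
    have "fmul (fstar y) y \<doteq> fmul (e - fmul e (f i)) y" by (intro cong_fmul sy cong_refl yF)
    also have "\<dots> = (fmul e e - h i) - (h i - fmul e (fmul (fmul (f i) (f i)) e))"
      using e f i by (simp add: y_def fmul_distrib assoc h_def)
    also have "\<dots> \<doteq> (e - h i) - (h i - h i)"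
      by (intro cong_diff cong_refl hF i e) (auto simp: h_def intro!: cong_fmul cong_refl f i e)
    also have "\<dots> = e - h i" by simp
    finally have yy: "fmul (fstar y) y \<doteq> e - h i" .
    have "(p y)\<^sup>2 = p (e - h i)" using cong_p[OF yy] p_cstar[OF yF] by simp
    also have "\<dots> = p (fmul e y)" using cong_p[OF ey] by simp
    also have "\<dots> \<le> p e * p y" by (rule p_fmul[OF e(1) yF])
    also have "\<dots> \<le> 1 * p y" by (intro mult_right_mono pe p_nonneg yF)
    finally have "p y * p y \<le> 1 * p y" by (simp add: power2_eq_square)
    then have "p y \<le> 1" using p_nonneg[OF yF] by (metis mult_right_le_imp_le order_le_less zero_le_one)
    then have "(p y)\<^sup>2 \<le> 1" using p_nonneg[OF yF] by (simp add: power_le_one)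
    then show ?thesis using \<open>(p y)\<^sup>2 = p (e - h i)\<close> by simp
  qed
  have pf: "p (fmul (f j) e) = 0" if "p (h j) = 0"
  proof -
    have "(p (fmul (f j) e))\<^sup>2 = p (h j)"
      using cong_p[OF fe[OF I(2)]] p_cstar[of "fmul (f j) e"] e f I by (simp add: fstar_fmul[where G = G])
    with that show ?thesis by simp
  qed
  let ?J = "I - {j}"
  have sum: "h j + (\<Sum>i\<in>?J. h i) \<doteq> 0"
    using zero sum.remove[OF I, of h] by (simp add: h_def)
  have "p (h j) = 0"
  proof (cases "?J = {}")
    case True
    then show ?thesis using sum by (simp only: sum.empty add_0_right cong_zero_iff)
  next
    case False
    define N where "N = real (card ?J)"
    have "card ?J \<noteq> 0" using False I by (metis card_eq_0_iff finite_Diff)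
    then have N: "N \<ge> 1" unfolding N_def by linarith
    define g where "g = cscale (complex_of_real (1/N)) (h j)"
    have gF: "g \<in> FA G" using hF I by (auto simp: g_def)
    have eh: "fmul e (h j) \<doteq> h j"
      using cong_fmul[OF e(3) cong_refl, of "fmul (f j) e"] e f I by (simp add: h_def assoc)
    have he: "fmul (h j) e \<doteq> h j"
      using cong_fmul[OF cong_refl e(3), of "fmul e (f j)"] e f I by (simp add: h_def assoc)
    have hs: "fstar (h j) \<doteq> h j"
    proof -
      have "fstar (h j) = fmul (fmul (fstar e) (fstar (f j))) (fstar e)"
        using e f I by (simp add: h_def fstar_fmul[where G = G])
      also have "\<dots> \<doteq> fmul (fmul e (f j)) e" by (intro cong_fmul e f I)
      also have "\<dots> = h j" using e f I by (simp add: h_def assoc)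
      finally show ?thesis .
    qed
    \<comment> \<open>\<open>N (e + g)\<close> is the sum of the other \<open>N\<close> elements \<open>e - h i\<close>.\<close>
    have plus: "p (e + g) \<le> 1"
    proof -
      have "(\<Sum>i\<in>?J. e - h i) = cscale (complex_of_real N) e + h j - (h j + (\<Sum>i\<in>?J. h i))"
        by (rule ext) (simp add: pointwise sum_fun_apply sum_subtractf cscale_def N_def)
      also have "\<dots> \<doteq> cscale (complex_of_real N) e + h j - 0"
        by (intro cong_diff sum cong_refl) (use e hF I in auto)
      also have "\<dots> = cscale (complex_of_real N) (e + g)"
        using N by (simp add: g_def cscale_distrib)
      finally have "p (cscale (complex_of_real N) (e + g)) = p (\<Sum>i\<in>?J. e - h i)" using cong_p by force
      then have "N * p (e + g) = p (\<Sum>i\<in>?J. e - h i)" using p_cscale[of "e + g"] e gF N by simp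
      also have "\<dots> \<le> (\<Sum>i\<in>?J. p (e - h i))" by (rule p_sum) (use e hF in auto)
      also have "\<dots> \<le> (\<Sum>i\<in>?J. 1)" by (rule sum_mono) (use le in auto)
      also have "\<dots> = N * 1" by (simp add: N_def)
      finally show ?thesis using N by (simp only: mult_le_cancel_left_pos)
    qed
    \<comment> \<open>A convex combination of \<open>e\<close> and \<open>e - h j\<close>.\<close>
    have minus: "p (e - g) \<le> 1"
    proof -
      have "e - g = cscale (complex_of_real (1 - 1/N)) e + cscale (complex_of_real (1/N)) (e - h j)"
        by (rule ext) (simp add: g_def pointwise cscale_def algebra_simps)
      then have "p (e - g) \<le> p (cscale (complex_of_real (1 - 1/N)) e) + p (cscale (complex_of_real (1/N)) (e - h j))"
        using p_add e hF I by (metis FA_cscale FA_diff)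
      also have "\<dots> = (1 - 1/N) * p e + 1/N * p (e - h j)"
        using p_cscale[OF e(1), of "complex_of_real (1 - 1/N)"] p_cscale[of "e - h j" "complex_of_real (1/N)"] N e hF I
        by (simp only: norm_of_real FA_diff) simp
      also have "\<dots> \<le> (1 - 1/N) * 1 + 1/N * 1"
        using N pe le[OF I(2)] by (intro add_mono mult_left_mono) auto
      finally show ?thesis by simp
    qed
    have "p g = 0"
      by (rule unit_extreme[OF e(1,3) gF _ _ _ plus minus])
         (simp_all add: g_def, intro cong_cscale eh, intro cong_cscale he, intro cong_cscale hs)
    then show ?thesis using p_cscale[of "h j" "complex_of_real (1/N)"] hF I N by (simp add: g_def)
  qed
  with pf show ?thesis using e f I by (auto simp: cong_zero_iff)
qed

end

section \<open>Normal forms modulo the Cuntz-Krieger relations\<close>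

locale row_finite_kgraph =
  fixes k :: nat and \<Lambda> :: "'m kgraph"
  assumes hrg: "higher_rank_graph k \<Lambda>" and row_finite: "row_finite k \<Lambda>"
begin

lemma
  assumes "\<alpha> \<in> Mor \<Lambda>"
  shows rg_Mor [simp]: "rg \<Lambda> \<alpha> \<in> Mor \<Lambda>" and sc_Mor [simp]: "sc \<Lambda> \<alpha> \<in> Mor \<Lambda>"
    and rg_rg [simp]: "rg \<Lambda> (rg \<Lambda> \<alpha>) = rg \<Lambda> \<alpha>" and sc_rg [simp]: "sc \<Lambda> (rg \<Lambda> \<alpha>) = rg \<Lambda> \<alpha>"
    and rg_sc [simp]: "rg \<Lambda> (sc \<Lambda> \<alpha>) = sc \<Lambda> \<alpha>" and sc_sc [simp]: "sc \<Lambda> (sc \<Lambda> \<alpha>) = sc \<Lambda> \<alpha>"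
    and cmp_rg [simp]: "cmp \<Lambda> (rg \<Lambda> \<alpha>) \<alpha> = \<alpha>" and cmp_sc [simp]: "cmp \<Lambda> \<alpha> (sc \<Lambda> \<alpha>) = \<alpha>"
    and deg_Nk [simp]: "deg \<Lambda> \<alpha> \<in> Nk k" and deg_rg [simp]: "deg \<Lambda> (rg \<Lambda> \<alpha>) = 0"
    and deg_sc [simp]: "deg \<Lambda> (sc \<Lambda> \<alpha>) = 0"
  using hrg assms unfolding higher_rank_graph_def small_category_def degree_functor_def by blast+

lemma
  assumes "\<alpha> \<in> Mor \<Lambda>" "\<mu> \<in> Mor \<Lambda>" "sc \<Lambda> \<alpha> = rg \<Lambda> \<mu>"
  shows cmp_Mor [simp]: "cmp \<Lambda> \<alpha> \<mu> \<in> Mor \<Lambda>"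
    and rg_cmp [simp]: "rg \<Lambda> (cmp \<Lambda> \<alpha> \<mu>) = rg \<Lambda> \<alpha>"
    and sc_cmp [simp]: "sc \<Lambda> (cmp \<Lambda> \<alpha> \<mu>) = sc \<Lambda> \<mu>"
    and deg_cmp [simp]: "deg \<Lambda> (cmp \<Lambda> \<alpha> \<mu>) = deg \<Lambda> \<alpha> + deg \<Lambda> \<mu>"
  using hrg assms unfolding higher_rank_graph_def small_category_def degree_functor_def by blast+

lemma cmp_assoc:
  assumes "\<alpha> \<in> Mor \<Lambda>" "\<mu> \<in> Mor \<Lambda>" "\<nu> \<in> Mor \<Lambda>" "sc \<Lambda> \<alpha> = rg \<Lambda> \<mu>" "sc \<Lambda> \<mu> = rg \<Lambda> \<nu>"
  shows "cmp \<Lambda> (cmp \<Lambda> \<alpha> \<mu>) \<nu> = cmp \<Lambda> \<alpha> (cmp \<Lambda> \<mu> \<nu>)"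
  using hrg assms unfolding higher_rank_graph_def small_category_def by blast

text \<open>
  Either degree determines the other one, by cancellation in \<open>\<nat>\<^sup>k\<close>.
\<close>

lemma factorization_unique:
  assumes "\<mu> \<in> Mor \<Lambda>" "\<nu> \<in> Mor \<Lambda>" "sc \<Lambda> \<mu> = rg \<Lambda> \<nu>"
    and "\<mu>' \<in> Mor \<Lambda>" "\<nu>' \<in> Mor \<Lambda>" "sc \<Lambda> \<mu>' = rg \<Lambda> \<nu>'"
    and eq: "cmp \<Lambda> \<mu> \<nu> = cmp \<Lambda> \<mu>' \<nu>'" and d: "deg \<Lambda> \<mu> = deg \<Lambda> \<mu>' \<or> deg \<Lambda> \<nu> = deg \<Lambda> \<nu>'"
  shows "\<mu> = \<mu>' \<and> \<nu> = \<nu>'"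
proof -
  have sum: "deg \<Lambda> \<mu> + deg \<Lambda> \<nu> = deg \<Lambda> \<mu>' + deg \<Lambda> \<nu>'"
    using deg_cmp[OF assms(1-3)] deg_cmp[OF assms(4-6)] eq by simp
  then have d': "deg \<Lambda> \<mu> = deg \<Lambda> \<mu>'" "deg \<Lambda> \<nu> = deg \<Lambda> \<nu>'"
    using d by (metis add_left_cancel add_right_cancel)+
  have "unique_factorization k \<Lambda>" using hrg by (simp add: higher_rank_graph_def)
  moreover have "cmp \<Lambda> \<mu> \<nu> \<in> Mor \<Lambda>" "deg \<Lambda> (cmp \<Lambda> \<mu> \<nu>) = deg \<Lambda> \<mu> + deg \<Lambda> \<nu>"
    using cmp_Mor[OF assms(1-3)] deg_cmp[OF assms(1-3)] by auto
  moreover define Q where "Q = (\<lambda>(x, y). x \<in> Mor \<Lambda> \<and> y \<in> Mor \<Lambda> \<and> sc \<Lambda> x = rg \<Lambda> y \<and> cmp \<Lambda> x y = cmp \<Lambda> \<mu> \<nu>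
           \<and> deg \<Lambda> x = deg \<Lambda> \<mu> \<and> deg \<Lambda> y = deg \<Lambda> \<nu>)"
  ultimately have ex1: "\<exists>!z. Q z"
    using assms(1,2) deg_Nk unfolding unique_factorization_def by blast
  have "Q (\<mu>, \<nu>)" using assms(1-3) by (simp add: Q_def)
  moreover have "Q (\<mu>', \<nu>')" using assms(4-6) d' eq[symmetric] by (simp add: Q_def)
  ultimately have "(\<mu>, \<nu>) = (\<mu>', \<nu>')" using ex1 by (metis the1_equality)
  then show ?thesis by simp
qed

lemma factorization_exists:
  assumes "\<alpha> \<in> Mor \<Lambda>" "n \<in> Nk k" "n \<le> deg \<Lambda> \<alpha>"
  obtains \<mu> \<nu> where "\<mu> \<in> Mor \<Lambda>" "\<nu> \<in> Mor \<Lambda>" "sc \<Lambda> \<mu> = rg \<Lambda> \<nu>" "cmp \<Lambda> \<mu> \<nu> = \<alpha>"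
    "deg \<Lambda> \<mu> = n" "deg \<Lambda> \<nu> = deg \<Lambda> \<alpha> - n"
proof -
  have "unique_factorization k \<Lambda>" using hrg by (simp add: higher_rank_graph_def)
  moreover have "deg \<Lambda> \<alpha> = n + (deg \<Lambda> \<alpha> - n)"
    using assms(3) by (auto simp: fun_eq_iff le_fun_def pointwise)
  moreover have "deg \<Lambda> \<alpha> - n \<in> Nk k" using deg_Nk[OF assms(1)] by (auto simp: Nk_def pointwise)
  ultimately have "\<exists>!(\<mu>, \<nu>). \<mu> \<in> Mor \<Lambda> \<and> \<nu> \<in> Mor \<Lambda> \<and> sc \<Lambda> \<mu> = rg \<Lambda> \<nu> \<and> cmp \<Lambda> \<mu> \<nu> = \<alpha>
      \<and> deg \<Lambda> \<mu> = n \<and> deg \<Lambda> \<nu> = deg \<Lambda> \<alpha> - n"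
    using assms(1,2) unfolding unique_factorization_def by blast
  then show thesis using that by auto
qed

lemma vertices_eq: "vertices \<Lambda> = {v \<in> Mor \<Lambda>. rg \<Lambda> v = v}"
  by (rule vertices_eq_identities[OF hrg])

lemma vertexD: "v \<in> vertices \<Lambda> \<Longrightarrow> v \<in> Mor \<Lambda>" "v \<in> vertices \<Lambda> \<Longrightarrow> rg \<Lambda> v = v"
  "v \<in> vertices \<Lambda> \<Longrightarrow> sc \<Lambda> v = v"
  unfolding vertices_eq by (auto, metis sc_rg)

lemma rg_vertex [simp]: "\<alpha> \<in> Mor \<Lambda> \<Longrightarrow> rg \<Lambda> \<alpha> \<in> vertices \<Lambda>"
  and sc_vertex [simp]: "\<alpha> \<in> Mor \<Lambda> \<Longrightarrow> sc \<Lambda> \<alpha> \<in> vertices \<Lambda>"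
  by (auto simp: vertices_eq)

lemma finite_paths_to: "v \<in> vertices \<Lambda> \<Longrightarrow> n \<in> Nk k \<Longrightarrow> finite (paths_to \<Lambda> v n)"
  using row_finite by (simp add: row_finite_def)

lemma paths_toD: "\<alpha> \<in> paths_to \<Lambda> v n \<Longrightarrow> \<alpha> \<in> Mor \<Lambda> \<and> rg \<Lambda> \<alpha> = v \<and> deg \<Lambda> \<alpha> = n"
  by (auto simp: paths_to_def paths_def)

definition int_deg :: "'m \<Rightarrow> nat \<Rightarrow> int" where
  "int_deg \<alpha> = (\<lambda>i. int (deg \<Lambda> \<alpha> i))"

fun letter_degree :: "'m \<times> bool \<Rightarrow> nat \<Rightarrow> int" where
  "letter_degree (\<alpha>, e) = (if e then - int_deg \<alpha> else int_deg \<alpha>)"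

definition word_degree :: "('m \<times> bool) list \<Rightarrow> nat \<Rightarrow> int" where
  "word_degree w = (\<Sum>l\<leftarrow>w. letter_degree l)"

text \<open>
  A bound for the total degree that the starred letters of a word can remove.
\<close>

definition word_size :: "('m \<times> bool) list \<Rightarrow> nat \<Rightarrow> nat" where
  "word_size w = (\<Sum>l\<leftarrow>w. deg \<Lambda> (fst l))"

end

locale ck_seminorm = row_finite_kgraph k \<Lambda> + free_cstar_seminorm "Mor \<Lambda>" p
  for k :: nat and \<Lambda> :: "'m kgraph" and p :: "'m free \<Rightarrow> real" +
  assumes relations: "(b, c) \<in> ck_relations k \<Lambda> \<Longrightarrow> p (b - c) = 0"
begin

notation cong (infix \<open>\<doteq>\<close> 50)

abbreviation t :: "'m \<Rightarrow> 'm free" where "t \<alpha> \<equiv> fgen \<alpha>"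
abbreviation t' :: "'m \<Rightarrow> 'm free" where "t' \<alpha> \<equiv> fstar (fgen \<alpha>)"

lemmas assoc = fmul_assoc[where G = "Mor \<Lambda>"]

lemma relation_cong:
  "(b, c) \<in> ck_relations k \<Lambda> \<Longrightarrow> b \<in> FA (Mor \<Lambda>) \<Longrightarrow> c \<in> FA (Mor \<Lambda>) \<Longrightarrow> b \<doteq> c"
  by (simp add: cong_def relations)

lemma t_isometry: "\<alpha> \<in> Mor \<Lambda> \<Longrightarrow> fmul (fmul (t \<alpha>) (t' \<alpha>)) (t \<alpha>) \<doteq> t \<alpha>"
  by (rule relation_cong[OF ck_relations.partial_isometry]) auto

lemma t_vertex_star: "v \<in> vertices \<Lambda> \<Longrightarrow> t' v \<doteq> t v"
  by (rule relation_cong[OF ck_relations.vertex_selfadjoint]) (auto dest: vertexD)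

lemma t_vertex_orth: "v \<in> vertices \<Lambda> \<Longrightarrow> w \<in> vertices \<Lambda> \<Longrightarrow> v \<noteq> w \<Longrightarrow> fmul (t v) (t w) \<doteq> 0"
  by (rule relation_cong[OF ck_relations.vertex_orthogonal]) (simp_all add: vertexD(1))

lemma t_cmp: "\<alpha> \<in> Mor \<Lambda> \<Longrightarrow> \<eta> \<in> Mor \<Lambda> \<Longrightarrow> sc \<Lambda> \<alpha> = rg \<Lambda> \<eta> \<Longrightarrow> fmul (t \<alpha>) (t \<eta>) \<doteq> t (cmp \<Lambda> \<alpha> \<eta>)"
  by (rule relation_cong[OF ck_relations.product]) auto

lemma t_source: "\<alpha> \<in> Mor \<Lambda> \<Longrightarrow> fmul (t' \<alpha>) (t \<alpha>) \<doteq> t (sc \<Lambda> \<alpha>)"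
  by (rule relation_cong[OF ck_relations.source_projection]) auto

lemma t_range_sum:
  assumes "v \<in> vertices \<Lambda>" "n \<in> Nk k"
  shows "t v \<doteq> (\<Sum>\<alpha>\<in>paths_to \<Lambda> v n. fmul (t \<alpha>) (t' \<alpha>))"
  by (rule relation_cong[OF ck_relations.range_sum[OF assms]])
     (use assms in \<open>auto dest: vertexD paths_toD intro!: FA_sum\<close>)

lemma t_rg: "\<alpha> \<in> Mor \<Lambda> \<Longrightarrow> fmul (t (rg \<Lambda> \<alpha>)) (t \<alpha>) \<doteq> t \<alpha>"
  using t_cmp[of "rg \<Lambda> \<alpha>" \<alpha>] by simp

lemma t_sc: "\<alpha> \<in> Mor \<Lambda> \<Longrightarrow> fmul (t \<alpha>) (t (sc \<Lambda> \<alpha>)) \<doteq> t \<alpha>"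
  using t_cmp[of \<alpha> "sc \<Lambda> \<alpha>"] by simp

lemma t'_rg: "\<alpha> \<in> Mor \<Lambda> \<Longrightarrow> fmul (t' \<alpha>) (t (rg \<Lambda> \<alpha>)) \<doteq> t' \<alpha>"
proof -
  assume a: "\<alpha> \<in> Mor \<Lambda>"
  have "fmul (t' \<alpha>) (t (rg \<Lambda> \<alpha>)) \<doteq> fmul (t' \<alpha>) (t' (rg \<Lambda> \<alpha>))"
    using a by (intro cong_fmul cong_refl cong_sym[OF t_vertex_star]) auto
  also have "\<dots> = fstar (fmul (t (rg \<Lambda> \<alpha>)) (t \<alpha>))" using a by (simp add: fstar_fmul[where G = "Mor \<Lambda>"])
  also have "\<dots> \<doteq> t' \<alpha>" by (intro cong_fstar t_rg a)
  finally show ?thesis .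
qed

lemma t_orth_range:
  assumes "\<alpha> \<in> Mor \<Lambda>" "\<beta> \<in> Mor \<Lambda>" "rg \<Lambda> \<alpha> \<noteq> rg \<Lambda> \<beta>"
  shows "fmul (t' \<alpha>) (t \<beta>) \<doteq> 0"
proof -
  have "fmul (t' \<alpha>) (t \<beta>) \<doteq> fmul (fmul (t' \<alpha>) (t (rg \<Lambda> \<alpha>))) (fmul (t (rg \<Lambda> \<beta>)) (t \<beta>))"
    by (intro cong_fmul cong_sym[OF t'_rg] cong_sym[OF t_rg] assms)
  also have "\<dots> = fmul (t' \<alpha>) (fmul (fmul (t (rg \<Lambda> \<alpha>)) (t (rg \<Lambda> \<beta>))) (t \<beta>))"
    using assms by (simp add: assoc)
  also have "\<dots> \<doteq> fmul (t' \<alpha>) (fmul 0 (t \<beta>))"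
    using assms by (intro cong_fmul cong_refl t_vertex_orth) auto
  finally show ?thesis by simp
qed

lemma range_projection:
  assumes "\<alpha> \<in> Mor \<Lambda>"
  shows "fstar (fmul (t \<alpha>) (t' \<alpha>)) \<doteq> fmul (t \<alpha>) (t' \<alpha>)"
    and "fmul (fmul (t \<alpha>) (t' \<alpha>)) (fmul (t \<alpha>) (t' \<alpha>)) \<doteq> fmul (t \<alpha>) (t' \<alpha>)"
proof -
  show "fstar (fmul (t \<alpha>) (t' \<alpha>)) \<doteq> fmul (t \<alpha>) (t' \<alpha>)"
    using assms by (simp add: fstar_fmul[where G = "Mor \<Lambda>"])
  have "fmul (fmul (fmul (t \<alpha>) (t' \<alpha>)) (t \<alpha>)) (t' \<alpha>) \<doteq> fmul (t \<alpha>) (t' \<alpha>)"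
    using assms by (intro cong_fmul t_isometry cong_refl) auto
  then show "fmul (fmul (t \<alpha>) (t' \<alpha>)) (fmul (t \<alpha>) (t' \<alpha>)) \<doteq> fmul (t \<alpha>) (t' \<alpha>)"
    using assms by (simp add: assoc)
qed

text \<open>
  The projections \<open>t\<^sub>\<gamma> t\<^sub>\<gamma>\<^sup>*\<close> with \<open>\<gamma>\<close> in \<open>r(\<beta>)\<Lambda>\<close> of the degree of \<open>\<beta>\<close> sum to a projection that
  dominates \<open>t\<^sub>\<beta> t\<^sub>\<beta>\<^sup>*\<close>. Compressing the sum by \<open>t\<^sub>\<beta> t\<^sub>\<beta>\<^sup>*\<close> shows that the compressions of the other
  summands sum to zero, so \<open>projections_orthogonal\<close> applies. Paths with different ranges are
  separated by the vertex projections.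
\<close>

lemma t_orth:
  assumes \<alpha>: "\<alpha> \<in> Mor \<Lambda>" and \<beta>: "\<beta> \<in> Mor \<Lambda>" and d: "deg \<Lambda> \<alpha> = deg \<Lambda> \<beta>" and ne: "\<alpha> \<noteq> \<beta>"
  shows "fmul (t' \<alpha>) (t \<beta>) \<doteq> 0"
proof (cases "rg \<Lambda> \<alpha> = rg \<Lambda> \<beta>")
  case True
  define e where "e \<gamma> = fmul (t \<gamma>) (t' \<gamma>)" for \<gamma>
  let ?P = "paths_to \<Lambda> (rg \<Lambda> \<beta>) (deg \<Lambda> \<beta>)"
  have fin: "finite ?P" using \<beta> by (intro finite_paths_to) auto
  have mem: "\<alpha> \<in> ?P" "\<beta> \<in> ?P" using assms True by (auto simp: paths_to_def paths_def)
  have eF [simp]: "\<gamma> \<in> Mor \<Lambda> \<Longrightarrow> e \<gamma> \<in> FA (Mor \<Lambda>)" for \<gamma> by (simp add: e_def)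
  have tsum: "(\<Sum>\<gamma>\<in>?P. e \<gamma>) \<doteq> t (rg \<Lambda> \<beta>)"
    unfolding e_def using \<beta> by (intro cong_sym[OF t_range_sum]) auto
  have "fmul (e \<alpha>) (e \<beta>) \<doteq> 0"
  proof (rule projections_orthogonal[where f = e and I = "?P - {\<beta>}"])
    have "fmul (e \<beta>) (e \<beta>) + (\<Sum>\<gamma>\<in>?P - {\<beta>}. fmul (e \<beta>) (fmul (e \<gamma>) (e \<beta>)))
        \<doteq> fmul (e \<beta>) (fmul (e \<beta>) (e \<beta>)) + (\<Sum>\<gamma>\<in>?P - {\<beta>}. fmul (e \<beta>) (fmul (e \<gamma>) (e \<beta>)))"
      using \<beta> by (intro cong_add cong_fmul cong_sym[OF range_projection(2)[folded e_def]] cong_refl FA_sum)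
         (auto dest!: paths_toD)
    also have "\<dots> = (\<Sum>\<gamma>\<in>?P. fmul (e \<beta>) (fmul (e \<gamma>) (e \<beta>)))"
      using sum.remove[OF fin mem(2), of "\<lambda>\<gamma>. fmul (e \<beta>) (fmul (e \<gamma>) (e \<beta>))"] by simp
    also have "\<dots> = fmul (e \<beta>) (fmul (\<Sum>\<gamma>\<in>?P. e \<gamma>) (e \<beta>))" by (simp add: fmul_sum)
    also have "\<dots> \<doteq> fmul (e \<beta>) (fmul (t (rg \<Lambda> \<beta>)) (e \<beta>))"
      using \<beta> by (intro cong_fmul tsum cong_refl) auto
    also have "\<dots> = fmul (e \<beta>) (fmul (fmul (t (rg \<Lambda> \<beta>)) (t \<beta>)) (t' \<beta>))"
      using \<beta> by (simp add: e_def assoc)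
    also have "\<dots> \<doteq> fmul (e \<beta>) (fmul (t \<beta>) (t' \<beta>))"
      using \<beta> by (intro cong_fmul cong_refl t_rg) auto
    finally have "fmul (e \<beta>) (e \<beta>) + (\<Sum>\<gamma>\<in>?P - {\<beta>}. fmul (e \<beta>) (fmul (e \<gamma>) (e \<beta>))) \<doteq> fmul (e \<beta>) (e \<beta>)"
      by (simp add: e_def)
    from cong_diff[OF this cong_refl[of "fmul (e \<beta>) (e \<beta>)"]]
    show "(\<Sum>\<gamma>\<in>?P - {\<beta>}. fmul (e \<beta>) (fmul (e \<gamma>) (e \<beta>))) \<doteq> 0"
      using \<beta> by simp
  qed (use fin mem ne \<beta> range_projection[folded e_def] in \<open>auto dest: paths_toD\<close>)
  then have z: "fmul (e \<alpha>) (e \<beta>) \<doteq> 0" .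
  have "t' \<alpha> \<doteq> fstar (fmul (fmul (t \<alpha>) (t' \<alpha>)) (t \<alpha>))"
    by (intro cong_fstar cong_sym[OF t_isometry] \<alpha>)
  also have "\<dots> = fmul (t' \<alpha>) (e \<alpha>)" using \<alpha> by (simp add: fstar_fmul[where G = "Mor \<Lambda>"] e_def)
  finally have a: "t' \<alpha> \<doteq> fmul (t' \<alpha>) (e \<alpha>)" .
  have b: "t \<beta> \<doteq> fmul (e \<beta>) (t \<beta>)" unfolding e_def by (rule cong_sym[OF t_isometry[OF \<beta>]])
  have "fmul (t' \<alpha>) (t \<beta>) \<doteq> fmul (fmul (t' \<alpha>) (e \<alpha>)) (fmul (e \<beta>) (t \<beta>))" by (intro cong_fmul a b)
  also have "\<dots> = fmul (t' \<alpha>) (fmul (fmul (e \<alpha>) (e \<beta>)) (t \<beta>))" using \<alpha> \<beta> by (simp add: assoc)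
  also have "\<dots> \<doteq> fmul (t' \<alpha>) (fmul 0 (t \<beta>))" using \<alpha> \<beta> by (intro cong_fmul z cong_refl) auto
  finally show ?thesis by simp
qed (rule t_orth_range[OF \<alpha> \<beta>])

lemma p_t_le_1: "\<alpha> \<in> Mor \<Lambda> \<Longrightarrow> p (t \<alpha>) \<le> 1"
proof -
  have v: "p (t v) \<le> 1" if "v \<in> vertices \<Lambda>" for v
  proof -
    have "(p (t v))\<^sup>2 = p (t v)"
      using cong_p[OF t_source[of v]] p_cstar[of "t v"] vertexD[OF that] by simp
    then have "p (t v) = 0 \<or> p (t v) = 1" by (simp add: power2_eq_square)
    then show ?thesis by auto
  qed
  assume a: "\<alpha> \<in> Mor \<Lambda>"
  have "(p (t \<alpha>))\<^sup>2 \<le> 1" using cong_p[OF t_source[OF a]] p_cstar[of "t \<alpha>"] v[of "sc \<Lambda> \<alpha>"] a by simp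
  then have "(p (t \<alpha>))\<^sup>2 \<le> 1\<^sup>2" by simp
  then show ?thesis by (rule power2_le_imp_le) simp
qed

text \<open>
  Complex linear spans modulo the kernel of the seminorm.
\<close>

inductive cspan :: "'m free set \<Rightarrow> 'm free \<Rightarrow> bool" for U where
  null: "a \<doteq> 0 \<Longrightarrow> cspan U a"
| gen: "u \<in> U \<Longrightarrow> u \<in> FA (Mor \<Lambda>) \<Longrightarrow> cspan U u"
| add: "cspan U a \<Longrightarrow> cspan U b \<Longrightarrow> cspan U (a + b)"
| cscale: "cspan U a \<Longrightarrow> cspan U (cscale c a)"

lemma cspan_FA: "cspan U a \<Longrightarrow> a \<in> FA (Mor \<Lambda>)"
  by (induction rule: cspan.induct) (auto dest: cong_FA)

lemma cspan_cong: "cspan U a \<Longrightarrow> b \<doteq> a \<Longrightarrow> cspan U b"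
proof -
  assume a: "cspan U a" and b: "b \<doteq> a"
  have "cspan U (a + (b - a))"
    using cong_diff[OF b cong_refl[OF cspan_FA[OF a]]] by (intro cspan.add a cspan.null) simp
  then show ?thesis by simp
qed

lemma cspan_mono: "cspan U a \<Longrightarrow> U \<subseteq> U' \<Longrightarrow> cspan U' a"
  by (induction rule: cspan.induct) (auto intro: cspan.intros)

lemma cspan_sum: "(\<And>i. i \<in> A \<Longrightarrow> cspan U (f i)) \<Longrightarrow> cspan U (sum f A)"
  by (induction A rule: infinite_finite_induct) (auto intro: cspan.intros simp: cong_zero_iff)

lemma cspan_finite:
  "cspan U a \<Longrightarrow> \<exists>U'. finite U' \<and> U' \<subseteq> U \<and> cspan U' a"
proof (induction rule: cspan.induct)
  case (null a)
  then show ?case by (intro exI[of _ "{}"]) (auto intro: cspan.null)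
next
  case (gen u)
  then show ?case by (intro exI[of _ "{u}"]) (auto intro: cspan.gen)
next
  case (add a b)
  then obtain A B where "finite A" "A \<subseteq> U" "cspan A a" "finite B" "B \<subseteq> U" "cspan B b" by blast
  then show ?case by (intro exI[of _ "A \<union> B"]) (auto intro!: cspan.add elim: cspan_mono)
qed (auto intro: cspan.cscale)

lemma cspan_fmul_left:
  assumes "b \<in> FA (Mor \<Lambda>)" "\<And>u. u \<in> U \<Longrightarrow> u \<in> FA (Mor \<Lambda>) \<Longrightarrow> cspan U' (fmul b u)"
  shows "cspan U a \<Longrightarrow> cspan U' (fmul b a)"
proof (induction rule: cspan.induct)
  case (null a)
  then show ?case using cong_fmul[OF cong_refl[OF assms(1)] null] by (auto intro: cspan.null)
qed (auto simp: fmul_distrib intro: cspan.intros assms)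

lemma cspan_fmul:
  assumes "\<And>u v. u \<in> U \<Longrightarrow> v \<in> U' \<Longrightarrow> u \<in> FA (Mor \<Lambda>) \<Longrightarrow> v \<in> FA (Mor \<Lambda>) \<Longrightarrow> cspan U'' (fmul u v)"
    and b: "cspan U' b"
  shows "cspan U a \<Longrightarrow> cspan U'' (fmul a b)"
proof (induction rule: cspan.induct)
  case (null a)
  then show ?case using cong_fmul[OF null cong_refl[OF cspan_FA[OF b]]] by (auto intro: cspan.null)
next
  case (gen u)
  then show ?case using assms by (intro cspan_fmul_left[OF _ _ b]) auto
qed (auto simp: fmul_distrib intro: cspan.intros)

lemma cspan_fstar:
  assumes "\<And>u. u \<in> U \<Longrightarrow> u \<in> FA (Mor \<Lambda>) \<Longrightarrow> cspan U' (fstar u)"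
  shows "cspan U a \<Longrightarrow> cspan U' (fstar a)"
proof (induction rule: cspan.induct)
  case (null a)
  then show ?case using cong_fstar[OF null] by (auto intro: cspan.null)
qed (auto intro: cspan.intros assms)

lemma cspan_image:
  assumes "finite P" "\<And>i. i \<in> P \<Longrightarrow> f i \<in> FA (Mor \<Lambda>)"
  shows "cspan (f ` P) a \<Longrightarrow> \<exists>\<beta>. a \<doteq> (\<Sum>i\<in>P. cscale (\<beta> i) (f i))"
proof (induction rule: cspan.induct)
  case (null a)
  then show ?case by (intro exI[of _ "\<lambda>_. 0"]) simp
next
  case (gen u)
  then obtain j where j: "j \<in> P" "u = f j" by auto
  have "(\<Sum>i\<in>P. cscale (if i = j then 1 else 0) (f i)) = (\<Sum>i\<in>P. if i = j then f i else 0)"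
    by (rule sum.cong) auto
  also have "\<dots> = u" using j assms(1) by simp
  finally show ?case using gen by (intro exI[of _ "\<lambda>i. if i = j then 1 else 0"]) simp
next
  case (add a b)
  then obtain \<beta> \<gamma> where "a \<doteq> (\<Sum>i\<in>P. cscale (\<beta> i) (f i))" "b \<doteq> (\<Sum>i\<in>P. cscale (\<gamma> i) (f i))" by blast
  from cong_add[OF this] show ?case
    by (intro exI[of _ "\<lambda>i. \<beta> i + \<gamma> i"]) (simp add: cscale_distrib sum.distrib)
next
  case (cscale a c)
  then obtain \<beta> where "a \<doteq> (\<Sum>i\<in>P. cscale (\<beta> i) (f i))" by blast
  from cong_cscale[OF this, of c] show ?case by (intro exI[of _ "\<lambda>i. c * \<beta> i"]) (simp add: cscale_sum)
qed

text \<open>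
  The spanning elements \<open>t\<^sub>\<mu> t\<^sub>\<nu>\<^sup>*\<close> of degree \<open>g\<close> for which \<open>d(\<nu>)\<close> is exactly \<open>N\<close>. Fixing \<open>N\<close>
  once and for all makes the family stable under left multiplication by generators and, as long as
  \<open>d(\<mu>)\<close> is large enough, by their adjoints.
\<close>

definition units :: "(nat \<Rightarrow> nat) \<Rightarrow> (nat \<Rightarrow> int) \<Rightarrow> 'm free set" where
  "units N g = {fmul (t \<mu>) (t' \<nu>) | \<mu> \<nu>. \<mu> \<in> Mor \<Lambda> \<and> \<nu> \<in> Mor \<Lambda> \<and> sc \<Lambda> \<mu> = sc \<Lambda> \<nu>
      \<and> deg \<Lambda> \<nu> = N \<and> int_deg \<mu> = int_deg \<nu> + g}"

lemma units_left:
  assumes \<alpha>: "\<alpha> \<in> Mor \<Lambda>" and a: "cspan (units N g) a"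
  shows "cspan (units N (int_deg \<alpha> + g)) (fmul (t \<alpha>) a)"
proof (rule cspan_fmul_left[OF _ _ a])
  fix u assume "u \<in> units N g"
  then obtain \<mu> \<nu> where u: "u = fmul (t \<mu>) (t' \<nu>)" and *: "\<mu> \<in> Mor \<Lambda>" "\<nu> \<in> Mor \<Lambda>" "sc \<Lambda> \<mu> = sc \<Lambda> \<nu>"
      "deg \<Lambda> \<nu> = N" "int_deg \<mu> = int_deg \<nu> + g" by (auto simp: units_def)
  have eq: "fmul (t \<alpha>) u = fmul (fmul (t \<alpha>) (t \<mu>)) (t' \<nu>)" using \<alpha> * by (simp add: u assoc)
  show "cspan (units N (int_deg \<alpha> + g)) (fmul (t \<alpha>) u)"
  proof (cases "sc \<Lambda> \<alpha> = rg \<Lambda> \<mu>")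
    case True
    have "fmul (t \<alpha>) u \<doteq> fmul (t (cmp \<Lambda> \<alpha> \<mu>)) (t' \<nu>)"
      unfolding eq using \<alpha> * True by (intro cong_fmul t_cmp cong_refl) auto
    moreover have "fmul (t (cmp \<Lambda> \<alpha> \<mu>)) (t' \<nu>) \<in> units N (int_deg \<alpha> + g)"
      unfolding units_def using \<alpha> * True
      by (intro CollectI exI[of _ "cmp \<Lambda> \<alpha> \<mu>"] exI[of _ \<nu>]) (auto simp: int_deg_def fun_eq_iff pointwise)
    ultimately show ?thesis using cspan_cong cspan.gen cong_FA by metis
  next
    case False
    have "fmul (t \<alpha>) (t \<mu>) \<doteq> fmul (fmul (t \<alpha>) (t (sc \<Lambda> \<alpha>))) (fmul (t (rg \<Lambda> \<mu>)) (t \<mu>))"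
      using \<alpha> * by (intro cong_fmul cong_sym[OF t_sc] cong_sym[OF t_rg])
    also have "\<dots> = fmul (t \<alpha>) (fmul (fmul (t (sc \<Lambda> \<alpha>)) (t (rg \<Lambda> \<mu>))) (t \<mu>))"
      using \<alpha> * by (simp add: assoc)
    also have "\<dots> \<doteq> fmul (t \<alpha>) (fmul 0 (t \<mu>))"
      using \<alpha> * False by (intro cong_fmul t_vertex_orth cong_refl) auto
    finally have "fmul (t \<alpha>) u \<doteq> fmul 0 (t' \<nu>)"
      unfolding eq using * by (intro cong_fmul cong_refl) auto
    then show ?thesis by (intro cspan.null) simp
  qed
qed (use \<alpha> in simp)

text \<open>
  If \<open>d(\<alpha>) \<le> d(\<mu>)\<close>, then \<open>\<mu>\<close> has an initial path \<open>\<mu>1\<close> of the degree of \<open>\<alpha>\<close>, and \<open>t\<^sub>\<alpha>\<^sup>* t\<^sub>\<mu>\<close> is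
  the rest of \<open>\<mu>\<close> or zero, according to whether \<open>\<alpha> = \<mu>1\<close> or not.
\<close>

lemma units_left_star:
  assumes \<alpha>: "\<alpha> \<in> Mor \<Lambda>" and a: "cspan (units N g) a"
    and le: "\<And>i. int_deg \<alpha> i \<le> int (N i) + g i"
  shows "cspan (units N (- int_deg \<alpha> + g)) (fmul (t' \<alpha>) a)"
proof (rule cspan_fmul_left[OF _ _ a])
  fix u assume "u \<in> units N g"
  then obtain \<mu> \<nu> where u: "u = fmul (t \<mu>) (t' \<nu>)" and *: "\<mu> \<in> Mor \<Lambda>" "\<nu> \<in> Mor \<Lambda>" "sc \<Lambda> \<mu> = sc \<Lambda> \<nu>"
      "deg \<Lambda> \<nu> = N" "int_deg \<mu> = int_deg \<nu> + g" by (auto simp: units_def)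
  have "int (deg \<Lambda> \<alpha> i) \<le> int (deg \<Lambda> \<mu> i)" for i
    using le[of i] *(4) fun_cong[OF *(5), of i] by (simp add: int_deg_def pointwise)
  then have "deg \<Lambda> \<alpha> \<le> deg \<Lambda> \<mu>" by (simp add: le_fun_def)
  then obtain \<mu>1 \<mu>2 where f: "\<mu>1 \<in> Mor \<Lambda>" "\<mu>2 \<in> Mor \<Lambda>" "sc \<Lambda> \<mu>1 = rg \<Lambda> \<mu>2" "cmp \<Lambda> \<mu>1 \<mu>2 = \<mu>"
      "deg \<Lambda> \<mu>1 = deg \<Lambda> \<alpha>"
    using factorization_exists[of \<mu> "deg \<Lambda> \<alpha>"] * \<alpha> by (metis deg_Nk)
  have "fmul (t' \<alpha>) u \<doteq> fmul (t' \<alpha>) (fmul (fmul (t \<mu>1) (t \<mu>2)) (t' \<nu>))"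
    unfolding u f(4)[symmetric] using \<alpha> * f(1-3) by (intro cong_fmul cong_refl cong_sym[OF t_cmp]) auto
  also have "\<dots> = fmul (fmul (t' \<alpha>) (t \<mu>1)) (fmul (t \<mu>2) (t' \<nu>))"
    using \<alpha> * f(1-3) by (simp add: assoc)
  finally have eq: "fmul (t' \<alpha>) u \<doteq> fmul (fmul (t' \<alpha>) (t \<mu>1)) (fmul (t \<mu>2) (t' \<nu>))" .
  show "cspan (units N (- int_deg \<alpha> + g)) (fmul (t' \<alpha>) u)"
  proof (cases "\<alpha> = \<mu>1")
    case True
    note eq
    also have "fmul (fmul (t' \<alpha>) (t \<mu>1)) (fmul (t \<mu>2) (t' \<nu>)) \<doteq> fmul (t (rg \<Lambda> \<mu>2)) (fmul (t \<mu>2) (t' \<nu>))"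
      unfolding f(3)[symmetric] True using * f(1,2) by (intro cong_fmul t_source cong_refl) auto
    also have "\<dots> = fmul (fmul (t (rg \<Lambda> \<mu>2)) (t \<mu>2)) (t' \<nu>)" using * f(1,2) by (simp add: assoc)
    also have "\<dots> \<doteq> fmul (t \<mu>2) (t' \<nu>)" using * f(1,2) by (intro cong_fmul t_rg cong_refl) auto
    finally have "fmul (t' \<alpha>) u \<doteq> fmul (t \<mu>2) (t' \<nu>)" .
    moreover have "fmul (t \<mu>2) (t' \<nu>) \<in> units N (- int_deg \<alpha> + g)"
      unfolding units_def
    proof (intro CollectI exI conjI)
      show "sc \<Lambda> \<mu>2 = sc \<Lambda> \<nu>" using f * sc_cmp by metis
      have "int_deg \<mu> = int_deg \<alpha> + int_deg \<mu>2"
        using f(1,2,3,5) unfolding f(4)[symmetric] by (simp add: int_deg_def fun_eq_iff pointwise)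
      then show "int_deg \<mu>2 = int_deg \<nu> + (- int_deg \<alpha> + g)"
        unfolding *(5) by (simp add: algebra_simps)
    qed (use * f in auto)
    ultimately show ?thesis using cspan_cong cspan.gen cong_FA by metis
  next
    case False
    have "fmul (fmul (t' \<alpha>) (t \<mu>1)) (fmul (t \<mu>2) (t' \<nu>)) \<doteq> fmul 0 (fmul (t \<mu>2) (t' \<nu>))"
      using \<alpha> * f(1,2,5) False by (intro cong_fmul t_orth cong_refl) auto
    with eq have "fmul (t' \<alpha>) u \<doteq> fmul 0 (fmul (t \<mu>2) (t' \<nu>))" by (rule cong_trans)
    then show ?thesis by (intro cspan.null) simp
  qed
qed (use \<alpha> in simp)

lemma units_vertex:
  assumes "v \<in> vertices \<Lambda>" "N \<in> Nk k"
  shows "cspan (units N 0) (t v)"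
proof (rule cspan_cong[OF _ t_range_sum[OF assms]], rule cspan_sum, rule cspan.gen)
  fix \<alpha> assume "\<alpha> \<in> paths_to \<Lambda> v N"
  then have "\<alpha> \<in> Mor \<Lambda>" "deg \<Lambda> \<alpha> = N" by (auto dest: paths_toD)
  then show "fmul (t \<alpha>) (t' \<alpha>) \<in> units N 0" "fmul (t \<alpha>) (t' \<alpha>) \<in> FA (Mor \<Lambda>)"
    unfolding units_def by (auto intro!: exI[of _ \<alpha>])
qed

lemma letter_cases:
  "word_elt [(\<alpha>, e)] = (if e then t' \<alpha> else t \<alpha>)"
  by (simp add: fgen_eq_word)

lemma word_degree_Cons: "word_degree (l # w) = letter_degree l + word_degree w"
  by (simp add: word_degree_def)

lemma word_size_Cons: "word_size (l # w) = deg \<Lambda> (fst l) + word_size w"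
  by (simp add: word_size_def)

lemma word_degree_ge: "- int (word_size w i) \<le> word_degree w i"
proof (induction w)
  case (Cons l w)
  then show ?case
    by (cases l) (auto simp: word_degree_Cons word_size_Cons int_deg_def pointwise)
qed (simp add: word_degree_def word_size_def pointwise)

lemma units_letter:
  assumes "fst l \<in> Mor \<Lambda>" "cspan (units N g) a" "\<And>i. int (deg \<Lambda> (fst l) i) \<le> int (N i) + g i"
  shows "cspan (units N (letter_degree l + g)) (fmul (word_elt [l]) a)"
proof -
  obtain \<alpha> e where l: "l = (\<alpha>, e)" by fastforce
  show ?thesis
  proof (cases e)
    case True
    then show ?thesis using units_left_star[of \<alpha> N g a] assms by (simp add: l letter_cases int_deg_def)
  next
    case False
    then show ?thesis using units_left[of \<alpha> N g a] assms by (simp add: l letter_cases)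
  qed
qed

text \<open>
  The letters of the word are applied from right to left to the sum \<open>\<Sum> t\<^sub>\<mu> t\<^sub>\<mu>\<^sup>*\<close> over the paths of
  degree \<open>N\<close> into the vertex at the right end of the word. As \<open>N\<close> bounds the size of the word,
  the left legs never become too short for \<open>units_left_star\<close>.
\<close>

lemma units_word:
  assumes "w \<in> words_over (Mor \<Lambda>)" "N \<in> Nk k" "word_size w \<le> N"
  shows "cspan (units N (word_degree w)) (word_elt w)"
  using assms(1,3)
proof (induction w)
  case (Cons l w)
  obtain \<alpha> e where l: "l = (\<alpha>, e)" by fastforce
  have \<alpha>: "\<alpha> \<in> Mor \<Lambda>" using Cons.prems by (simp add: words_over_def l)
  have size: "deg \<Lambda> \<alpha> i + word_size w i \<le> N i" for i
    using Cons.prems(2) by (simp add: le_fun_def word_size_Cons l pointwise)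
  show ?case
  proof (cases "w = []")
    case True
    define v where "v = (if e then rg \<Lambda> \<alpha> else sc \<Lambda> \<alpha>)"
    have v: "v \<in> vertices \<Lambda>" using \<alpha> by (simp add: v_def)
    have "word_elt [l] \<doteq> fmul (word_elt [l]) (t v)"
      using \<alpha> by (auto simp: l letter_cases v_def intro!: cong_sym[OF t_sc] cong_sym[OF t'_rg])
    moreover have "cspan (units N (letter_degree l + 0)) (fmul (word_elt [l]) (t v))"
    proof (rule units_letter[OF _ units_vertex[OF v assms(2)]])
      show "int (deg \<Lambda> (fst l) i) \<le> int (N i) + 0 i" for i
        using size[of i] by (simp add: l pointwise)
    qed (use \<alpha> l in auto)
    ultimately show ?thesis using True by (simp add: word_degree_def cspan_cong del: letter_degree.simps)
  next
    case False
    then have w: "w \<in> words_over (Mor \<Lambda>)" using Cons.prems by (auto simp: words_over_def)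
    have "word_size w \<le> N" using size by (simp add: le_fun_def) (meson add_leD2)
    then have IH: "cspan (units N (word_degree w)) (word_elt w)" using Cons.IH w by blast
    have "cspan (units N (letter_degree l + word_degree w)) (fmul (word_elt [l]) (word_elt w))"
    proof (rule units_letter[OF _ IH])
      show "int (deg \<Lambda> (fst l) i) \<le> int (N i) + word_degree w i" for i
        using size[of i] word_degree_ge[of w i] by (simp add: l)
    qed (use \<alpha> l in auto)
    then show ?thesis by (simp add: word_degree_Cons)
  qed
qed (simp add: words_over_def)

text \<open>
  One \<open>N\<close> serves all words in the support of \<open>a\<close>.
\<close>

lemma homogeneous_normal_form:
  assumes a: "a \<in> FA (Mor \<Lambda>)" and hom: "\<And>w. a w \<noteq> 0 \<Longrightarrow> word_degree w = g"
  obtains N where "N \<in> Nk k" "cspan (units N g) a"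
proof -
  let ?S = "{w. a w \<noteq> 0}"
  have fin: "finite ?S" and sub: "?S \<subseteq> words_over (Mor \<Lambda>)" using a by (auto simp: FA_def)
  define N where "N = (\<Sum>w\<in>?S. word_size w)"
  have sz: "word_size w \<in> Nk k" if "fst ` set w \<subseteq> Mor \<Lambda>" for w
    using that
  proof (induction w)
    case (Cons l w)
    then have "deg \<Lambda> (fst l) \<in> Nk k" "word_size w \<in> Nk k" by auto
    then show ?case by (simp add: word_size_Cons Nk_def pointwise)
  qed (simp add: word_size_def Nk_def pointwise)
  have N: "N \<in> Nk k"
  proof -
    have "word_size w i = 0" if "w \<in> ?S" "i \<ge> k" for w i
      using sz[of w] that sub by (auto simp: Nk_def words_over_def)
    then show ?thesis unfolding N_def Nk_def by (auto simp: sum_fun_apply)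
  qed
  have le: "word_size w \<le> N" if "w \<in> ?S" for w
    unfolding N_def le_fun_def sum_fun_apply using fin that by (auto intro!: member_le_sum)
  have "cspan (units N g) (\<Sum>w\<in>?S. cscale (a w) (word_elt w))"
  proof (rule cspan_sum, rule cspan.cscale)
    fix w assume w: "w \<in> ?S"
    then show "cspan (units N g) (word_elt w)"
      using units_word[of w N] N le[OF w] sub hom[of w] by auto
  qed
  then show thesis using that N FA_expand[OF fin order_refl] by metis
qed

end

section \<open>Representations on graded sets with a path action\<close>

text \<open>
  After taking roots of order \<open>2\<^sup>m\<close> the factor \<open>C D\<^sup>m\<close> tends to \<open>1\<close>.
\<close>

lemma growth_bound:
  fixes x y C D :: real
  assumes "0 \<le> x" "0 \<le> y" "0 < C" "1 \<le> D" and le: "\<And>m. x ^ (2 ^ m) \<le> C * D ^ m * y ^ (2 ^ m)"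
  shows "x \<le> y"
proof (rule ccontr)
  assume "\<not> x \<le> y"
  then have xy: "y < x" by simp
  have "y \<noteq> 0" using le[of 0] xy by auto
  then have y: "0 < y" using assms by simp
  define r where "r = x / y"
  have r: "1 < r" using xy y by (simp add: r_def)
  have bound: "2 ^ m * ln r - real m * ln D \<le> ln C" for m
  proof -
    have "r ^ (2 ^ m) \<le> C * D ^ m"
      using le[of m] y by (simp add: r_def power_divide divide_le_eq)
    then have "ln (r ^ (2 ^ m)) \<le> ln (C * D ^ m)" using r assms by simp
    then show ?thesis using r assms by (simp add: ln_mult ln_realpow)
  qed
  have "ln r > 0" using r by simp
  then have "filterlim (\<lambda>m::nat. 2 ^ m * ln r - real m * ln D) at_top sequentially" by real_asymp
  then have "\<forall>\<^sub>F m::nat in sequentially. ln C + 1 \<le> 2 ^ m * ln r - real m * ln D"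
    by (simp add: filterlim_at_top)
  then obtain m :: nat where "ln C + 1 \<le> 2 ^ m * ln r - real m * ln D"
    by (meson eventually_happens trivial_limit_sequentially)
  with bound[of m] show False by simp
qed

context free_cstar_seminorm begin

text \<open>
  The iteration plays the role of powers in the spectral radius formula; it turns bounds up to a factor
  into inequalities of \<open>C\<^sup>*\<close>-seminorms.
\<close>

fun square_iter :: "nat \<Rightarrow> 'g free \<Rightarrow> 'g free" where
  "square_iter 0 a = a"
| "square_iter (Suc m) a = fmul (fstar (square_iter m a)) (square_iter m a)"

lemma square_iter_FA: "a \<in> FA G \<Longrightarrow> square_iter m a \<in> FA G"
  by (induction m) auto

lemma p_square_iter: "a \<in> FA G \<Longrightarrow> p (square_iter m a) = p a ^ (2 ^ m)"
  by (induction m) (auto simp: p_cstar square_iter_FA power_mult[symmetric] mult.commute)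

end

text \<open>
  The properties of the set of path classes along \<open>x\<close> on which the uniqueness argument rests: the graph
  acts by prepending paths, and every element has a range and a unique initial path of each degree.
  The degree \<open>dg\<close> takes negative values, as for path classes it measures the degree
  relative to a position on \<open>x\<close>.
\<close>

locale kgraph_action = row_finite_kgraph k \<Lambda> for k :: nat and \<Lambda> :: "'m kgraph" +
  fixes X :: "'x set" and ran :: "'x \<Rightarrow> 'm" and act :: "'m \<Rightarrow> 'x \<Rightarrow> 'x" and dg :: "'x \<Rightarrow> nat \<Rightarrow> int"
  assumes ran_vertex: "x \<in> X \<Longrightarrow> ran x \<in> vertices \<Lambda>"
    and act_X: "\<alpha> \<in> Mor \<Lambda> \<Longrightarrow> x \<in> X \<Longrightarrow> sc \<Lambda> \<alpha> = ran x \<Longrightarrow> act \<alpha> x \<in> X"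
    and ran_act: "\<alpha> \<in> Mor \<Lambda> \<Longrightarrow> x \<in> X \<Longrightarrow> sc \<Lambda> \<alpha> = ran x \<Longrightarrow> ran (act \<alpha> x) = rg \<Lambda> \<alpha>"
    and act_cmp: "\<alpha> \<in> Mor \<Lambda> \<Longrightarrow> \<beta> \<in> Mor \<Lambda> \<Longrightarrow> x \<in> X \<Longrightarrow> sc \<Lambda> \<alpha> = rg \<Lambda> \<beta> \<Longrightarrow> sc \<Lambda> \<beta> = ran x \<Longrightarrow>
      act (cmp \<Lambda> \<alpha> \<beta>) x = act \<alpha> (act \<beta> x)"
    and act_ran: "x \<in> X \<Longrightarrow> act (ran x) x = x"
    and act_factor: "x \<in> X \<Longrightarrow> n \<in> Nk k \<Longrightarrow>
      \<exists>\<alpha> y. \<alpha> \<in> Mor \<Lambda> \<and> y \<in> X \<and> sc \<Lambda> \<alpha> = ran y \<and> act \<alpha> y = x \<and> deg \<Lambda> \<alpha> = n"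
    and act_unique: "\<alpha> \<in> Mor \<Lambda> \<Longrightarrow> \<beta> \<in> Mor \<Lambda> \<Longrightarrow> x \<in> X \<Longrightarrow> y \<in> X \<Longrightarrow> sc \<Lambda> \<alpha> = ran x \<Longrightarrow>
      sc \<Lambda> \<beta> = ran y \<Longrightarrow> act \<alpha> x = act \<beta> y \<Longrightarrow> deg \<Lambda> \<alpha> = deg \<Lambda> \<beta> \<Longrightarrow> \<alpha> = \<beta> \<and> x = y"
    and dg_act: "\<alpha> \<in> Mor \<Lambda> \<Longrightarrow> x \<in> X \<Longrightarrow> sc \<Lambda> \<alpha> = ran x \<Longrightarrow> dg (act \<alpha> x) = int_deg \<alpha> + dg x"
    and ran_surj: "v \<in> vertices \<Lambda> \<Longrightarrow> \<exists>x\<in>X. ran x = v"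
begin

definition composable :: "'m \<Rightarrow> 'x \<Rightarrow> bool" where
  "composable \<alpha> x \<longleftrightarrow> \<alpha> \<in> Mor \<Lambda> \<and> x \<in> X \<and> sc \<Lambda> \<alpha> = ran x"

lemma act_inj: "composable \<alpha> x \<Longrightarrow> composable \<alpha> y \<Longrightarrow> act \<alpha> x = act \<alpha> y \<Longrightarrow> x = y"
  using act_unique[of \<alpha> \<alpha> x y] by (simp add: composable_def)

definition extend :: "'m \<Rightarrow> 'x \<Rightarrow> 'x option" where
  "extend \<alpha> x = (if composable \<alpha> x then Some (act \<alpha> x) else None)"

definition strip :: "'m \<Rightarrow> 'x \<Rightarrow> 'x option" where
  "strip \<alpha> y = (if \<exists>x. composable \<alpha> x \<and> act \<alpha> x = y then Some (THE x. composable \<alpha> x \<and> act \<alpha> x = y) else None)"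

lemma strip_iff: "strip \<alpha> y = Some x \<longleftrightarrow> extend \<alpha> x = Some y"
proof -
  have the: "(THE x. composable \<alpha> x \<and> act \<alpha> x = act \<alpha> z) = z" if "composable \<alpha> z" for z
    using that act_inj by (intro the_equality) auto
  show ?thesis by (auto simp: strip_def extend_def the intro: act_inj)
qed

text \<open>The generator \<open>\<alpha>\<close> itself is given by \<open>strip\<close>, since \<open>pull\<close> is contravariant.\<close>

fun letter_op :: "'m \<times> bool \<Rightarrow> 'x l2 \<Rightarrow>\<^sub>L 'x l2" where
  "letter_op (\<alpha>, e) = pull (if e then extend \<alpha> else strip \<alpha>)"

sublocale star_letters letter_op
proof
  show "cinner (letter_op (g, e) \<xi>) \<eta> = cinner \<xi> (letter_op (g, \<not> e) \<eta>)"
    for g e \<xi> \<eta>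
    by (cases e) (auto intro!: cinner_pull simp: strip_iff)
qed

lemma partial_injection_letters: "partial_injection (strip \<alpha>)" "partial_injection (extend \<alpha>)"
  by (rule partial_injectionI[of _ "extend \<alpha>"], simp add: strip_iff,
      rule partial_injectionI[of _ "strip \<alpha>"], simp add: strip_iff)

lemma coord_letter:
  "coord (letter_op (\<alpha>, False) \<xi>) y = (case strip \<alpha> y of None \<Rightarrow> 0 | Some x \<Rightarrow> coord \<xi> x)"
  "coord (letter_op (\<alpha>, True) \<xi>) x = (case extend \<alpha> x of None \<Rightarrow> 0 | Some y \<Rightarrow> coord \<xi> y)"
  by (simp_all add: coord_pull partial_injection_letters)

lemma letter_basis:
  "letter_op (\<alpha>, False) (basis_l2 x) = (if composable \<alpha> x then basis_l2 (act \<alpha> x) else 0)"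
  "composable \<alpha> x \<Longrightarrow> letter_op (\<alpha>, True) (basis_l2 (act \<alpha> x)) = basis_l2 x"
  "(\<And>x. composable \<alpha> x \<Longrightarrow> act \<alpha> x \<noteq> y) \<Longrightarrow> letter_op (\<alpha>, True) (basis_l2 y) = 0"
proof -
  have b: "strip \<alpha> (act \<alpha> x) = Some x" if "composable \<alpha> x" for x
    using that by (simp add: strip_iff extend_def)
  have b': "composable \<alpha> x \<and> act \<alpha> x = y" if "strip \<alpha> y = Some x" for x y
    using that by (simp add: strip_iff extend_def split: if_splits)
  show "letter_op (\<alpha>, False) (basis_l2 x) = (if composable \<alpha> x then basis_l2 (act \<alpha> x) else 0)"
    by (rule l2_eqI, unfold coord_letter) (auto simp: coord_basis b dest: b' split: option.splits)
  show "composable \<alpha> x \<Longrightarrow> letter_op (\<alpha>, True) (basis_l2 (act \<alpha> x)) = basis_l2 x"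
    by (rule l2_eqI, unfold coord_letter) (auto simp: coord_basis extend_def dest: act_inj)
  show "(\<And>x. composable \<alpha> x \<Longrightarrow> act \<alpha> x \<noteq> y) \<Longrightarrow> letter_op (\<alpha>, True) (basis_l2 y) = 0"
    by (rule l2_eqI, unfold coord_letter) (auto simp: coord_basis extend_def)
qed

lemma letter_outside: "x \<notin> X \<Longrightarrow> letter_op l (basis_l2 x) = 0"
proof -
  assume x: "x \<notin> X"
  obtain \<alpha> e where l: "l = (\<alpha>, e)" by fastforce
  have "act \<alpha> z \<noteq> x" if "composable \<alpha> z" for z using that x act_X by (auto simp: composable_def)
  then show ?thesis using x letter_basis(1)[of \<alpha> x] letter_basis(3)[of \<alpha> x]
    by (cases e) (auto simp: l composable_def simp del: letter_op.simps)
qed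

lemma letter_supported: "letter_op l \<xi> \<in> supported X"
proof -
  obtain \<alpha> e where l: "l = (\<alpha>, e)" by fastforce
  have "strip \<alpha> y = None" if "y \<notin> X" for y
    using that act_X unfolding strip_def composable_def by auto
  then show ?thesis unfolding l supported_def
    by (cases e) (auto simp: coord_letter extend_def composable_def simp del: letter_op.simps)
qed

lemma word_outside: "w \<noteq> [] \<Longrightarrow> x \<notin> X \<Longrightarrow> word_op w (basis_l2 x) = 0"
proof (induction w)
  case (Cons l w)
  then show ?case by (cases "w = []") (auto simp: letter_outside simp del: letter_op.simps)
qed simp

lemma word_supported: "w \<noteq> [] \<Longrightarrow> word_op w \<xi> \<in> supported X"
  by (cases w) (auto simp: letter_supported simp del: letter_op.simps)

lemma supported_add: "\<xi> \<in> supported X \<Longrightarrow> \<eta> \<in> supported X \<Longrightarrow> \<xi> + \<eta> \<in> supported X"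
  and supported_scaleC: "\<xi> \<in> supported X \<Longrightarrow> scaleC_l2 c \<xi> \<in> supported X"
  and supported_zero: "0 \<in> supported X"
  by (auto simp: supported_def)

lemma lin_op_supported: "a \<in> FA (Mor \<Lambda>) \<Longrightarrow> lin_op a \<xi> \<in> supported X"
proof (induction a rule: FA_induct)
  case (word c w)
  then show ?case using word_supported[of w \<xi>]
    by (simp add: lin_op_cscale[where G = "Mor \<Lambda>"] words_over_def supported_scaleC)
qed (auto simp: lin_op_add[where G = "Mor \<Lambda>"] plus_blinfun.rep_eq supported_add supported_zero)

lemma lin_op_outside: "a \<in> FA (Mor \<Lambda>) \<Longrightarrow> x \<notin> X \<Longrightarrow> lin_op a (basis_l2 x) = 0"
proof (induction a rule: FA_induct)
  case (word c w)
  then show ?case using word_outside[of w x]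
    by (simp add: lin_op_cscale[where G = "Mor \<Lambda>"] words_over_def) (rule l2_eqI, simp)
qed (auto simp: lin_op_add[where G = "Mor \<Lambda>"] plus_blinfun.rep_eq)

text \<open>
  Basis vectors outside \<open>X\<close> are killed, since every word has at least one letter.
\<close>

lemma lin_op_eqI:
  assumes "a \<in> FA (Mor \<Lambda>)" "b \<in> FA (Mor \<Lambda>)"
    and eq: "\<And>x. x \<in> X \<Longrightarrow> lin_op a (basis_l2 x) = lin_op b (basis_l2 x)"
  shows "lin_op a = lin_op b"
proof (rule blinfun_eqI)
  fix \<xi>
  let ?E = "{\<xi>. lin_op a \<xi> = lin_op b \<xi>}"
  have "supported UNIV \<subseteq> ?E"
  proof (rule supported_in_closed_span)
    show "closed ?E" by (intro closed_Collect_eq blinfun.continuous_on continuous_on_const continuous_on_id)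
    show "scaleC_l2 c (basis_l2 x) \<in> ?E" for c x
      using eq[of x] lin_op_outside[of _ x] assms
      by (cases "x \<in> X") (auto simp: lin_op_scaleC[where G = "Mor \<Lambda>"])
  qed (auto simp: blinfun.add_right)
  then show "lin_op a \<xi> = lin_op b \<xi>" by (auto simp: supported_def)
qed

lemma lin_op_gen:
  "lin_op (fgen \<alpha>) = letter_op (\<alpha>, False)" "lin_op (fstar (fgen \<alpha>)) = letter_op (\<alpha>, True)"
  unfolding fgen_eq_word by (auto intro!: blinfun_eqI simp del: letter_op.simps)

lemma lin_op_gen_basis:
  assumes "\<alpha> \<in> Mor \<Lambda>" "x \<in> X"
  shows "lin_op (fgen \<alpha>) (basis_l2 x) = (if sc \<Lambda> \<alpha> = ran x then basis_l2 (act \<alpha> x) else 0)"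
  using assms by (simp add: lin_op_gen letter_basis composable_def del: letter_op.simps)

lemma lin_op_star_gen_basis:
  assumes "\<alpha> \<in> Mor \<Lambda>" "x \<in> X" "sc \<Lambda> \<alpha> = ran x"
  shows "lin_op (fstar (fgen \<alpha>)) (basis_l2 (act \<alpha> x)) = basis_l2 x"
  using assms by (simp add: lin_op_gen letter_basis composable_def del: letter_op.simps)

lemma lin_op_star_gen_basis_other:
  assumes "\<beta> \<in> Mor \<Lambda>" "\<alpha> \<in> Mor \<Lambda>" "x \<in> X" "sc \<Lambda> \<alpha> = ran x" "deg \<Lambda> \<alpha> = deg \<Lambda> \<beta>" "\<alpha> \<noteq> \<beta>"
  shows "lin_op (fstar (fgen \<beta>)) (basis_l2 (act \<alpha> x)) = 0"
proof -
  have "act \<beta> y \<noteq> act \<alpha> x" if "composable \<beta> y" for y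
    using act_unique[of \<beta> \<alpha> y x] assms that by (auto simp: composable_def)
  then show ?thesis by (simp add: lin_op_gen letter_basis(3) del: letter_op.simps)
qed

text \<open>
  All relations are checked on basis vectors. The range relation holds because exactly one path of
  degree \<open>n\<close> is an initial path of a given element of \<open>X\<close>.
\<close>

lemma lin_op_relations:
  assumes "(b, c) \<in> ck_relations k \<Lambda>"
  shows "b \<in> FA (Mor \<Lambda>) \<and> c \<in> FA (Mor \<Lambda>) \<and> lin_op b = lin_op c"
proof -
  note mul = lin_op_fmul[where G = "Mor \<Lambda>"]
  have star_v: "lin_op (fstar (fgen v)) (basis_l2 x) = (if v = ran x then basis_l2 x else 0)"
    if v: "v \<in> vertices \<Lambda>" and x: "x \<in> X" for v x
  proof (cases "v = ran x")
    case True
    then show ?thesis using lin_op_star_gen_basis[of v x] vertexD[OF v] x act_ran[OF x] by simp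
  next
    case False
    have "act v y \<noteq> x" if "composable v y" for y
      using that vertexD[OF v] act_ran[of y] False by (auto simp: composable_def)
    then show ?thesis using False by (simp add: lin_op_gen letter_basis(3) del: letter_op.simps)
  qed
  have vert: "lin_op (fgen v) (basis_l2 x) = (if v = ran x then basis_l2 x else 0)"
    if v: "v \<in> vertices \<Lambda>" and x: "x \<in> X" for v x
    using lin_op_gen_basis[of v x] vertexD[OF v] x act_ran[OF x] by auto
  show ?thesis using assms
  proof cases
    case (partial_isometry \<alpha>)
    have "lin_op b = lin_op c"
      by (rule lin_op_eqI)
         (use partial_isometry in \<open>auto simp: mul lin_op_gen_basis lin_op_star_gen_basis\<close>)
    then show ?thesis using partial_isometry by auto
  next
    case (vertex_selfadjoint v)
    have "lin_op b = lin_op c"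
      by (rule lin_op_eqI) (use vertex_selfadjoint in \<open>auto simp: star_v vert vertexD(1)\<close>)
    then show ?thesis using vertex_selfadjoint by (auto simp: vertexD(1))
  next
    case (vertex_idempotent v)
    have "lin_op b = lin_op c"
      by (rule lin_op_eqI) (use vertex_idempotent in \<open>auto simp: mul vert vertexD(1)\<close>)
    then show ?thesis using vertex_idempotent by (auto simp: vertexD(1))
  next
    case (vertex_orthogonal v w)
    have "lin_op b = lin_op c"
      by (rule lin_op_eqI) (use vertex_orthogonal in \<open>auto simp: mul vert vertexD(1)\<close>)
    then show ?thesis using vertex_orthogonal by (auto simp: vertexD(1))
  next
    case (product \<alpha> \<eta>)
    have "lin_op b = lin_op c"
      by (rule lin_op_eqI)
         (use product in \<open>auto simp: mul lin_op_gen_basis act_X ran_act act_cmp\<close>)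
    then show ?thesis using product by auto
  next
    case (source_projection \<alpha>)
    have "lin_op b = lin_op c"
      by (rule lin_op_eqI)
         (use source_projection in \<open>auto simp: mul lin_op_gen_basis lin_op_star_gen_basis act_ran\<close>)
    then show ?thesis using source_projection by auto
  next
    case (range_sum v n)
    let ?P = "paths_to \<Lambda> v n"
    have fin: "finite ?P" using range_sum by (intro finite_paths_to)
    have F: "fgen v \<in> FA (Mor \<Lambda>)" "(\<Sum>\<alpha>\<in>?P. fmul (fgen \<alpha>) (fstar (fgen \<alpha>))) \<in> FA (Mor \<Lambda>)"
      using range_sum by (auto simp: vertexD(1) dest: paths_toD intro!: FA_sum)
    have "lin_op (fgen v) = lin_op (\<Sum>\<alpha>\<in>?P. fmul (fgen \<alpha>) (fstar (fgen \<alpha>)))"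
    proof (rule lin_op_eqI[OF F])
      fix x assume x: "x \<in> X"
      obtain \<beta> y where \<beta>: "\<beta> \<in> Mor \<Lambda>" "y \<in> X" "sc \<Lambda> \<beta> = ran y" "act \<beta> y = x" "deg \<Lambda> \<beta> = n"
        using act_factor[OF x range_sum(4)] by auto
      have summand: "lin_op (fmul (fgen \<alpha>) (fstar (fgen \<alpha>))) (basis_l2 x) =
          (if \<alpha> = \<beta> then basis_l2 x else 0)" if "\<alpha> \<in> ?P" for \<alpha>
      proof (cases "\<alpha> = \<beta>")
        case True
        then show ?thesis using \<beta> lin_op_star_gen_basis[OF \<beta>(1-3)] lin_op_gen_basis[OF \<beta>(1,2)]
          by (simp add: mul)
      next
        case False
        then show ?thesis using \<beta> lin_op_star_gen_basis_other[of \<alpha> \<beta> y] paths_toD[OF that]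
          by (simp add: mul)
      qed
      have "lin_op (\<Sum>\<alpha>\<in>?P. fmul (fgen \<alpha>) (fstar (fgen \<alpha>))) (basis_l2 x) =
          (\<Sum>\<alpha>\<in>?P. lin_op (fmul (fgen \<alpha>) (fstar (fgen \<alpha>))) (basis_l2 x))"
        by (subst lin_op_sum[where G = "Mor \<Lambda>"]) (auto dest: paths_toD simp: blinfun.sum_left)
      also have "\<dots> = (\<Sum>\<alpha>\<in>?P. if \<alpha> = \<beta> then basis_l2 x else 0)" by (rule sum.cong[OF refl summand])
      also have "\<dots> = (if \<beta> \<in> ?P then basis_l2 x else 0)" using fin by simp
      also have "\<beta> \<in> ?P \<longleftrightarrow> v = ran x"
        using \<beta> ran_act[OF \<beta>(1-3)] by (auto simp: paths_to_def paths_def)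
      finally show "lin_op (fgen v) (basis_l2 x) =
          lin_op (\<Sum>\<alpha>\<in>?P. fmul (fgen \<alpha>) (fstar (fgen \<alpha>))) (basis_l2 x)"
        using vert[OF range_sum(3) x] by simp
    qed
    then show ?thesis using F range_sum by simp
  qed
qed

subsection \<open>The grading\<close>

definition grade :: "(nat \<Rightarrow> int) \<Rightarrow> 'x l2 \<Rightarrow>\<^sub>L 'x l2" where
  "grade h = pull (\<lambda>x. if dg x = h then Some x else None)"

lemma coord_grade: "coord (grade h \<xi>) x = (if dg x = h then coord \<xi> x else 0)"
  unfolding grade_def
  by (subst coord_pull, rule partial_injectionI[of _ "\<lambda>x. if dg x = h then Some x else None"])
     (auto split: if_splits)

lemma norm_grade_le: "norm (grade h \<xi>) \<le> norm \<xi>"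
  unfolding grade_def
  by (rule norm_pull_le, rule partial_injectionI[of _ "\<lambda>x. if dg x = h then Some x else None"])
     (auto split: if_splits)

lemma letter_grade:
  assumes "fst l \<in> Mor \<Lambda>"
  shows "letter_op l (grade h \<xi>) =
    (grade (letter_degree l + h)) (letter_op l \<xi>)"
proof -
  obtain \<alpha> e where l: "l = (\<alpha>, e)" by fastforce
  show ?thesis
  proof (rule l2_eqI)
    fix y
    show "coord (letter_op l (grade h \<xi>)) y =
      coord ((grade (letter_degree l + h)) (letter_op l \<xi>)) y"
    proof (cases e)
      case True
      then show ?thesis
        by (auto simp: l coord_letter coord_grade extend_def dg_act composable_def algebra_simps
            simp del: letter_op.simps)
    next
      case False
      have "dg y = int_deg \<alpha> + dg x" if "strip \<alpha> y = Some x" for x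
        using that by (auto simp: strip_iff extend_def composable_def dg_act split: if_splits)
      then show ?thesis using False
        by (auto simp: l coord_letter coord_grade algebra_simps simp del: letter_op.simps split: option.splits)
    qed
  qed
qed

lemma word_grade:
  "fst ` set w \<subseteq> Mor \<Lambda> \<Longrightarrow> word_op w (grade h \<xi>) =
    (grade (word_degree w + h)) (word_op w \<xi>)"
proof (induction w)
  case (Cons l w)
  then show ?case
    by (simp add: letter_grade word_degree_def add.assoc del: letter_op.simps letter_degree.simps)
qed (simp add: word_degree_def)

definition component :: "(nat \<Rightarrow> int) \<Rightarrow> 'm free \<Rightarrow> 'm free" where
  "component g a = (\<lambda>w. if word_degree w = g then a w else 0)"

lemma component_FA: "a \<in> FA (Mor \<Lambda>) \<Longrightarrow> component g a \<in> FA (Mor \<Lambda>)"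
  unfolding FA_def component_def by (auto elim: finite_subset[rotated])

lemma component_grade:
  assumes a: "a \<in> FA (Mor \<Lambda>)"
  shows "lin_op (component g a) (grade h \<xi>) =
    (grade (g + h)) (lin_op a (grade h \<xi>))"
proof (rule l2_eqI)
  fix x
  let ?F = "{w. a w \<noteq> 0}"
  have fin: "finite ?F" and sub: "?F \<subseteq> words_over (Mor \<Lambda>)" using a by (auto simp: FA_def)
  have w: "fst ` set w \<subseteq> Mor \<Lambda>" if "w \<in> ?F" for w using that sub by (auto simp: words_over_def)
  have "coord (lin_op (component g a) (grade h \<xi>)) x =
     (\<Sum>w\<in>?F. component g a w * coord (word_op w (grade h \<xi>)) x)"
    by (subst lin_op_apply[OF fin]) (auto simp: component_def)
  also have "\<dots> = (\<Sum>w\<in>?F. if dg x = g + h then a w * coord (word_op w (grade h \<xi>)) x else 0)"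
    by (rule sum.cong) (auto simp: component_def word_grade[OF w] coord_grade)
  also have "\<dots> = coord ((grade (g + h)) (lin_op a (grade h \<xi>))) x"
    by (auto simp: coord_grade lin_op_apply[OF fin order_refl])
  finally show "coord (lin_op (component g a) (grade h \<xi>)) x =
      coord ((grade (g + h)) (lin_op a (grade h \<xi>))) x" .
qed

lemma grade_orthogonal: "g \<noteq> h \<Longrightarrow> orthogonal (grade g \<xi>) (grade h \<eta>)"
  unfolding orthogonal_def inner_l2_def cinner.rep_eq
  by (subst infsum_0) (auto simp: coord_grade)

text \<open>
  With respect to the orthogonal decomposition by degree, the component of degree \<open>g\<close> is the part of
  the block matrix of \<open>lin_op a\<close> on one diagonal. Its blocks have pairwise orthogonal domains and
  pairwise orthogonal ranges, and each of them is a compression of \<open>lin_op a\<close>.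
\<close>

lemma norm_component_le:
  assumes a: "a \<in> FA (Mor \<Lambda>)"
  shows "norm (lin_op (component g a)) \<le> norm (lin_op a)"
proof (rule norm_blinfun_bound)
  let ?T = "blinfun_apply (lin_op (component g a))" and ?c = "norm (lin_op a)"
  have fin: "norm (?T \<xi>) \<le> ?c * norm \<xi>" if \<xi>: "finite {x. coord \<xi> x \<noteq> 0}" for \<xi>
  proof -
    let ?H = "dg ` {x. coord \<xi> x \<noteq> 0}"
    have H: "finite ?H" using \<xi> by simp
    have dec: "\<xi> = (\<Sum>h\<in>?H. grade h \<xi>)"
    proof (rule l2_eqI)
      fix x
      have "coord (\<Sum>h\<in>?H. grade h \<xi>) x = (\<Sum>h\<in>?H. if h = dg x then coord \<xi> x else 0)"
        unfolding coord_sum by (rule sum.cong) (auto simp: coord_grade)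
      also have "\<dots> = coord \<xi> x" using H by (auto simp: sum.delta)
      finally show "coord \<xi> x = coord (\<Sum>h\<in>?H. grade h \<xi>) x" ..
    qed
    let ?\<eta> = "\<lambda>h. lin_op a (grade h \<xi>)"
    have "?T \<xi> = (\<Sum>h\<in>?H. (grade (g + h)) (?\<eta> h))"
      by (subst dec) (simp add: blinfun.sum_right component_grade[OF a])
    then have "(norm (?T \<xi>))\<^sup>2 = (norm (\<Sum>h\<in>?H. (grade (g + h)) (?\<eta> h)))\<^sup>2" by simp
    also have "\<dots> = (\<Sum>h\<in>?H. (norm ((grade (g + h)) (?\<eta> h)))\<^sup>2)"
      by (rule norm_sum_Pythagorean[OF H]) (auto simp: pairwise_def intro!: grade_orthogonal)
    also have "\<dots> \<le> (\<Sum>h\<in>?H. (?c * norm (grade h \<xi>))\<^sup>2)"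
      by (intro sum_mono power_mono order_trans[OF norm_grade_le norm_blinfun]) auto
    also have "\<dots> = ?c\<^sup>2 * (\<Sum>h\<in>?H. (norm (grade h \<xi>))\<^sup>2)"
      by (simp add: power_mult_distrib sum_distrib_left)
    also have "(\<Sum>h\<in>?H. (norm (grade h \<xi>))\<^sup>2) = (norm (\<Sum>h\<in>?H. grade h \<xi>))\<^sup>2"
      by (rule norm_sum_Pythagorean[OF H, symmetric]) (auto simp: pairwise_def intro!: grade_orthogonal)
    also have "(\<Sum>h\<in>?H. grade h \<xi>) = \<xi>" by (rule dec[symmetric])
    finally have "(norm (?T \<xi>))\<^sup>2 \<le> (?c * norm \<xi>)\<^sup>2" by (simp add: power_mult_distrib)
    then show ?thesis by (rule power2_le_imp_le) simp
  qed
  fix \<xi>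
  have cl: "closed {\<xi>. norm (?T \<xi>) \<le> ?c * norm \<xi>}"
    by (intro closed_Collect_le continuous_intros blinfun.continuous_on)
  have "\<xi> \<in> closure {\<xi>. norm (?T \<xi>) \<le> ?c * norm \<xi>}"
    unfolding closure_approachable
  proof (intro allI impI)
    fix e :: real assume "0 < e"
    then obtain F where F: "finite F" "norm (\<xi> - (\<Sum>x\<in>F. scaleC_l2 (coord \<xi> x) (basis_l2 x))) < e"
      by (rule finite_support_approximation)
    let ?\<zeta> = "\<Sum>x\<in>F. scaleC_l2 (coord \<xi> x) (basis_l2 x)"
    have "{x. coord ?\<zeta> x \<noteq> 0} \<subseteq> F" by (auto simp: coord_basis intro!: sum.neutral)
    then have "norm (?T ?\<zeta>) \<le> ?c * norm ?\<zeta>" by (rule fin[OF finite_subset[OF _ F(1)]])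
    then show "\<exists>\<zeta>\<in>{\<xi>. norm (?T \<xi>) \<le> ?c * norm \<xi>}. dist \<zeta> \<xi> < e"
      using F(2) by (intro bexI[of _ ?\<zeta>]) (auto simp: dist_norm norm_minus_commute)
  qed
  then show "norm (?T \<xi>) \<le> ?c * norm \<xi>" using cl by simp
qed simp

end

section \<open>The universal norm is the operator norm\<close>

text \<open>
  Assuming that \<open>p\<close> dominates the operator norm makes the representation well defined modulo the
  kernel of \<open>p\<close>.
\<close>

locale kgraph_action_seminorm = kgraph_action k \<Lambda> X ran act dg + ck_seminorm k \<Lambda> p
  for k :: nat and \<Lambda> :: "'m kgraph" and X :: "'x set" and ran act dg and p +
  assumes op_norm_le: "a \<in> FA (Mor \<Lambda>) \<Longrightarrow> norm (lin_op a) \<le> p a"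
begin

lemma cong_lin_op:
  assumes "a \<doteq> b"
  shows "lin_op a = lin_op b"
  using assms op_norm_le[of "a - b"] by (auto simp: cong_def lin_op_diff[where G = "Mor \<Lambda>"])

definition matrix_units :: "'m set \<Rightarrow> 'm free set" where
  "matrix_units P = (\<lambda>(\<mu>, \<nu>). fmul (t \<mu>) (t' \<nu>)) ` {(\<mu>, \<nu>) \<in> P \<times> P. sc \<Lambda> \<mu> = sc \<Lambda> \<nu>}"

lemma matrix_unitsI:
  "\<mu> \<in> P \<Longrightarrow> \<nu> \<in> P \<Longrightarrow> sc \<Lambda> \<mu> = sc \<Lambda> \<nu> \<Longrightarrow> fmul (t \<mu>) (t' \<nu>) \<in> matrix_units P"
  unfolding matrix_units_def by (rule image_eqI[of _ _ "(\<mu>, \<nu>)"]) auto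

text \<open>
  For \<open>y\<close> in \<open>X\<close> with range \<open>s(\<nu>)\<close> the coefficient of \<open>t\<^sub>\<mu> t\<^sub>\<nu>\<^sup>*\<close> in \<open>a\<close> is the matrix coefficient
  of \<open>lin_op a\<close> between the basis vectors of \<open>\<nu> y\<close> and \<open>\<mu> y\<close>, so it is bounded by the norm of
  \<open>lin_op a\<close>.
\<close>

lemma matrix_entries_bound:
  assumes P: "finite P" "P \<subseteq> Mor \<Lambda>" "\<And>\<mu>. \<mu> \<in> P \<Longrightarrow> deg \<Lambda> \<mu> = N"
    and a: "cspan (matrix_units P) a"
  shows "p a \<le> (real (card P))\<^sup>2 * norm (lin_op a)"
proof -
  let ?I = "{(\<mu>, \<nu>) \<in> P \<times> P. sc \<Lambda> \<mu> = sc \<Lambda> \<nu>}" and ?f = "\<lambda>(\<mu>, \<nu>). fmul (t \<mu>) (t' \<nu>)"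
  have fin: "finite ?I" by (rule finite_subset[of _ "P \<times> P"]) (use P(1) in auto)
  have F: "?f i \<in> FA (Mor \<Lambda>)" if "i \<in> ?I" for i using that P(2) by (auto simp: subset_iff)
  obtain \<beta> where \<beta>: "a \<doteq> (\<Sum>i\<in>?I. cscale (\<beta> i) (?f i))"
    using cspan_image[OF fin F a[unfolded matrix_units_def]] by (rule exE)
  have entry: "cmod (\<beta> (\<mu>, \<nu>)) \<le> norm (lin_op a)" if i: "(\<mu>, \<nu>) \<in> ?I" for \<mu> \<nu>
  proof -
    have M: "\<mu> \<in> Mor \<Lambda>" "\<nu> \<in> Mor \<Lambda>" "sc \<Lambda> \<mu> = sc \<Lambda> \<nu>" "deg \<Lambda> \<nu> = N" "deg \<Lambda> \<mu> = N" using i P by auto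
    obtain y where y: "y \<in> X" "ran y = sc \<Lambda> \<nu>" using ran_surj[OF sc_vertex[OF M(2)]] by blast
    have summand: "coord (lin_op (cscale (\<beta> j) (?f j)) (basis_l2 (act \<nu> y))) (act \<mu> y) =
        (if j = (\<mu>, \<nu>) then \<beta> j else 0)" if "j \<in> ?I" for j
    proof -
      obtain \<mu>' \<nu>' where j: "j = (\<mu>', \<nu>')" by fastforce
      have M': "\<mu>' \<in> Mor \<Lambda>" "\<nu>' \<in> Mor \<Lambda>" "sc \<Lambda> \<mu>' = sc \<Lambda> \<nu>'" "deg \<Lambda> \<nu>' = N" "deg \<Lambda> \<mu>' = N"
        using that P j by auto
      have "lin_op (fmul (t \<mu>') (t' \<nu>')) (basis_l2 (act \<nu> y)) =
          (if \<nu>' = \<nu> then basis_l2 (act \<mu>' y) else 0)"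
      proof (cases "\<nu>' = \<nu>")
        case True
        then show ?thesis using M M' y
          by (simp add: lin_op_fmul[where G = "Mor \<Lambda>"] lin_op_star_gen_basis lin_op_gen_basis)
      next
        case False
        then show ?thesis using M M' y lin_op_star_gen_basis_other[of \<nu>' \<nu> y]
          by (simp add: lin_op_fmul[where G = "Mor \<Lambda>"])
      qed
      moreover have "act \<mu> y = act \<mu>' y \<longleftrightarrow> \<mu> = \<mu>'" if "\<nu>' = \<nu>"
        using act_unique[of \<mu> \<mu>' y y] M M' y that by auto
      ultimately show ?thesis using M'
        by (auto simp: j lin_op_cscale[where G = "Mor \<Lambda>"] coord_basis)
    qed
    have "coord (lin_op a (basis_l2 (act \<nu> y))) (act \<mu> y) =
        (\<Sum>j\<in>?I. coord (lin_op (cscale (\<beta> j) (?f j)) (basis_l2 (act \<nu> y))) (act \<mu> y))"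
      unfolding cong_lin_op[OF \<beta>] using F
      by (subst lin_op_sum[where G = "Mor \<Lambda>"]) (auto simp: blinfun.sum_left)
    also have "\<dots> = (\<Sum>j\<in>?I. if j = (\<mu>, \<nu>) then \<beta> j else 0)" by (rule sum.cong[OF refl summand])
    also have "\<dots> = \<beta> (\<mu>, \<nu>)" using fin i by (simp add: sum.delta)
    finally have "cmod (\<beta> (\<mu>, \<nu>)) \<le> norm (lin_op a (basis_l2 (act \<nu> y)))"
      using norm_coord_le by metis
    also have "\<dots> \<le> norm (lin_op a)" using norm_blinfun[of "lin_op a" "basis_l2 (act \<nu> y)"] by simp
    finally show ?thesis .
  qed
  have "p a = p (\<Sum>i\<in>?I. cscale (\<beta> i) (?f i))" by (rule cong_p[OF \<beta>])
  also have "\<dots> \<le> (\<Sum>i\<in>?I. p (cscale (\<beta> i) (?f i)))" using F by (intro p_sum) auto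
  also have "\<dots> \<le> (\<Sum>i\<in>?I. norm (lin_op a))"
  proof (rule sum_mono)
    fix i assume i: "i \<in> ?I"
    obtain \<mu> \<nu> where mn: "i = (\<mu>, \<nu>)" by fastforce
    then have M: "\<mu> \<in> Mor \<Lambda>" "\<nu> \<in> Mor \<Lambda>" using i P by auto
    have "p (?f i) \<le> p (t \<mu>) * p (t' \<nu>)" using M p_fmul[of "t \<mu>" "t' \<nu>"] by (simp add: mn)
    also have "\<dots> \<le> 1 * 1" using M by (intro mult_mono) (auto simp: p_fstar p_t_le_1 p_nonneg)
    finally have "p (?f i) \<le> 1" by simp
    then have "p (cscale (\<beta> i) (?f i)) \<le> cmod (\<beta> i)"
      using p_cscale[OF F[OF i]] by (simp add: mult_left_le)
    also have "\<dots> \<le> norm (lin_op a)" using entry i mn by blast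
    finally show "p (cscale (\<beta> i) (?f i)) \<le> norm (lin_op a)" .
  qed
  also have "\<dots> = real (card ?I) * norm (lin_op a)" by simp
  also have "\<dots> \<le> (real (card P))\<^sup>2 * norm (lin_op a)"
  proof (rule mult_right_mono)
    have "card ?I \<le> card (P \<times> P)" by (rule card_mono) (use P(1) in auto)
    then show "real (card ?I) \<le> (real (card P))\<^sup>2"
      by (simp add: card_cartesian_product power2_eq_square flip: of_nat_mult)
  qed simp
  finally show ?thesis .
qed

lemma matrix_units_fmul:
  assumes P: "P \<subseteq> Mor \<Lambda>" "\<And>\<mu>. \<mu> \<in> P \<Longrightarrow> deg \<Lambda> \<mu> = N"
    and b: "cspan (matrix_units P) b"
  shows "cspan (matrix_units P) a \<Longrightarrow> cspan (matrix_units P) (fmul a b)"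
proof (rule cspan_fmul[OF _ b])
  fix u v assume "u \<in> matrix_units P" "v \<in> matrix_units P"
  then obtain \<mu> \<nu> \<mu>' \<nu>' where u: "u = fmul (t \<mu>) (t' \<nu>)" "v = fmul (t \<mu>') (t' \<nu>')"
    and *: "\<mu> \<in> P" "\<nu> \<in> P" "\<mu>' \<in> P" "\<nu>' \<in> P" "sc \<Lambda> \<mu> = sc \<Lambda> \<nu>" "sc \<Lambda> \<mu>' = sc \<Lambda> \<nu>'"
    by (auto simp: matrix_units_def)
  have M: "\<mu> \<in> Mor \<Lambda>" "\<nu> \<in> Mor \<Lambda>" "\<mu>' \<in> Mor \<Lambda>" "\<nu>' \<in> Mor \<Lambda>" using * P by auto
  have eq: "fmul u v = fmul (t \<mu>) (fmul (fmul (t' \<nu>) (t \<mu>')) (t' \<nu>'))" using M by (simp add: u assoc)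
  show "cspan (matrix_units P) (fmul u v)"
  proof (cases "\<nu> = \<mu>'")
    case True
    have "fmul u v \<doteq> fmul (t \<mu>) (fmul (t (sc \<Lambda> \<mu>)) (t' \<nu>'))"
      unfolding eq True[symmetric] *(5) using M by (intro cong_fmul cong_refl t_source) auto
    also have "\<dots> = fmul (fmul (t \<mu>) (t (sc \<Lambda> \<mu>))) (t' \<nu>')" using M by (simp add: assoc)
    also have "\<dots> \<doteq> fmul (t \<mu>) (t' \<nu>')" using M by (intro cong_fmul t_sc cong_refl) auto
    finally have "fmul u v \<doteq> fmul (t \<mu>) (t' \<nu>')" .
    moreover have "cspan (matrix_units P) (fmul (t \<mu>) (t' \<nu>'))"
    proof (rule cspan.gen[OF matrix_unitsI[OF *(1,4)]])
      show "sc \<Lambda> \<mu> = sc \<Lambda> \<nu>'" using *(5,6) True by simp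
      show "fmul (t \<mu>) (t' \<nu>') \<in> FA (Mor \<Lambda>)" using M by simp
    qed
    ultimately show ?thesis by (rule cspan_cong[rotated])
  next
    case False
    have "fmul u v \<doteq> fmul (t \<mu>) (fmul 0 (t' \<nu>'))"
      unfolding eq using M False P(2) * by (intro cong_fmul cong_refl t_orth) auto
    then show ?thesis by (intro cspan.null) simp
  qed
qed

lemma matrix_units_fstar:
  assumes P: "P \<subseteq> Mor \<Lambda>"
  shows "cspan (matrix_units P) a \<Longrightarrow> cspan (matrix_units P) (fstar a)"
proof (rule cspan_fstar)
  fix u assume "u \<in> matrix_units P"
  then obtain \<mu> \<nu> where u: "u = fmul (t \<mu>) (t' \<nu>)"
    and *: "\<mu> \<in> P" "\<nu> \<in> P" "sc \<Lambda> \<mu> = sc \<Lambda> \<nu>" by (auto simp: matrix_units_def)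
  have M: "\<mu> \<in> Mor \<Lambda>" "\<nu> \<in> Mor \<Lambda>" using * P by auto
  have "fstar u = fmul (t \<nu>) (t' \<mu>)" using M by (simp add: u fstar_fmul[where G = "Mor \<Lambda>"])
  then show "cspan (matrix_units P) (fstar u)"
    using * M by (intro cspan.gen) (auto intro: matrix_unitsI)
qed

lemma op_seminorm: "free_cstar_seminorm (Mor \<Lambda>) (\<lambda>a. norm (lin_op a))"
  by standard (rule cstar_seminorm_lin_op)

lemma op_square_iter: "a \<in> FA (Mor \<Lambda>) \<Longrightarrow> norm (lin_op (square_iter m a)) = norm (lin_op a) ^ (2 ^ m)"
  using free_cstar_seminorm.p_square_iter[OF op_seminorm, of a m] by simp

text \<open>
  The matrix units over a finite set of paths of one degree span a \<open>*\<close>-algebra, so one and the same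
  constant works for all iterates.
\<close>

lemma degree_zero_bound:
  assumes a: "a \<in> FA (Mor \<Lambda>)" and hom: "\<And>w. a w \<noteq> 0 \<Longrightarrow> word_degree w = 0"
  shows "p a \<le> norm (lin_op a)"
proof -
  obtain N where N: "N \<in> Nk k" "cspan (units N 0) a" using homogeneous_normal_form[OF a hom] by blast
  obtain U where U: "finite U" "U \<subseteq> units N 0" "cspan U a" using cspan_finite[OF N(2)] by blast
  have "\<forall>u\<in>U. \<exists>\<mu> \<nu>. u = fmul (t \<mu>) (t' \<nu>) \<and> \<mu> \<in> Mor \<Lambda> \<and> \<nu> \<in> Mor \<Lambda> \<and> sc \<Lambda> \<mu> = sc \<Lambda> \<nu> \<and> deg \<Lambda> \<nu> = N \<and> deg \<Lambda> \<mu> = N"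
    using U(2) by (fastforce simp: units_def int_deg_def fun_eq_iff)
  then obtain l r where lr: "\<And>u. u \<in> U \<Longrightarrow> u = fmul (t (l u)) (t' (r u)) \<and> l u \<in> Mor \<Lambda> \<and> r u \<in> Mor \<Lambda>
      \<and> sc \<Lambda> (l u) = sc \<Lambda> (r u) \<and> deg \<Lambda> (r u) = N \<and> deg \<Lambda> (l u) = N" by metis
  define P where "P = l ` U \<union> r ` U"
  have P: "finite P" "P \<subseteq> Mor \<Lambda>" "\<And>\<mu>. \<mu> \<in> P \<Longrightarrow> deg \<Lambda> \<mu> = N" using U lr by (auto simp: P_def)
  have "U \<subseteq> matrix_units P"
  proof
    fix u assume u: "u \<in> U"
    then show "u \<in> matrix_units P"
      using lr[OF u] matrix_unitsI[of "l u" P "r u"] by (auto simp: P_def)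
  qed
  then have "cspan (matrix_units P) a" using cspan_mono U by blast
  then have span: "cspan (matrix_units P) (square_iter m a)" for m
    by (induction m) (auto intro!: matrix_units_fmul[OF P(2,3)] matrix_units_fstar[OF P(2)])
  \<comment> \<open>The summand \<open>1\<close> keeps the constant positive when \<open>P\<close> is empty.\<close>
  define C where "C = (real (card P))\<^sup>2 + 1"
  have "0 \<le> (real (card P))\<^sup>2" by simp
  then have C: "C > 0" unfolding C_def by (rule add_nonneg_pos) simp
  show ?thesis
  proof (rule growth_bound[OF p_nonneg[OF a] norm_ge_zero C order_refl])
    fix m
    have "p a ^ 2 ^ m = p (square_iter m a)" by (rule p_square_iter[OF a, symmetric])
    also have "\<dots> \<le> (real (card P))\<^sup>2 * norm (lin_op (square_iter m a))" by (rule matrix_entries_bound[OF P span])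
    also have "\<dots> \<le> C * norm (lin_op (square_iter m a))" by (intro mult_right_mono) (auto simp: C_def)
    finally show "p a ^ 2 ^ m \<le> C * 1 ^ m * norm (lin_op a) ^ 2 ^ m" by (simp add: op_square_iter[OF a])
  qed
qed

lemma fmul_support: "fmul a b w \<noteq> 0 \<Longrightarrow> \<exists>u v. w = u @ v \<and> a u \<noteq> 0 \<and> b v \<noteq> 0"
proof (rule ccontr)
  assume nz: "fmul a b w \<noteq> 0" and no: "\<nexists>u v. w = u @ v \<and> a u \<noteq> 0 \<and> b v \<noteq> 0"
  have "a (take i w) * b (drop i w) = 0" for i using no by (metis append_take_drop_id mult_eq_0_iff)
  then have "fmul a b w = 0" unfolding fmul_def by (intro sum.neutral) blast
  then show False using nz by simp
qed

lemma word_degree_append: "word_degree (u @ v) = word_degree u + word_degree v"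
  by (simp add: word_degree_def)

lemma word_degree_flip: "word_degree (flip_word w) = - word_degree w"
proof (induction w)
  case (Cons l w)
  obtain \<alpha> e where l: "l = (\<alpha>, e)" by fastforce
  have "flip_word (l # w) = flip_word w @ [(\<alpha>, \<not> e)]" by (simp add: l flip_word_def)
  moreover have "word_degree [(\<alpha>, \<not> e)] = - letter_degree l" by (simp add: word_degree_def l)
  ultimately show ?case using Cons by (simp only: word_degree_append word_degree_Cons) simp
qed (simp add: word_degree_def flip_word_def)

text \<open>
  If \<open>c\<close> is homogeneous, then \<open>c\<^sup>* c\<close> has degree zero.
\<close>

lemma component_bound:
  assumes a: "a \<in> FA (Mor \<Lambda>)"
  shows "p (component g a) \<le> norm (lin_op a)"
proof -
  let ?c = "component g a"
  have c: "?c \<in> FA (Mor \<Lambda>)" by (rule component_FA[OF a])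
  have "p (fmul (fstar ?c) ?c) \<le> norm (lin_op (fmul (fstar ?c) ?c))"
  proof (rule degree_zero_bound)
    fix w assume "fmul (fstar ?c) ?c w \<noteq> 0"
    then obtain u v where "w = u @ v" "fstar ?c u \<noteq> 0" "?c v \<noteq> 0" using fmul_support by blast
    then show "word_degree w = 0"
      by (auto simp: word_degree_append fstar_apply component_def word_degree_flip split: if_splits)
  qed (use c in auto)
  then have "(p ?c)\<^sup>2 \<le> (norm (lin_op ?c))\<^sup>2"
    using p_cstar[OF c] free_cstar_seminorm.p_cstar[OF op_seminorm c] by simp
  then have "p ?c \<le> norm (lin_op ?c)" by (rule power2_le_imp_le) simp
  also have "\<dots> \<le> norm (lin_op a)" by (rule norm_component_le[OF a])
  finally show ?thesis .
qed

text \<open>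
  The iteration doubles the side of the box that contains the degrees, so the number of degrees grows
  exponentially in \<open>m\<close>, which is what \<open>growth_bound\<close> tolerates.
\<close>

definition degree_box :: "nat \<Rightarrow> (nat \<Rightarrow> int) set" where
  "degree_box L = {g. (\<forall>i<k. \<bar>g i\<bar> \<le> int L) \<and> (\<forall>i\<ge>k. g i = 0)}"

lemma degree_box_card: "finite (degree_box L) \<and> card (degree_box L) \<le> (2 * L + 1) ^ k"
proof -
  let ?E = "PiE {..<k} (\<lambda>_. {- int L..int L})"
  have inj: "inj_on (\<lambda>g. restrict g {..<k}) (degree_box L)"
  proof (rule inj_onI, rule ext)
    fix g h i assume *: "g \<in> degree_box L" "h \<in> degree_box L" "restrict g {..<k} = restrict h {..<k}"
    show "g i = h i"
    proof (cases "i < k")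
      case True
      then show ?thesis using fun_cong[OF *(3), of i] by simp
    next
      case False
      then show ?thesis using * by (simp add: degree_box_def)
    qed
  qed
  have sub: "(\<lambda>g. restrict g {..<k}) ` degree_box L \<subseteq> ?E"
    by (intro image_subsetI PiE_I) (auto simp: degree_box_def abs_le_iff)
  have fin: "finite ?E" by (rule finite_PiE) auto
  have "card ?E = (2 * L + 1) ^ k" by (subst card_PiE) (auto simp: nat_add_distrib nat_mult_distrib)
  then show ?thesis
    using finite_imageD[OF finite_subset[OF sub fin] inj] card_inj_on_le[OF inj sub fin] by simp
qed

lemma box_bound:
  assumes a: "a \<in> FA (Mor \<Lambda>)" and box: "\<And>w. a w \<noteq> 0 \<Longrightarrow> word_degree w \<in> degree_box L"
  shows "p a \<le> real ((2 * L + 1) ^ k) * norm (lin_op a)"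
proof -
  note fin = degree_box_card[of L, THEN conjunct1]
  have dec: "a = (\<Sum>g\<in>degree_box L. component g a)"
  proof
    fix w
    have "(\<Sum>g\<in>degree_box L. component g a) w = (\<Sum>g\<in>degree_box L. if g = word_degree w then a w else 0)"
      unfolding sum_fun_apply by (rule sum.cong) (auto simp: component_def)
    also have "\<dots> = a w" using fin box[of w] by (auto simp: sum.delta)
    finally show "a w = (\<Sum>g\<in>degree_box L. component g a) w" ..
  qed
  have "p a = p (\<Sum>g\<in>degree_box L. component g a)" using dec by simp
  also have "\<dots> \<le> (\<Sum>g\<in>degree_box L. p (component g a))" by (rule p_sum) (rule component_FA[OF a])
  also have "\<dots> \<le> (\<Sum>g\<in>degree_box L. norm (lin_op a))" by (rule sum_mono) (rule component_bound[OF a])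
  also have "\<dots> = real (card (degree_box L)) * norm (lin_op a)" by simp
  also have "\<dots> \<le> real ((2 * L + 1) ^ k) * norm (lin_op a)"
    by (rule mult_right_mono) (use degree_box_card[of L] of_nat_le_iff in blast, simp)
  finally show ?thesis .
qed

lemma square_iter_box:
  assumes a: "a \<in> FA (Mor \<Lambda>)" and box: "\<And>w. a w \<noteq> 0 \<Longrightarrow> word_degree w \<in> degree_box L"
  shows "square_iter m a w \<noteq> 0 \<Longrightarrow> word_degree w \<in> degree_box (L * 2 ^ m)"
proof (induction m arbitrary: w)
  case (Suc m)
  then obtain u v where w: "w = u @ v" and u: "square_iter m a (flip_word u) \<noteq> 0" and v: "square_iter m a v \<noteq> 0"
    using fmul_support[of "fstar (square_iter m a)" "square_iter m a" w] by (auto simp: fstar_apply)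
  have uv: "word_degree (flip_word u) \<in> degree_box (L * 2 ^ m)" "word_degree v \<in> degree_box (L * 2 ^ m)"
    using Suc.IH u v by auto
  show ?case unfolding degree_box_def
  proof (intro CollectI conjI allI impI)
    fix i assume "i < k"
    then have "\<bar>word_degree u i\<bar> \<le> int (L * 2 ^ m)" "\<bar>word_degree v i\<bar> \<le> int (L * 2 ^ m)"
      using uv by (auto simp: degree_box_def word_degree_flip pointwise)
    then show "\<bar>word_degree w i\<bar> \<le> int (L * 2 ^ Suc m)" by (simp add: w word_degree_append pointwise)
  next
    fix i assume "k \<le> i"
    then show "word_degree w i = 0"
      using uv by (auto simp: degree_box_def word_degree_flip w word_degree_append pointwise)
  qed
qed (use box in simp)

text \<open>
  If the degrees in \<open>a\<close> lie in the box of size \<open>L\<close>, those in the \<open>m\<close>-th iterate lie in the box of size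
  \<open>L 2\<^sup>m\<close>, which has at most \<open>((2 L + 1) 2\<^sup>m)\<^sup>k\<close> elements. So \<open>growth_bound\<close> applies with
  \<open>C = (2 L + 1)\<^sup>k\<close> and \<open>D = 2\<^sup>k\<close>.
\<close>

theorem seminorm_le_op_norm:
  assumes a: "a \<in> FA (Mor \<Lambda>)"
  shows "p a \<le> norm (lin_op a)"
proof -
  let ?S = "{w. a w \<noteq> 0}"
  have fin: "finite ?S" and sub: "?S \<subseteq> words_over (Mor \<Lambda>)" using a by (auto simp: FA_def)
  define L where "L = (\<Sum>w\<in>?S. \<Sum>i<k. nat \<bar>word_degree w i\<bar>)"
  have box: "word_degree w \<in> degree_box L" if w: "a w \<noteq> 0" for w
    unfolding degree_box_def
  proof (intro CollectI conjI allI impI)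
    fix i assume i: "i < k"
    have "nat \<bar>word_degree w i\<bar> \<le> (\<Sum>i<k. nat \<bar>word_degree w i\<bar>)" using i by (intro member_le_sum) auto
    also have "\<dots> \<le> L" unfolding L_def
      using fin w member_le_sum[of w ?S "\<lambda>w. \<Sum>i<k. nat \<bar>word_degree w i\<bar>"] by simp
    finally show "\<bar>word_degree w i\<bar> \<le> int L" by linarith
  next
    fix i assume i: "k \<le> i"
    have "fst ` set w \<subseteq> Mor \<Lambda>" using sub w by (auto simp: words_over_def)
    then show "word_degree w i = 0"
    proof (induction w)
      case (Cons l w)
      obtain \<alpha> e where l: "l = (\<alpha>, e)" by fastforce
      have "deg \<Lambda> \<alpha> \<in> Nk k" using Cons.prems by (simp add: l)
      then show ?case using Cons i by (auto simp: word_degree_Cons l pointwise int_deg_def Nk_def)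
    qed (simp add: word_degree_def pointwise)
  qed
  show ?thesis
  proof (rule growth_bound[OF p_nonneg[OF a] norm_ge_zero])
    show "(0::real) < real (2 * L + 1) ^ k" by simp
    show "(1::real) \<le> 2 ^ k" by simp
    fix m
    have "p a ^ 2 ^ m = p (square_iter m a)" by (rule p_square_iter[OF a, symmetric])
    also have "\<dots> \<le> real ((2 * (L * 2 ^ m) + 1) ^ k) * norm (lin_op (square_iter m a))"
      by (rule box_bound[OF square_iter_FA[OF a] square_iter_box[OF a box]])
    also have "\<dots> \<le> real (((2 * L + 1) * 2 ^ m) ^ k) * norm (lin_op (square_iter m a))"
    proof (rule mult_right_mono)
      have "2 * (L * 2 ^ m) + 1 \<le> (2 * L + 1) * 2 ^ m" by (simp add: algebra_simps)
      then show "real ((2 * (L * 2 ^ m) + 1) ^ k) \<le> real (((2 * L + 1) * 2 ^ m) ^ k)"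
        by (intro of_nat_mono power_mono) auto
    qed simp
    also have "real (((2 * L + 1) * 2 ^ m) ^ k) = real (2 * L + 1) ^ k * (2 ^ k) ^ m"
      by (simp only: of_nat_power of_nat_mult of_nat_numeral power_mult_distrib power_mult[symmetric] mult.commute)
    finally show "p a ^ 2 ^ m \<le> real (2 * L + 1) ^ k * (2 ^ k) ^ m * norm (lin_op a) ^ 2 ^ m"
      by (simp add: op_square_iter[OF a])
  qed
qed

end

context kgraph_action begin

text \<open>
  The operator norm is itself one of the seminorms in the supremum. Any other one is compared with the
  operator norm through the maximum of the two, which is again a \<open>C\<^sup>*\<close>-seminorm.
\<close>

theorem universal_seminorm_eq_op_norm:
  assumes a: "a \<in> FA (Mor \<Lambda>)"
  shows "universal_seminorm (Mor \<Lambda>) (ck_relations k \<Lambda>) a = norm (lin_op a)"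
  unfolding universal_seminorm_def
proof (rule cSup_eq_maximum)
  let ?q = "\<lambda>a. norm (lin_op a)"
  have rel: "?q (b - c) = 0" if "(b, c) \<in> ck_relations k \<Lambda>" for b c
    using lin_op_relations[OF that] by (simp add: lin_op_diff[where G = "Mor \<Lambda>"])
  show "norm (lin_op a) \<in> (\<lambda>p. p a) ` {p. cstar_seminorm (free_star_alg (Mor \<Lambda>)) p \<and>
      (\<forall>(b, c)\<in>ck_relations k \<Lambda>. p (b - c) = 0)}"
    using cstar_seminorm_lin_op rel by (intro image_eqI[of _ _ ?q]) auto
  fix y assume "y \<in> (\<lambda>p. p a) ` {p. cstar_seminorm (free_star_alg (Mor \<Lambda>)) p \<and>
      (\<forall>(b, c)\<in>ck_relations k \<Lambda>. p (b - c) = 0)}"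
  then obtain p where y: "y = p a" and p: "cstar_seminorm (free_star_alg (Mor \<Lambda>)) p"
    and prel: "\<And>b c. (b, c) \<in> ck_relations k \<Lambda> \<Longrightarrow> p (b - c) = 0" by auto
  interpret p: free_cstar_seminorm "Mor \<Lambda>" p by standard (rule p)
  interpret q: free_cstar_seminorm "Mor \<Lambda>" ?q by standard (rule cstar_seminorm_lin_op)
  \<comment> \<open>Enlarging the seminorm does not change its being one of the competitors.\<close>
  define r where "r a = max (p a) (?q a)" for a
  have "cstar_seminorm (free_star_alg (Mor \<Lambda>)) r"
    unfolding cstar_seminorm_free
  proof (intro conjI ballI allI)
    fix a b c assume a: "a \<in> FA (Mor \<Lambda>)" and b: "b \<in> FA (Mor \<Lambda>)"
    show "r (a + b) \<le> r a + r b"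
      using p.p_add[OF a b] q.p_add[OF a b] by (auto simp: r_def)
    have le: "p c \<le> r c" "?q c \<le> r c" "0 \<le> r c" for c by (auto simp: r_def le_max_iff_disj)
    have "p (fmul a b) \<le> r a * r b"
      by (rule order_trans[OF p.p_fmul[OF a b]]) (intro mult_mono le p.p_nonneg b)
    moreover have "?q (fmul a b) \<le> r a * r b"
      by (rule order_trans[OF q.p_fmul[OF a b]]) (intro mult_mono le norm_ge_zero)
    ultimately show "r (fmul a b) \<le> r a * r b" by (simp add: r_def)
  next
    fix a c assume a: "a \<in> FA (Mor \<Lambda>)"
    show "0 \<le> r a" by (simp add: r_def le_max_iff_disj)
    show "r (cscale c a) = cmod c * r a"
      using p.p_cscale[OF a] q.p_cscale[OF a] by (simp add: r_def max_mult_distrib_left)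
    show "r (fstar a) = r a" using p.p_fstar[OF a] q.p_fstar[OF a] by (simp add: r_def)
    have mono: "x \<le> y \<longleftrightarrow> x\<^sup>2 \<le> y\<^sup>2" if "0 \<le> x" "0 \<le> y" for x y :: real
      using that by (simp add: abs_le_square_iff[symmetric])
    show "r (fmul (fstar a) a) = (r a)\<^sup>2"
      using p.p_cstar[OF a] q.p_cstar[OF a] mono[OF p.p_nonneg[OF a] q.p_nonneg[OF a]]
      by (simp add: r_def max_def)
  qed
  then interpret kgraph_action_seminorm k \<Lambda> X ran act dg r
    by unfold_locales (use rel prel in \<open>auto simp: r_def\<close>)
  show "y \<le> norm (lin_op a)" using seminorm_le_op_norm[OF a] by (simp add: y r_def)
qed

end

section \<open>Completions modelled in Banach spaces\<close>

text \<open>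
  A map \<open>\<Theta>\<close> that turns seminorm distance into distance in a Banach space identifies the Hausdorff
  completion with the closure of its range: a class of Cauchy sequences is sent to the common limit of
  the images.
\<close>

locale completion_model =
  fixes V :: "('a, 'z) vs_scheme" and p :: "'a \<Rightarrow> real" and \<Theta> :: "'a \<Rightarrow> 'b :: banach"
  assumes seminorm_diff: "a \<in> car V \<Longrightarrow> b \<in> car V \<Longrightarrow> p (vdiff V a b) = norm (\<Theta> a - \<Theta> b)"
begin

lemma cauchy_seqs_iff: "f \<in> cauchy_seqs V p \<longleftrightarrow> (\<forall>n. f n \<in> car V) \<and> Cauchy (\<lambda>n. \<Theta> (f n))"
  unfolding cauchy_seqs_def Cauchy_iff by (auto simp: seminorm_diff)

lemma cauchy_seqs_tendsto: "f \<in> cauchy_seqs V p \<Longrightarrow> (\<lambda>n. \<Theta> (f n)) \<longlonglongrightarrow> lim (\<lambda>n. \<Theta> (f n))"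
  by (simp add: cauchy_seqs_iff Cauchy_convergent_iff convergent_LIMSEQ_iff)

lemma cauchy_class_iff:
  assumes f: "f \<in> cauchy_seqs V p"
  shows "g \<in> cauchy_class V p f \<longleftrightarrow> g \<in> cauchy_seqs V p \<and> lim (\<lambda>n. \<Theta> (g n)) = lim (\<lambda>n. \<Theta> (f n))"
proof -
  have "(\<lambda>n. p (vdiff V (f n) (g n))) \<longlonglongrightarrow> 0 \<longleftrightarrow> lim (\<lambda>n. \<Theta> (g n)) = lim (\<lambda>n. \<Theta> (f n))"
    if g: "g \<in> cauchy_seqs V p"
  proof -
    have "(\<lambda>n. p (vdiff V (f n) (g n))) = (\<lambda>n. norm (\<Theta> (f n) - \<Theta> (g n)))"
      using f g by (auto simp: cauchy_seqs_iff seminorm_diff)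
    moreover have "(\<lambda>n. norm (\<Theta> (f n) - \<Theta> (g n))) \<longlonglongrightarrow> norm (lim (\<lambda>n. \<Theta> (f n)) - lim (\<lambda>n. \<Theta> (g n)))"
      by (intro tendsto_norm tendsto_diff cauchy_seqs_tendsto f g)
    ultimately show ?thesis using LIMSEQ_unique by fastforce
  qed
  then show ?thesis by (auto simp: cauchy_class_def)
qed

definition limit_of :: "(nat \<Rightarrow> 'a) set \<Rightarrow> 'b" where
  "limit_of C = lim (\<lambda>n. \<Theta> (rep C n))"

lemma rep_in:
  assumes "C \<in> cauchy_class V p ` cauchy_seqs V p"
  shows "rep C \<in> cauchy_seqs V p" "C = {g \<in> cauchy_seqs V p. lim (\<lambda>n. \<Theta> (g n)) = limit_of C}"
    "(\<lambda>n. \<Theta> (rep C n)) \<longlonglongrightarrow> limit_of C" "rep C n \<in> car V"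
proof -
  obtain f where f: "f \<in> cauchy_seqs V p" "C = cauchy_class V p f" using assms by auto
  have "f \<in> C" using f by (simp add: cauchy_class_iff)
  then have r: "rep C \<in> C" unfolding rep_def by (rule someI[of "\<lambda>f. f \<in> C"])
  then show "rep C \<in> cauchy_seqs V p" using f by (simp add: cauchy_class_iff)
  then show "(\<lambda>n. \<Theta> (rep C n)) \<longlonglongrightarrow> limit_of C" "rep C n \<in> car V"
    unfolding limit_of_def by (auto simp: cauchy_seqs_tendsto cauchy_seqs_iff)
  show "C = {g \<in> cauchy_seqs V p. lim (\<lambda>n. \<Theta> (g n)) = limit_of C}"
    using r f unfolding limit_of_def by (auto simp: cauchy_class_iff)
qed

lemma limit_of_inj: "inj_on limit_of (cauchy_class V p ` cauchy_seqs V p)"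
proof (rule inj_onI)
  fix C C' assume C: "C \<in> cauchy_class V p ` cauchy_seqs V p"
    and C': "C' \<in> cauchy_class V p ` cauchy_seqs V p" and eq: "limit_of C = limit_of C'"
  show "C = C'" by (rule trans[OF rep_in(2)[OF C, unfolded eq] rep_in(2)[OF C', symmetric]])
qed

lemma class_limit:
  assumes "\<And>n. f n \<in> car V" "(\<lambda>n. \<Theta> (f n)) \<longlonglongrightarrow> y"
  shows "cauchy_class V p f \<in> cauchy_class V p ` cauchy_seqs V p" "limit_of (cauchy_class V p f) = y"
proof -
  have f: "f \<in> cauchy_seqs V p" using assms by (auto simp: cauchy_seqs_iff intro: LIMSEQ_imp_Cauchy)
  then show C: "cauchy_class V p f \<in> cauchy_class V p ` cauchy_seqs V p" by simp
  have "f \<in> cauchy_class V p f" using f by (simp add: cauchy_class_iff)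
  then have "lim (\<lambda>n. \<Theta> (f n)) = limit_of (cauchy_class V p f)" using rep_in(2)[OF C] by auto
  then show "limit_of (cauchy_class V p f) = y" using assms(2) by (simp add: limI)
qed

lemma limit_of_image: "limit_of ` (cauchy_class V p ` cauchy_seqs V p) = closure (\<Theta> ` car V)"
proof (intro equalityI subsetI)
  fix y assume "y \<in> limit_of ` (cauchy_class V p ` cauchy_seqs V p)"
  then obtain C where C: "C \<in> cauchy_class V p ` cauchy_seqs V p" "y = limit_of C" by blast
  show "y \<in> closure (\<Theta> ` car V)"
    unfolding closure_sequential C(2)
    by (rule exI[of _ "\<lambda>n. \<Theta> (rep C n)"]) (use rep_in(3,4)[OF C(1)] in blast)
next
  fix y assume "y \<in> closure (\<Theta> ` car V)"
  then obtain h where h: "\<And>n. h n \<in> \<Theta> ` car V" "h \<longlonglongrightarrow> y" unfolding closure_sequential by blast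
  have "\<forall>n. \<exists>a. a \<in> car V \<and> h n = \<Theta> a" using h(1) by blast
  then obtain f where "\<And>n. f n \<in> car V" "\<And>n. h n = \<Theta> (f n)" by metis
  moreover from this have "(\<lambda>n. \<Theta> (f n)) \<longlonglongrightarrow> y" using h(2) by (metis (no_types, lifting) ext)
  ultimately show "y \<in> limit_of ` (cauchy_class V p ` cauchy_seqs V p)" using class_limit by (metis imageI)
qed

end

text \<open>
  \<open>\<Theta>\<close> is only required to respect the operations, since the direct limit of Hilbert spaces below is a
  vector space only up to vectors of seminorm zero.
\<close>

locale hilbert_model =
  fixes D :: "'a ip_space" and \<Theta> :: "'a \<Rightarrow> 'x l2"
  assumes add_D: "a \<in> car D \<Longrightarrow> b \<in> car D \<Longrightarrow> add D a b \<in> car D \<and> \<Theta> (add D a b) = \<Theta> a + \<Theta> b"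
    and scl_D: "a \<in> car D \<Longrightarrow> scl D c a \<in> car D \<and> \<Theta> (scl D c a) = scaleC_l2 c (\<Theta> a)"
    and zer_D: "zer D \<in> car D \<and> \<Theta> (zer D) = 0"
    and ip_D: "a \<in> car D \<Longrightarrow> b \<in> car D \<Longrightarrow> ip D a b = cinner (\<Theta> a) (\<Theta> b)"
begin

lemma ip_norm_D: "a \<in> car D \<Longrightarrow> ip_norm D a = norm (\<Theta> a)"
  by (simp add: ip_norm_def ip_D Re_cinner_self)

sublocale completion_model D "ip_norm D" \<Theta>
proof
  fix a b assume a: "a \<in> car D" and b: "b \<in> car D"
  have "scaleC_l2 (- 1) (\<Theta> b) = - \<Theta> b" by (rule l2_eqI) simp
  then have "vdiff D a b \<in> car D \<and> \<Theta> (vdiff D a b) = \<Theta> a - \<Theta> b"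
    unfolding vdiff_def using add_D[OF a, of "scl D (- 1) b"] scl_D[OF b, of "- 1"] by simp
  then show "ip_norm D (vdiff D a b) = norm (\<Theta> a - \<Theta> b)" by (simp add: ip_norm_D)
qed

abbreviation H where "H \<equiv> hilbert_completion D"

lemma car_H: "car H = cauchy_class D (ip_norm D) ` cauchy_seqs D (ip_norm D)"
  by (simp add: hilbert_completion_def Let_def)

lemma zer_H: "zer H \<in> car H" "limit_of (zer H) = 0"
  unfolding car_H using class_limit[of "\<lambda>_. zer D" 0] zer_D by (simp_all add: hilbert_completion_def Let_def)

lemma add_H:
  assumes "X \<in> car H" "Y \<in> car H"
  shows "add H X Y \<in> car H" "limit_of (add H X Y) = limit_of X + limit_of Y"
proof -
  note X = rep_in[OF assms(1)[unfolded car_H]] and Y = rep_in[OF assms(2)[unfolded car_H]]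
  have eq: "add H X Y = cauchy_class D (ip_norm D) (\<lambda>n. add D (rep X n) (rep Y n))"
    by (simp add: hilbert_completion_def Let_def)
  have l: "(\<lambda>n. \<Theta> (add D (rep X n) (rep Y n))) \<longlonglongrightarrow> limit_of X + limit_of Y"
    using tendsto_add[OF X(3) Y(3)] by (simp add: add_D X(4) Y(4))
  show "add H X Y \<in> car H" "limit_of (add H X Y) = limit_of X + limit_of Y"
    unfolding eq car_H using class_limit[OF _ l] add_D X(4) Y(4) by blast+
qed

lemma scl_H:
  assumes "X \<in> car H"
  shows "scl H c X \<in> car H" "limit_of (scl H c X) = scaleC_l2 c (limit_of X)"
proof -
  note X = rep_in[OF assms(1)[unfolded car_H]]
  have eq: "scl H c X = cauchy_class D (ip_norm D) (\<lambda>n. scl D c (rep X n))"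
    by (simp add: hilbert_completion_def Let_def)
  have l: "(\<lambda>n. \<Theta> (scl D c (rep X n))) \<longlonglongrightarrow> scaleC_l2 c (limit_of X)"
    using bounded_linear.tendsto[OF bounded_linear_scaleC X(3)] by (simp add: scl_D X(4))
  show "scl H c X \<in> car H" "limit_of (scl H c X) = scaleC_l2 c (limit_of X)"
    unfolding eq car_H using class_limit[OF _ l] scl_D X(4) by blast+
qed

lemma ip_H:
  assumes "X \<in> car H" "Y \<in> car H"
  shows "ip H X Y = cinner (limit_of X) (limit_of Y)"
proof -
  note X = rep_in[OF assms(1)[unfolded car_H]] and Y = rep_in[OF assms(2)[unfolded car_H]]
  have "ip H X Y = lim (\<lambda>n. cinner (\<Theta> (rep X n)) (\<Theta> (rep Y n)))"
    by (simp add: hilbert_completion_def Let_def ip_D X(4) Y(4))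
  then show ?thesis using tendsto_cinner[OF X(3) Y(3)] by (simp add: limI)
qed

lemma ip_norm_H: "X \<in> car H \<Longrightarrow> ip_norm H X = norm (limit_of X)"
  by (simp add: ip_norm_def ip_H Re_cinner_self)

lemma inj_H: "inj_on limit_of (car H)"
  unfolding car_H by (rule limit_of_inj)

lemma image_H: "limit_of ` car H = closure (\<Theta> ` car D)"
  unfolding car_H by (rule limit_of_image)

lemma closed_image_H: "closed (limit_of ` car H)"
  unfolding image_H by simp

definition conj_op :: "('x l2 \<Rightarrow>\<^sub>L 'x l2) \<Rightarrow> (nat \<Rightarrow> 'a) set \<Rightarrow> (nat \<Rightarrow> 'a) set" where
  "conj_op S = (\<lambda>X\<in>car H. inv_into (car H) limit_of (blinfun_apply S (limit_of X)))"

definition compatible_op :: "('x l2 \<Rightarrow>\<^sub>L 'x l2) \<Rightarrow> bool" where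
  "compatible_op S \<longleftrightarrow> (\<forall>c \<xi>. blinfun_apply S (scaleC_l2 c \<xi>) = scaleC_l2 c (blinfun_apply S \<xi>)) \<and>
     (\<forall>\<xi>. blinfun_apply S \<xi> \<in> limit_of ` car H)"

lemma conj_op_in:
  assumes "compatible_op S" "X \<in> car H"
  shows "conj_op S X \<in> car H" "limit_of (conj_op S X) = blinfun_apply S (limit_of X)"
proof -
  have "blinfun_apply S (limit_of X) \<in> limit_of ` car H" using assms by (simp add: compatible_op_def)
  then show "conj_op S X \<in> car H" "limit_of (conj_op S X) = blinfun_apply S (limit_of X)"
    using assms(2) by (simp_all add: conj_op_def inv_into_into f_inv_into_f)
qed

lemma H_eqI: "X \<in> car H \<Longrightarrow> Y \<in> car H \<Longrightarrow> limit_of X = limit_of Y \<Longrightarrow> X = Y"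
  using inj_H by (simp add: inj_onD)

lemma conj_op_bounded:
  assumes "compatible_op S"
  shows "conj_op S \<in> car (bounded_ops H)"
proof -
  note c = conj_op_in[OF assms]
  have "conj_op S (add H X Y) = add H (conj_op S X) (conj_op S Y)" if "X \<in> car H" "Y \<in> car H" for X Y
    using that by (intro H_eqI) (auto simp: c add_H blinfun.add_right)
  moreover have "conj_op S (scl H a X) = scl H a (conj_op S X)" if "X \<in> car H" for a X
    using that assms by (intro H_eqI) (auto simp: c scl_H compatible_op_def)
  moreover have "\<exists>C. \<forall>X\<in>car H. ip_norm H (conj_op S X) \<le> C * ip_norm H X"
    by (rule exI[of _ "norm S"]) (simp add: ip_norm_H c norm_blinfun)
  moreover have "conj_op S \<in> extensional (car H)" by (simp add: conj_op_def)
  ultimately show ?thesis unfolding bounded_ops_def Let_def using c by auto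
qed

lemma bounded_opsD:
  assumes "T \<in> car (bounded_ops H)"
  shows "T \<in> extensional (car H)" "\<And>X. X \<in> car H \<Longrightarrow> T X \<in> car H"
    "\<And>X Y. X \<in> car H \<Longrightarrow> Y \<in> car H \<Longrightarrow> T (add H X Y) = add H (T X) (T Y)"
    "\<And>c X. X \<in> car H \<Longrightarrow> T (scl H c X) = scl H c (T X)"
    "\<exists>C. \<forall>X\<in>car H. ip_norm H (T X) \<le> C * ip_norm H X"
  using assms unfolding bounded_ops_def Let_def by auto

lemma bounded_ops_eqI:
  assumes "S \<in> car (bounded_ops H)" "T \<in> car (bounded_ops H)"
    and eq: "\<And>X. X \<in> car H \<Longrightarrow> limit_of (S X) = limit_of (T X)"
  shows "S = T"
proof (rule extensionalityI[OF bounded_opsD(1)[OF assms(1)] bounded_opsD(1)[OF assms(2)]])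
  show "S X = T X" if "X \<in> car H" for X
    using that eq[OF that] bounded_opsD(2)[OF assms(1) that] bounded_opsD(2)[OF assms(2) that]
    by (intro H_eqI)
qed

text \<open>
  The images under \<open>limit_of\<close> of the vectors on which \<open>S\<close> and \<open>T\<close> agree form a closed subspace that
  contains the basis vectors.
\<close>

lemma bounded_ops_eq_on_generators:
  assumes S: "S \<in> car (bounded_ops H)" and T: "T \<in> car (bounded_ops H)"
    and B: "B \<subseteq> car H" "limit_of ` B = basis_l2 ` Y" "limit_of ` car H \<subseteq> supported Y"
    and eq: "\<And>X. X \<in> B \<Longrightarrow> S X = T X"
  shows "S = T"
proof -
  note S' = bounded_opsD[OF S] and T' = bounded_opsD[OF T]
  define E where "E = limit_of ` {X \<in> car H. S X = T X}"
  have "supported Y \<subseteq> E"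
  proof (rule supported_in_closed_span)
    have "S (scl H 0 (zer H)) = scl H 0 (S (zer H))" "T (scl H 0 (zer H)) = scl H 0 (T (zer H))"
      using S' T' zer_H by auto
    moreover have z: "scl H 0 X = zer H" if "X \<in> car H" for X
      using that by (intro H_eqI) (auto simp: scl_H zer_H intro: l2_eqI)
    ultimately have "S (zer H) = T (zer H)" using S'(2) T'(2) zer_H(1) by metis
    then show "0 \<in> E" unfolding E_def using zer_H by (metis (mono_tags, lifting) image_eqI mem_Collect_eq)
    show "\<xi> + \<eta> \<in> E" if xe: "\<xi> \<in> E" "\<eta> \<in> E" for \<xi> \<eta>
    proof -
      obtain X Y where "X \<in> car H" "S X = T X" "\<xi> = limit_of X" "Y \<in> car H" "S Y = T Y" "\<eta> = limit_of Y"
        using xe by (auto simp: E_def)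
      then show ?thesis unfolding E_def
        by (intro image_eqI[of _ _ "add H X Y"]) (auto simp: add_H S'(3) T'(3))
    qed
    have sc: "scaleC_l2 c \<xi> \<in> E" if x: "\<xi> \<in> E" for c \<xi>
    proof -
      obtain X where "X \<in> car H" "S X = T X" "\<xi> = limit_of X" using x by (auto simp: E_def)
      then show ?thesis unfolding E_def
        by (intro image_eqI[of _ _ "scl H c X"]) (auto simp: scl_H S'(4) T'(4))
    qed
    show "scaleC_l2 c (basis_l2 y) \<in> E" if "y \<in> Y" for c y
    proof (rule sc)
      have "basis_l2 y \<in> limit_of ` B" using B(2) that by simp
      then show "basis_l2 y \<in> E" unfolding E_def using B(1) eq by auto
    qed
    show "closed E"
      unfolding closed_sequential_limits
    proof (intro allI impI, elim conjE)
      fix h l assume h: "\<forall>n. h n \<in> E" and l: "h \<longlonglongrightarrow> l"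
      have "\<forall>n. \<exists>X. X \<in> car H \<and> S X = T X \<and> h n = limit_of X" using h by (auto simp: E_def)
      then obtain Z where Z: "\<And>n. Z n \<in> car H" "\<And>n. S (Z n) = T (Z n)" "\<And>n. h n = limit_of (Z n)" by metis
      have "l \<in> limit_of ` car H"
        by (rule closed_sequentially[OF closed_image_H _ l]) (use Z in auto)
      then obtain X where X: "X \<in> car H" "l = limit_of X" by blast
      have conv: "(\<lambda>n. limit_of (R (Z n))) \<longlonglongrightarrow> limit_of (R X)" if R: "R \<in> car (bounded_ops H)" for R
      proof -
        note R' = bounded_opsD[OF R]
        obtain C where C: "\<And>X. X \<in> car H \<Longrightarrow> ip_norm H (R X) \<le> C * ip_norm H X" using R'(5) by blast
        have m: "scaleC_l2 (- 1) \<xi> = - \<xi>" for \<xi> :: "'x l2" by (rule l2_eqI) simp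
        have bound: "norm (limit_of (R (Z n)) - limit_of (R X)) \<le> C * norm (h n - l)" for n
        proof -
          let ?d = "add H (Z n) (scl H (- 1) X)"
          have d: "?d \<in> car H" "limit_of ?d = h n - l" using Z X by (simp_all add: add_H scl_H m)
          have "limit_of (R ?d) = limit_of (R (Z n)) - limit_of (R X)"
            using Z(1) X(1) R'(2) by (simp add: R'(3,4) add_H scl_H m)
          then show ?thesis using C[OF d(1)] d R'(2)[OF d(1)] by (simp add: ip_norm_H)
        qed
        have "(\<lambda>n. C * norm (h n - l)) \<longlonglongrightarrow> 0"
          using tendsto_mult_right_zero[OF tendsto_norm_zero[OF LIM_zero[OF l]]] .
        then have "(\<lambda>n. limit_of (R (Z n)) - limit_of (R X)) \<longlonglongrightarrow> 0"
          by (rule Lim_null_comparison[OF always_eventually[OF allI[OF bound]]])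
        then show ?thesis by (rule LIM_zero_cancel)
      qed
      have "limit_of (S X) = limit_of (T X)"
        by (rule LIMSEQ_unique[OF conv[OF S]]) (use conv[OF T] Z(2) in simp)
      then have "S X = T X" using S'(2) T'(2) X(1) by (intro H_eqI)
      then show "l \<in> E" using X by (auto simp: E_def)
    qed
  qed
  then have sub: "limit_of ` car H \<subseteq> E" using B(3) by blast
  show ?thesis
  proof (rule bounded_ops_eqI[OF S T])
    fix X assume X: "X \<in> car H"
    then obtain X' where "X' \<in> car H" "S X' = T X'" "limit_of X = limit_of X'" using sub by (auto simp: E_def)
    then have "S X = T X" using H_eqI[OF X, of X'] by simp
    then show "limit_of (S X) = limit_of (T X)" by simp
  qed
qed

text \<open>
  The definite description in the definition of the adjoint is resolved by uniqueness: the difference of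
  two candidates, applied to a vector, is orthogonal to the whole space.
\<close>

lemma star_conj_op:
  assumes S: "compatible_op S" and S': "compatible_op S'"
    and adj: "\<And>\<xi> \<eta>. cinner (blinfun_apply S \<xi>) \<eta> = cinner \<xi> (blinfun_apply S' \<eta>)"
  shows "star (bounded_ops H) (conj_op S) = conj_op S'"
proof -
  let ?adj = "\<lambda>R. R \<in> car (bounded_ops H) \<and> (\<forall>X\<in>car H. \<forall>Y\<in>car H. ip H (conj_op S X) Y = ip H X (R Y))"
  have "(THE R. ?adj R) = conj_op S'"
  proof (rule the_equality)
    show "?adj (conj_op S')"
      using S S' by (simp add: conj_op_bounded ip_H conj_op_in adj)
    fix R assume R: "?adj R"
    show "R = conj_op S'"
    proof (rule bounded_ops_eqI)
      fix Y assume Y: "Y \<in> car H"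
      have RY: "R Y \<in> car H" using R Y bounded_opsD(2) by blast
      let ?z = "limit_of (R Y) - blinfun_apply S' (limit_of Y)"
      have "cinner (limit_of X) ?z = 0" if X: "X \<in> car H" for X
      proof -
        have "cinner (limit_of X) (limit_of (R Y)) = ip H (conj_op S X) Y" using R X Y RY by (simp add: ip_H)
        also have "\<dots> = cinner (limit_of X) (blinfun_apply S' (limit_of Y))"
          using S X Y by (simp add: ip_H conj_op_in adj)
        finally show ?thesis by (simp add: cinner_diff_right)
      qed
      moreover have "\<exists>X\<in>car H. limit_of X = ?z"
      proof -
        have m: "scaleC_l2 (- 1) \<xi> = - \<xi>" for \<xi> :: "'x l2" by (rule l2_eqI) simp
        have "limit_of (add H (R Y) (scl H (- 1) (conj_op S' Y))) = ?z"
          using RY Y S' by (simp add: add_H scl_H conj_op_in m)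
        moreover have "add H (R Y) (scl H (- 1) (conj_op S' Y)) \<in> car H"
          using RY Y S' by (simp add: add_H scl_H conj_op_in)
        ultimately show ?thesis by blast
      qed
      ultimately have "cinner ?z ?z = 0" by metis
      then have "?z = 0" using Re_cinner_self[of ?z] by simp
      then show "limit_of (R Y) = limit_of (conj_op S' Y)" using Y S' by (simp add: conj_op_in)
    qed (use R S' conj_op_bounded in auto)
  qed
  then show ?thesis by (simp add: bounded_ops_def Let_def)
qed

lemma conj_op_add:
  assumes "compatible_op S" "compatible_op T" "compatible_op (S + T)"
  shows "conj_op (S + T) = add (bounded_ops H) (conj_op S) (conj_op T)"
proof
  fix X
  show "conj_op (S + T) X = add (bounded_ops H) (conj_op S) (conj_op T) X"
  proof (cases "X \<in> car H")
    case True
    have "conj_op (S + T) X = add H (conj_op S X) (conj_op T X)"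
      using True assms by (intro H_eqI) (auto simp: conj_op_in add_H plus_blinfun.rep_eq)
    then show ?thesis using True by (simp add: bounded_ops_def Let_def)
  qed (simp add: bounded_ops_def Let_def conj_op_def)
qed

lemma conj_op_scaleC:
  assumes "compatible_op S" "compatible_op (scaleC_op c o\<^sub>L S)"
  shows "conj_op (scaleC_op c o\<^sub>L S) = scl (bounded_ops H) c (conj_op S)"
proof
  fix X
  show "conj_op (scaleC_op c o\<^sub>L S) X = scl (bounded_ops H) c (conj_op S) X"
  proof (cases "X \<in> car H")
    case True
    have "conj_op (scaleC_op c o\<^sub>L S) X = scl H c (conj_op S X)"
      using True assms by (intro H_eqI) (auto simp: conj_op_in scl_H)
    then show ?thesis using True by (simp add: bounded_ops_def Let_def)
  qed (simp add: bounded_ops_def Let_def conj_op_def)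
qed

lemma conj_op_mul:
  assumes "compatible_op S" "compatible_op T" "compatible_op (S o\<^sub>L T)"
  shows "conj_op (S o\<^sub>L T) = mul (bounded_ops H) (conj_op S) (conj_op T)"
proof
  fix X
  show "conj_op (S o\<^sub>L T) X = mul (bounded_ops H) (conj_op S) (conj_op T) X"
  proof (cases "X \<in> car H")
    case True
    have "conj_op (S o\<^sub>L T) X = conj_op S (conj_op T X)"
      using True assms by (intro H_eqI) (auto simp: conj_op_in)
    then show ?thesis using True by (simp add: bounded_ops_def Let_def)
  qed (simp add: bounded_ops_def Let_def conj_op_def)
qed

text \<open>
  Finite combinations of basis vectors with coefficients in \<open>\<rat> + \<i>\<rat>\<close> are dense.
\<close>

lemma separable_H:
  assumes Y: "countable Y" and im: "limit_of ` car H = supported Y"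
  shows "separable H"
proof -
  define Q where "Q = {Complex a b | a b. a \<in> \<rat> \<and> b \<in> \<rat>}"
  have "Q = (\<lambda>(a, b). Complex a b) ` (\<rat> \<times> \<rat>)" by (auto simp: Q_def)
  then have cQ: "countable Q" by (simp add: countable_rat)
  have dense: "\<exists>q\<in>Q. cmod (c - q) < e" if "0 < e" for c e
  proof -
    obtain a where "a \<in> \<rat>" "Re c - e / 2 < a" "a < Re c + e / 2"
      using Rats_dense_in_real[of "Re c - e / 2" "Re c + e / 2"] \<open>0 < e\<close> by auto
    then have a: "a \<in> \<rat>" "\<bar>Re c - a\<bar> < e / 2" by linarith+
    obtain b where "b \<in> \<rat>" "Im c - e / 2 < b" "b < Im c + e / 2"
      using Rats_dense_in_real[of "Im c - e / 2" "Im c + e / 2"] \<open>0 < e\<close> by auto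
    then have b: "b \<in> \<rat>" "\<bar>Im c - b\<bar> < e / 2" by linarith+
    have "cmod (c - Complex a b) \<le> \<bar>Re c - a\<bar> + \<bar>Im c - b\<bar>"
      using cmod_le[of "c - Complex a b"] by simp
    also have "\<dots> < e" using a b by simp
    finally show ?thesis using a b by (auto simp: Q_def)
  qed
  define comb where "comb zs = (\<Sum>(q, y)\<leftarrow>zs. scaleC_l2 q (basis_l2 y))" for zs :: "(complex \<times> 'x) list"
  define D where "D = comb ` lists (Q \<times> Y)"
  have cD: "countable D" unfolding D_def using cQ Y by (intro countable_image countable_lists) auto
  have comb_append: "comb (us @ vs) = comb us + comb vs" for us vs by (simp add: comb_def)
  have plus: "\<xi> + \<eta> \<in> D" if D: "\<xi> \<in> D" "\<eta> \<in> D" for \<xi> \<eta>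
  proof -
    obtain us where us: "\<xi> = comb us" "us \<in> lists (Q \<times> Y)" using D(1) unfolding D_def by (rule imageE)
    obtain vs where vs: "\<eta> = comb vs" "vs \<in> lists (Q \<times> Y)" using D(2) unfolding D_def by (rule imageE)
    from us vs show ?thesis unfolding D_def by (intro image_eqI[of _ _ "us @ vs"]) (auto simp: comb_append)
  qed
  have sub: "D \<subseteq> supported Y"
  proof
    fix \<xi> assume "\<xi> \<in> D"
    then obtain us where us: "us \<in> lists (Q \<times> Y)" "\<xi> = comb us" by (auto simp: D_def)
    from us(1) show "\<xi> \<in> supported Y" unfolding us(2)
      by (induction us) (auto simp: comb_def supported_def coord_basis)
  qed
  have dense_D: "supported Y \<subseteq> closure D"
  proof (rule supported_in_closed_span)
    have "0 \<in> D" unfolding D_def by (rule image_eqI[of _ _ "[]"]) (auto simp: comb_def)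
    then show "0 \<in> closure D" using closure_subset by blast
    show "\<xi> + \<eta> \<in> closure D" if cl: "\<xi> \<in> closure D" "\<eta> \<in> closure D" for \<xi> \<eta>
    proof -
      obtain f where f: "\<forall>n. f n \<in> D" "f \<longlonglongrightarrow> \<xi>" using cl(1) unfolding closure_sequential by blast
      obtain g where g: "\<forall>n. g n \<in> D" "g \<longlonglongrightarrow> \<eta>" using cl(2) unfolding closure_sequential by blast
      show ?thesis unfolding closure_sequential
        by (rule exI[of _ "\<lambda>n. f n + g n"]) (use f g in \<open>auto intro: plus tendsto_add\<close>)
    qed
    show "scaleC_l2 c (basis_l2 y) \<in> closure D" if y: "y \<in> Y" for c y
      unfolding closure_approachable
    proof (intro allI impI)
      fix e :: real assume "0 < e"
      then obtain q where q: "q \<in> Q" "cmod (c - q) < e" using dense by blast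
      have "scaleC_l2 q (basis_l2 y) \<in> D"
        unfolding D_def by (rule image_eqI[of _ _ "[(q, y)]"]) (use q y in \<open>auto simp: comb_def\<close>)
      moreover have "scaleC_l2 q (basis_l2 y) - scaleC_l2 c (basis_l2 y) = scaleC_l2 (q - c) (basis_l2 y)"
        by (rule l2_eqI) (simp add: algebra_simps)
      then have "dist (scaleC_l2 q (basis_l2 y)) (scaleC_l2 c (basis_l2 y)) < e"
        using q by (simp add: dist_norm norm_scaleC norm_minus_commute)
      ultimately show "\<exists>\<eta>\<in>D. dist \<eta> (scaleC_l2 c (basis_l2 y)) < e" by blast
    qed
  qed simp
  let ?W = "inv_into (car H) limit_of"
  have W: "?W \<xi> \<in> car H" "limit_of (?W \<xi>) = \<xi>" if "\<xi> \<in> D" for \<xi>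
  proof -
    have "\<xi> \<in> limit_of ` car H" unfolding im using sub that by (rule subsetD)
    then show "?W \<xi> \<in> car H" "limit_of (?W \<xi>) = \<xi>" by (rule inv_into_into, rule f_inv_into_f)
  qed
  show ?thesis unfolding separable_def
  proof (intro exI[of _ "?W ` D"] conjI ballI allI impI)
    show "?W ` D \<subseteq> car H" using W by blast
    show "countable (?W ` D)" using cD by simp
    fix X and e :: real assume X: "X \<in> car H" and e: "0 < e"
    have "limit_of X \<in> closure D" using X im dense_D by blast
    then obtain \<xi> where \<xi>: "\<xi> \<in> D" "dist \<xi> (limit_of X) < e" using e unfolding closure_approachable by blast
    have m: "scaleC_l2 (- 1) \<eta> = - \<eta>" for \<eta> :: "'x l2" by (rule l2_eqI) simp
    have "ip_norm H (vdiff H X (?W \<xi>)) = norm (limit_of X - \<xi>)"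
      unfolding vdiff_def using X W[OF \<xi>(1)] by (simp add: ip_norm_H add_H scl_H m)
    then show "\<exists>Y\<in>?W ` D. ip_norm H (vdiff H X Y) < e"
      using \<xi> by (intro bexI[of _ "?W \<xi>"] imageI) (simp add: dist_norm norm_minus_commute)
  qed
qed

end

section \<open>Classes of paths along an infinite path\<close>

locale infinite_path = row_finite_kgraph k \<Lambda> for k :: nat and \<Lambda> :: "'m kgraph" +
  fixes x :: "(nat \<Rightarrow> nat) \<times> (nat \<Rightarrow> nat) \<Rightarrow> 'm"
  assumes strongly_connected: "strongly_connected \<Lambda>" and x: "x \<in> infinite_paths k \<Lambda>"
begin

definition seg :: "nat \<Rightarrow> nat \<Rightarrow> 'm" where
  "seg i j = x (diag k i, diag k j)"

lemma
  assumes "i \<le> j"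
  shows seg_Mor [simp]: "seg i j \<in> Mor \<Lambda>" and rg_seg [simp]: "rg \<Lambda> (seg i j) = seg i i"
    and sc_seg [simp]: "sc \<Lambda> (seg i j) = seg j j" and deg_seg: "deg \<Lambda> (seg i j) = diag k j - diag k i"
proof -
  have m: "(diag k i, diag k j) \<in> Mor (Omega k)"
    using assms by (auto simp: Omega_def Nk_def diag_def le_fun_def)
  have f: "degree_preserving_functor (Omega k) \<Lambda> x" using x by (simp add: infinite_paths_def)
  have "rg (Omega k) (diag k i, diag k j) = (diag k i, diag k i)"
    "sc (Omega k) (diag k i, diag k j) = (diag k j, diag k j)"
    "deg (Omega k) (diag k i, diag k j) = diag k j - diag k i" by (simp_all add: Omega_def)
  then show "seg i j \<in> Mor \<Lambda>" "rg \<Lambda> (seg i j) = seg i i" "sc \<Lambda> (seg i j) = seg j j"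
    "deg \<Lambda> (seg i j) = diag k j - diag k i"
    using f m unfolding degree_preserving_functor_def seg_def by metis+
qed

lemma cmp_seg: "i \<le> j \<Longrightarrow> j \<le> l \<Longrightarrow> cmp \<Lambda> (seg i j) (seg j l) = seg i l"
proof -
  assume "i \<le> j" "j \<le> l"
  then have m: "(diag k i, diag k j) \<in> Mor (Omega k)" "(diag k j, diag k l) \<in> Mor (Omega k)"
    "sc (Omega k) (diag k i, diag k j) = rg (Omega k) (diag k j, diag k l)"
    "cmp (Omega k) (diag k i, diag k j) (diag k j, diag k l) = (diag k i, diag k l)"
    by (auto simp: Omega_def Nk_def diag_def le_fun_def)
  have f: "degree_preserving_functor (Omega k) \<Lambda> x" using x by (simp add: infinite_paths_def)
  show ?thesis using f m unfolding degree_preserving_functor_def seg_def by metis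
qed

abbreviation F :: "nat \<Rightarrow> 'm set" where
  "F \<equiv> paths_into k \<Lambda> x"

lemma F_iff: "\<mu> \<in> F i \<longleftrightarrow> \<mu> \<in> Mor \<Lambda> \<and> sc \<Lambda> \<mu> = seg i i"
proof -
  have "rg \<Lambda> (segment k x i) = seg i i" using rg_seg[of i "Suc i"] by (simp add: segment_def seg_def)
  then show ?thesis by (auto simp: paths_into_def)
qed

text \<open>
  The composite of the connecting maps \<open>\<mu> \<mapsto> \<mu> x\<^sub>i\<close> between two stages.
\<close>

definition prolong :: "nat \<Rightarrow> nat \<Rightarrow> 'm \<Rightarrow> 'm" where
  "prolong i j \<mu> = cmp \<Lambda> \<mu> (seg i j)"

lemma prolong_props:
  assumes "\<mu> \<in> F i" "i \<le> j"
  shows prolong_F: "prolong i j \<mu> \<in> F j" and rg_prolong: "rg \<Lambda> (prolong i j \<mu>) = rg \<Lambda> \<mu>"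
    and deg_prolong: "deg \<Lambda> (prolong i j \<mu>) = deg \<Lambda> \<mu> + (diag k j - diag k i)"
  using assms by (auto simp: F_iff prolong_def deg_seg)

lemma prolong_same: "\<mu> \<in> F i \<Longrightarrow> prolong i i \<mu> = \<mu>"
  unfolding prolong_def F_iff by (metis cmp_sc)

lemma prolong_prolong: "\<mu> \<in> F i \<Longrightarrow> i \<le> j \<Longrightarrow> j \<le> l \<Longrightarrow> prolong j l (prolong i j \<mu>) = prolong i l \<mu>"
  unfolding prolong_def F_iff by (simp add: cmp_assoc cmp_seg)

lemma prolong_inj: "\<mu> \<in> F i \<Longrightarrow> \<nu> \<in> F i \<Longrightarrow> i \<le> j \<Longrightarrow> prolong i j \<mu> = prolong i j \<nu> \<Longrightarrow> \<mu> = \<nu>"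
  unfolding prolong_def F_iff using factorization_unique[of \<mu> "seg i j" \<nu> "seg i j"] by simp

lemma prolong_cmp:
  assumes "\<alpha> \<in> Mor \<Lambda>" "\<mu> \<in> F i" "sc \<Lambda> \<alpha> = rg \<Lambda> \<mu>" "i \<le> j"
  shows "cmp \<Lambda> \<alpha> \<mu> \<in> F i" "prolong i j (cmp \<Lambda> \<alpha> \<mu>) = cmp \<Lambda> \<alpha> (prolong i j \<mu>)"
  using assms by (auto simp: prolong_def F_iff cmp_assoc)

text \<open>
  The index of the basis vector \<open>[\<xi>\<^sup>i\<^sub>\<mu>]\<close>: all pairs that become equal to \<open>(i, \<mu>)\<close> at a common later
  stage.
\<close>

definition path_class :: "nat \<Rightarrow> 'm \<Rightarrow> (nat \<times> 'm) set" where
  "path_class i \<mu> = {(j, \<nu>). \<nu> \<in> F j \<and> prolong i (max i j) \<mu> = prolong j (max i j) \<nu>}"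

lemma in_path_class_iff:
  assumes "\<mu> \<in> F i" "\<nu> \<in> F j" "i \<le> l" "j \<le> l"
  shows "(j, \<nu>) \<in> path_class i \<mu> \<longleftrightarrow> prolong i l \<mu> = prolong j l \<nu>"
proof -
  let ?m = "max i j"
  have "prolong i l \<mu> = prolong ?m l (prolong i ?m \<mu>)" "prolong j l \<nu> = prolong ?m l (prolong j ?m \<nu>)"
    using assms by (simp_all add: prolong_prolong)
  moreover have "prolong i ?m \<mu> \<in> F ?m" "prolong j ?m \<nu> \<in> F ?m" using assms by (auto intro: prolong_F)
  ultimately show ?thesis using assms prolong_inj[of "prolong i ?m \<mu>" ?m "prolong j ?m \<nu>" l] by (auto simp: path_class_def)
qed

lemma path_class_eq_iff:
  assumes "\<mu> \<in> F i" "\<nu> \<in> F j" "i \<le> l" "j \<le> l"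
  shows "path_class i \<mu> = path_class j \<nu> \<longleftrightarrow> prolong i l \<mu> = prolong j l \<nu>"
proof
  assume "path_class i \<mu> = path_class j \<nu>"
  moreover have "(j, \<nu>) \<in> path_class j \<nu>" using assms by (simp add: in_path_class_iff[of \<nu> j \<nu> j l])
  ultimately show "prolong i l \<mu> = prolong j l \<nu>" using assms in_path_class_iff by blast
next
  assume eq: "prolong i l \<mu> = prolong j l \<nu>"
  have "(n, \<zeta>) \<in> path_class i \<mu> \<longleftrightarrow> (n, \<zeta>) \<in> path_class j \<nu>" for n \<zeta>
  proof (cases "\<zeta> \<in> F n")
    case True
    let ?N = "max l n"
    have "prolong i ?N \<mu> = prolong l ?N (prolong i l \<mu>)" "prolong j ?N \<nu> = prolong l ?N (prolong j l \<nu>)"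
      using assms by (simp_all add: prolong_prolong)
    then have "prolong i ?N \<mu> = prolong j ?N \<nu>" using eq by simp
    then show ?thesis using assms True in_path_class_iff[of \<mu> i \<zeta> n ?N] in_path_class_iff[of \<nu> j \<zeta> n ?N] by simp
  qed (simp add: path_class_def)
  then show "path_class i \<mu> = path_class j \<nu>" by auto
qed

lemma path_class_prolong: "\<mu> \<in> F i \<Longrightarrow> i \<le> j \<Longrightarrow> path_class j (prolong i j \<mu>) = path_class i \<mu>"
  by (subst path_class_eq_iff[of _ _ _ _ j]) (auto simp: prolong_F prolong_same)

lemma path_class_inj: "\<mu> \<in> F i \<Longrightarrow> \<nu> \<in> F i \<Longrightarrow> path_class i \<mu> = path_class i \<nu> \<longleftrightarrow> \<mu> = \<nu>"
  by (subst path_class_eq_iff[of _ _ _ _ i]) (auto simp: prolong_same)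

definition X :: "(nat \<times> 'm) set set" where
  "X = {path_class i \<mu> | i \<mu>. \<mu> \<in> F i}"

text \<open>
  Range, action and degree of a class are computed from an arbitrary representative; the lemmas
  \<open>ran_path_class\<close>, \<open>act_path_class\<close> and \<open>dg_path_class\<close> show that the choice does not matter.
\<close>

definition chosen :: "(nat \<times> 'm) set \<Rightarrow> nat \<times> 'm" where
  "chosen c = (SOME z. z \<in> c)"

lemma chosen_path_class:
  assumes \<mu>: "\<mu> \<in> F i"
  obtains j \<nu> l where "chosen (path_class i \<mu>) = (j, \<nu>)" "\<nu> \<in> F j" "i \<le> l" "j \<le> l" "prolong i l \<mu> = prolong j l \<nu>"
proof -
  have "(i, \<mu>) \<in> path_class i \<mu>" using \<mu> by (simp add: in_path_class_iff[of _ _ _ _ i])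
  then have "chosen (path_class i \<mu>) \<in> path_class i \<mu>" unfolding chosen_def by (rule someI)
  moreover obtain j \<nu> where j: "chosen (path_class i \<mu>) = (j, \<nu>)" by fastforce
  ultimately have "\<nu> \<in> F j" "prolong i (max i j) \<mu> = prolong j (max i j) \<nu>" by (auto simp: path_class_def)
  then show thesis using that[of j \<nu> "max i j"] j by simp
qed

definition ran :: "(nat \<times> 'm) set \<Rightarrow> 'm" where
  "ran c = rg \<Lambda> (snd (chosen c))"

definition act :: "'m \<Rightarrow> (nat \<times> 'm) set \<Rightarrow> (nat \<times> 'm) set" where
  "act \<alpha> c = (case chosen c of (j, \<nu>) \<Rightarrow> path_class j (cmp \<Lambda> \<alpha> \<nu>))"

text \<open>
  Prolonging along \<open>x\<close> by one stage raises both the degree of the path and the diagonal by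
  \<open>(1,\<dots>,1)\<close>.
\<close>

definition dg :: "(nat \<times> 'm) set \<Rightarrow> nat \<Rightarrow> int" where
  "dg c = (case chosen c of (j, \<nu>) \<Rightarrow> \<lambda>i. int (deg \<Lambda> \<nu> i) - int (diag k j i))"

lemma ran_path_class: "\<mu> \<in> F i \<Longrightarrow> ran (path_class i \<mu>) = rg \<Lambda> \<mu>"
proof -
  assume \<mu>: "\<mu> \<in> F i"
  obtain j \<nu> l where c: "chosen (path_class i \<mu>) = (j, \<nu>)" "\<nu> \<in> F j" "i \<le> l" "j \<le> l" "prolong i l \<mu> = prolong j l \<nu>"
    by (rule chosen_path_class[OF \<mu>])
  have "rg \<Lambda> (prolong i l \<mu>) = rg \<Lambda> \<mu>" "rg \<Lambda> (prolong j l \<nu>) = rg \<Lambda> \<nu>"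
    by (rule rg_prolong[OF \<mu> c(3)], rule rg_prolong[OF c(2,4)])
  then show ?thesis using c by (simp add: ran_def)
qed

lemma act_path_class:
  assumes "\<alpha> \<in> Mor \<Lambda>" "\<mu> \<in> F i" "sc \<Lambda> \<alpha> = rg \<Lambda> \<mu>"
  shows "act \<alpha> (path_class i \<mu>) = path_class i (cmp \<Lambda> \<alpha> \<mu>)"
proof -
  obtain j \<nu> l where c: "chosen (path_class i \<mu>) = (j, \<nu>)" "\<nu> \<in> F j" "i \<le> l" "j \<le> l" "prolong i l \<mu> = prolong j l \<nu>"
    by (rule chosen_path_class[OF assms(2)])
  have r: "rg \<Lambda> \<nu> = rg \<Lambda> \<mu>" using rg_prolong[OF assms(2) c(3)] rg_prolong[OF c(2,4)] c(5) by simp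
  have "path_class j (cmp \<Lambda> \<alpha> \<nu>) = path_class i (cmp \<Lambda> \<alpha> \<mu>)"
    using assms c r by (subst path_class_eq_iff[of _ _ _ _ l]) (auto simp: prolong_cmp)
  then show ?thesis by (simp add: act_def c)
qed

lemma dg_path_class:
  assumes "\<mu> \<in> F i"
  shows "dg (path_class i \<mu>) = (\<lambda>n. int (deg \<Lambda> \<mu> n) - int (diag k i n))"
proof -
  obtain j \<nu> l where c: "chosen (path_class i \<mu>) = (j, \<nu>)" "\<nu> \<in> F j" "i \<le> l" "j \<le> l" "prolong i l \<mu> = prolong j l \<nu>"
    by (rule chosen_path_class[OF assms])
  have "deg \<Lambda> \<mu> + (diag k l - diag k i) = deg \<Lambda> \<nu> + (diag k l - diag k j)"
    using deg_prolong[OF assms c(3)] deg_prolong[OF c(2,4)] c(5) by simp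
  then have "deg \<Lambda> \<mu> n + (diag k l n - diag k i n) = deg \<Lambda> \<nu> n + (diag k l n - diag k j n)" for n
    by (auto simp: pointwise dest: fun_cong[of _ _ n])
  moreover have "diag k i n \<le> diag k l n" "diag k j n \<le> diag k l n" for n using c by (auto simp: diag_def)
  ultimately have "int (deg \<Lambda> \<mu> n) - int (diag k i n) = int (deg \<Lambda> \<nu> n) - int (diag k j n)" for n
    by (smt (verit) of_nat_add of_nat_diff)
  then show ?thesis by (simp add: dg_def c)
qed

lemma X_stage:
  assumes "c \<in> X"
  obtains i where "\<And>l. i \<le> l \<Longrightarrow> \<exists>\<mu>\<in>F l. c = path_class l \<mu>"
proof -
  obtain i \<mu> where "\<mu> \<in> F i" "c = path_class i \<mu>" using assms by (auto simp: X_def)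
  then have "\<exists>\<nu>\<in>F l. c = path_class l \<nu>" if "i \<le> l" for l using that path_class_prolong prolong_F by metis
  then show thesis by (rule that)
qed

lemma X_common_stage:
  assumes "c \<in> X" "d \<in> X"
  obtains l \<mu> \<nu> where "\<mu> \<in> F l" "\<nu> \<in> F l" "c = path_class l \<mu>" "d = path_class l \<nu>"
proof -
  obtain i j where "\<And>l. i \<le> l \<Longrightarrow> \<exists>\<mu>\<in>F l. c = path_class l \<mu>" "\<And>l. j \<le> l \<Longrightarrow> \<exists>\<mu>\<in>F l. d = path_class l \<mu>"
    using X_stage[OF assms(1)] X_stage[OF assms(2)] by metis
  then show thesis using that[of _ "max i j"] by (metis max.cobounded1 max.cobounded2)
qed

lemma path_class_X: "\<mu> \<in> F i \<Longrightarrow> path_class i \<mu> \<in> X"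
  by (auto simp: X_def)

text \<open>
  Initial paths of any degree exist because a representative can be prolonged until its degree is large
  enough. Strong connectedness gives, for each vertex, a path from \<open>x\<close> to it.
\<close>

sublocale kgraph_action k \<Lambda> X ran act dg
proof
  fix c assume c: "c \<in> X"
  then obtain i \<mu> where \<mu>: "\<mu> \<in> F i" "c = path_class i \<mu>" by (auto simp: X_def)
  have M: "\<mu> \<in> Mor \<Lambda>" using \<mu> by (simp add: F_iff)
  show "ran c \<in> vertices \<Lambda>" using \<mu> M by (simp add: ran_path_class)
  show "act (ran c) c = c" using \<mu> M act_path_class[of "rg \<Lambda> \<mu>" \<mu> i] by (simp add: ran_path_class)
  fix \<alpha> assume \<alpha>: "\<alpha> \<in> Mor \<Lambda>" and s: "sc \<Lambda> \<alpha> = ran c"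
  then have s': "sc \<Lambda> \<alpha> = rg \<Lambda> \<mu>" using \<mu> by (simp add: ran_path_class)
  note a = act_path_class[OF \<alpha> \<mu>(1) s', folded \<mu>(2)] and mem = prolong_cmp(1)[OF \<alpha> \<mu>(1) s' order_refl]
  show "act \<alpha> c \<in> X" unfolding a using mem by (rule path_class_X)
  show "ran (act \<alpha> c) = rg \<Lambda> \<alpha>" unfolding a using mem \<alpha> M s' by (simp add: ran_path_class)
  show "dg (act \<alpha> c) = int_deg \<alpha> + dg c"
    unfolding a using \<mu> mem \<alpha> M s' by (simp add: dg_path_class int_deg_def fun_eq_iff pointwise)
next
  fix \<alpha> \<beta> c assume *: "\<alpha> \<in> Mor \<Lambda>" "\<beta> \<in> Mor \<Lambda>" "c \<in> X" "sc \<Lambda> \<alpha> = rg \<Lambda> \<beta>" "sc \<Lambda> \<beta> = ran c"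
  then obtain i \<mu> where \<mu>: "\<mu> \<in> F i" "c = path_class i \<mu>" by (auto simp: X_def)
  then show "act (cmp \<Lambda> \<alpha> \<beta>) c = act \<alpha> (act \<beta> c)"
    using * prolong_cmp(1)[of \<beta> \<mu> i i] by (simp add: act_path_class ran_path_class cmp_assoc F_iff)
next
  fix c n assume c: "c \<in> X" and n: "n \<in> Nk k"
  obtain i \<mu> where \<mu>: "\<mu> \<in> F i" "c = path_class i \<mu>" using c by (auto simp: X_def)
  \<comment> \<open>Each coordinate of \<open>n\<close> is at most \<open>l - i\<close>.\<close>
  define l where "l = i + (\<Sum>j<k. n j)"
  have l: "i \<le> l" by (simp add: l_def)
  let ?\<mu> = "prolong i l \<mu>"
  have \<mu>': "?\<mu> \<in> F l" "c = path_class l ?\<mu>" using \<mu> l by (auto simp: prolong_F path_class_prolong)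
  have "n \<le> deg \<Lambda> ?\<mu>" unfolding le_fun_def
  proof
    fix j
    show "n j \<le> deg \<Lambda> ?\<mu> j"
    proof (cases "j < k")
      case True
      have "n j \<le> (\<Sum>j<k. n j)" using True by (intro member_le_sum) auto
      moreover have "deg \<Lambda> ?\<mu> j = deg \<Lambda> \<mu> j + (diag k l j - diag k i j)"
        by (simp add: deg_prolong[OF \<mu>(1) l] pointwise)
      ultimately show ?thesis using True by (simp add: diag_def l_def)
    qed (use n in \<open>simp add: Nk_def\<close>)
  qed
  then obtain \<alpha> \<nu> where f: "\<alpha> \<in> Mor \<Lambda>" "\<nu> \<in> Mor \<Lambda>" "sc \<Lambda> \<alpha> = rg \<Lambda> \<nu>" "cmp \<Lambda> \<alpha> \<nu> = ?\<mu>" "deg \<Lambda> \<alpha> = n"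
    using factorization_exists[of ?\<mu> n] \<mu>'(1) n by (metis F_iff)
  have \<nu>: "\<nu> \<in> F l" using f \<mu>'(1) sc_cmp[OF f(1-3)] by (simp add: F_iff)
  show "\<exists>\<alpha> y. \<alpha> \<in> Mor \<Lambda> \<and> y \<in> X \<and> sc \<Lambda> \<alpha> = ran y \<and> act \<alpha> y = c \<and> deg \<Lambda> \<alpha> = n"
    using f \<nu> \<mu>' act_path_class[OF f(1) \<nu> f(3)]
    by (intro exI[of _ \<alpha>] exI[of _ "path_class l \<nu>"]) (simp add: ran_path_class path_class_X)
next
  fix \<alpha> \<beta> c d assume *: "\<alpha> \<in> Mor \<Lambda>" "\<beta> \<in> Mor \<Lambda>" "c \<in> X" "d \<in> X" "sc \<Lambda> \<alpha> = ran c" "sc \<Lambda> \<beta> = ran d"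
    "act \<alpha> c = act \<beta> d" "deg \<Lambda> \<alpha> = deg \<Lambda> \<beta>"
  obtain l \<mu> \<nu> where m: "\<mu> \<in> F l" "\<nu> \<in> F l" "c = path_class l \<mu>" "d = path_class l \<nu>" using X_common_stage *(3,4) by blast
  have s: "sc \<Lambda> \<alpha> = rg \<Lambda> \<mu>" "sc \<Lambda> \<beta> = rg \<Lambda> \<nu>" using * m by (auto simp: ran_path_class)
  have "path_class l (cmp \<Lambda> \<alpha> \<mu>) = path_class l (cmp \<Lambda> \<beta> \<nu>)" using *(1,2,7) m s by (simp add: act_path_class)
  then have "cmp \<Lambda> \<alpha> \<mu> = cmp \<Lambda> \<beta> \<nu>" using *(1,2) m s prolong_cmp(1) path_class_inj by blast
  then have "\<alpha> = \<beta> \<and> \<mu> = \<nu>" using factorization_unique[of \<alpha> \<mu> \<beta> \<nu>] *(1,2,8) m s by (simp add: F_iff)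
  then show "\<alpha> = \<beta> \<and> c = d" using m by simp
next
  fix v assume v: "v \<in> vertices \<Lambda>"
  have "seg 0 0 \<in> vertices \<Lambda>" using rg_seg[of 0 0] seg_Mor[of 0 0] by (simp add: vertices_eq)
  then obtain \<alpha> where "\<alpha> \<in> Mor \<Lambda>" "rg \<Lambda> \<alpha> = v" "sc \<Lambda> \<alpha> = seg 0 0"
    using strongly_connected v unfolding strongly_connected_def by blast
  then show "\<exists>c\<in>X. ran c = v" by (intro bexI[of _ "path_class 0 \<alpha>"]) (auto simp: ran_path_class path_class_X F_iff)
qed

section \<open>The inductive limit as a space of square-summable functions\<close>

lemma ell2_iff: "f \<in> car (ell2 A) \<longleftrightarrow> (\<forall>a. a \<notin> A \<longrightarrow> f a = 0) \<and> (\<exists>\<xi>. coord \<xi> = f)"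
proof -
  have "(\<lambda>a. (cmod (f a))\<^sup>2) summable_on A \<longleftrightarrow> (\<exists>\<xi>. coord \<xi> = f)" if "\<forall>a. a \<notin> A \<longrightarrow> f a = 0"
  proof -
    have "(\<lambda>a. (cmod (f a))\<^sup>2) summable_on A \<longleftrightarrow> (\<lambda>a. (cmod (f a))\<^sup>2) summable_on UNIV"
      by (rule summable_on_cong_neutral) (use that in auto)
    also have "\<dots> \<longleftrightarrow> (\<exists>\<xi>. coord \<xi> = f)"
      using square_summable_coord Abs_l2_inverse[of f] by auto
    finally show ?thesis .
  qed
  then show ?thesis by (auto simp: ell2_def)
qed

text \<open>
  \<open>locate i\<close> and \<open>place i\<close> are the inverse partial injections that identify \<open>F i\<close> with the classes
  that have a representative at stage \<open>i\<close>.
\<close>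

definition locate :: "nat \<Rightarrow> (nat \<times> 'm) set \<Rightarrow> 'm option" where
  "locate i c = (if \<exists>\<mu>\<in>F i. path_class i \<mu> = c then Some (THE \<mu>. \<mu> \<in> F i \<and> path_class i \<mu> = c) else None)"

definition place :: "nat \<Rightarrow> 'm \<Rightarrow> (nat \<times> 'm) set option" where
  "place i \<mu> = (if \<mu> \<in> F i then Some (path_class i \<mu>) else None)"

lemma locate_path_class: "\<mu> \<in> F i \<Longrightarrow> locate i (path_class i \<mu>) = Some \<mu>"
proof -
  assume \<mu>: "\<mu> \<in> F i"
  then have "(THE \<nu>. \<nu> \<in> F i \<and> path_class i \<nu> = path_class i \<mu>) = \<mu>" by (intro the_equality) (auto simp: path_class_inj)
  then show ?thesis using \<mu> by (auto simp: locate_def)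
qed

lemma locate_iff: "locate i c = Some \<mu> \<longleftrightarrow> \<mu> \<in> F i \<and> path_class i \<mu> = c"
proof
  assume l: "locate i c = Some \<mu>"
  then obtain \<nu> where "\<nu> \<in> F i" "path_class i \<nu> = c" by (auto simp: locate_def split: if_splits)
  then show "\<mu> \<in> F i \<and> path_class i \<mu> = c" using l locate_path_class by force
qed (use locate_path_class in auto)

lemma locate_place: "locate i c = Some \<mu> \<longleftrightarrow> place i \<mu> = Some c"
  by (auto simp: locate_iff place_def)

lemma partial_injection_stage: "partial_injection (locate i)" "partial_injection (place i)"
  by (rule partial_injectionI[of _ "place i"], simp add: locate_place,
      rule partial_injectionI[of _ "locate i"], simp add: locate_place)

text \<open>
  The canonical isometry of the direct limit into the square-summable functions on classes.
\<close>

definition \<Theta> :: "nat \<times> ('m \<Rightarrow> complex) \<Rightarrow> (nat \<times> 'm) set l2" where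
  "\<Theta> = (\<lambda>(i, f). pull (locate i) (Abs_l2 f))"

lemma coord_\<Theta>:
  assumes "f \<in> car (ell2 (F i))"
  shows "coord (\<Theta> (i, f)) c = (case locate i c of None \<Rightarrow> 0 | Some \<mu> \<Rightarrow> f \<mu>)"
proof -
  have "coord (Abs_l2 f) = f" using assms by (metis ell2_iff coord_inverse)
  then show ?thesis
    by (simp add: \<Theta>_def coord_pull[OF partial_injection_stage(1)] split: option.split)
qed

lemma cinner_\<Theta>:
  assumes f: "f \<in> car (ell2 (F i))" and g: "g \<in> car (ell2 (F i))"
  shows "cinner (\<Theta> (i, f)) (\<Theta> (i, g)) = ip (ell2 (F i)) f g"
proof -
  have c: "coord (Abs_l2 f) = f" "coord (Abs_l2 g) = g" using f g by (metis ell2_iff coord_inverse)+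
  have z: "g \<mu> = 0" "f \<mu> = 0" if "\<mu> \<notin> F i" for \<mu> using f g that by (auto simp: ell2_iff)
  have "pull (place i) (\<Theta> (i, g)) = Abs_l2 g"
    by (rule l2_eqI) (auto simp: coord_pull[OF partial_injection_stage(2)] coord_\<Theta>[OF g] place_def
        locate_path_class c z)
  then have "cinner (\<Theta> (i, f)) (\<Theta> (i, g)) = cinner (Abs_l2 f) (Abs_l2 g)"
    using cinner_pull[OF locate_place[of i], where \<xi> = "Abs_l2 f" and \<eta> = "\<Theta> (i, g)"] by (simp add: \<Theta>_def)
  also have "\<dots> = (\<Sum>\<^sub>\<infinity>\<mu>\<in>F i. f \<mu> * cnj (g \<mu>))"
    unfolding cinner.rep_eq c by (rule infsum_cong_neutral) (auto simp: z)
  finally show ?thesis by (simp add: ell2_def)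
qed

lemma shift_isometry_apply:
  assumes "f \<in> car (ell2 (F i))"
  shows "\<mu> \<in> F i \<Longrightarrow> shift_isometry k \<Lambda> x i f (prolong i (Suc i) \<mu>) = f \<mu>"
    and "\<nu> \<notin> prolong i (Suc i) ` F i \<Longrightarrow> shift_isometry k \<Lambda> x i f \<nu> = 0"
proof -
  have e: "cmp \<Lambda> \<alpha> (segment k x i) = prolong i (Suc i) \<alpha>" for \<alpha> by (simp add: prolong_def seg_def segment_def)
  show "shift_isometry k \<Lambda> x i f (prolong i (Suc i) \<mu>) = f \<mu>" if "\<mu> \<in> F i"
  proof -
    have "{\<alpha>. \<alpha> \<in> F i \<and> prolong i (Suc i) \<alpha> = prolong i (Suc i) \<mu>} = {\<mu>}"
      using that prolong_inj[of _ i \<mu> "Suc i"] by auto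
    then show ?thesis by (simp add: shift_isometry_def e)
  qed
  show "shift_isometry k \<Lambda> x i f \<nu> = 0" if "\<nu> \<notin> prolong i (Suc i) ` F i"
  proof -
    have "{\<alpha>. \<alpha> \<in> F i \<and> prolong i (Suc i) \<alpha> = \<nu>} = {}" using that by auto
    then show ?thesis by (simp only: shift_isometry_def e sum.empty)
  qed
qed

text \<open>
  A path and its prolongation have the same class.
\<close>

lemma \<Theta>_shift:
  assumes f: "f \<in> car (ell2 (F i))"
  shows "shift_isometry k \<Lambda> x i f \<in> car (ell2 (F (Suc i))) \<and> \<Theta> (Suc i, shift_isometry k \<Lambda> x i f) = \<Theta> (i, f)"
proof
  let ?g = "shift_isometry k \<Lambda> x i f"
  note s = shift_isometry_apply[OF f]
  have "coord (pull (place (Suc i)) (\<Theta> (i, f))) = ?g"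
  proof
    fix \<nu>
    show "coord (pull (place (Suc i)) (\<Theta> (i, f))) \<nu> = ?g \<nu>"
    proof (cases "\<nu> \<in> prolong i (Suc i) ` F i")
      case True
      then obtain \<mu> where \<mu>: "\<mu> \<in> F i" "\<nu> = prolong i (Suc i) \<mu>" by blast
      then have "\<nu> \<in> F (Suc i)" "path_class (Suc i) \<nu> = path_class i \<mu>" by (auto simp: prolong_F path_class_prolong)
      then show ?thesis using \<mu> s(1)
        by (simp add: coord_pull[OF partial_injection_stage(2)] place_def coord_\<Theta>[OF f] locate_path_class)
    next
      case False
      have "locate i (path_class (Suc i) \<nu>) = None" if \<nu>: "\<nu> \<in> F (Suc i)"
      proof (rule ccontr)
        assume "locate i (path_class (Suc i) \<nu>) \<noteq> None"
        then obtain \<mu> where "\<mu> \<in> F i" "path_class i \<mu> = path_class (Suc i) \<nu>" by (auto simp: locate_iff)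
        then have "prolong i (Suc i) \<mu> = \<nu>" using \<nu> path_class_eq_iff[of \<mu> i \<nu> "Suc i" "Suc i"] by (simp add: prolong_same)
        then show False using False \<open>\<mu> \<in> F i\<close> by blast
      qed
      then show ?thesis using s(2)[OF False]
        by (simp add: coord_pull[OF partial_injection_stage(2)] place_def coord_\<Theta>[OF f])
    qed
  qed
  moreover have "?g \<nu> = 0" if "\<nu> \<notin> F (Suc i)" for \<nu>
    using that prolong_F[of _ i "Suc i"] by (intro s(2)) auto
  ultimately show g: "?g \<in> car (ell2 (F (Suc i)))" unfolding ell2_iff by blast
  show "\<Theta> (Suc i, ?g) = \<Theta> (i, f)"
  proof (rule l2_eqI)
    fix c
    show "coord (\<Theta> (Suc i, ?g)) c = coord (\<Theta> (i, f)) c"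
    proof (cases "locate i c")
      case (Some \<mu>)
      then have \<mu>: "\<mu> \<in> F i" "path_class i \<mu> = c" by (auto simp: locate_iff)
      then have "locate (Suc i) c = Some (prolong i (Suc i) \<mu>)" by (simp add: locate_iff prolong_F path_class_prolong)
      then show ?thesis using Some \<mu> s(1) by (simp add: coord_\<Theta>[OF f] coord_\<Theta>[OF g])
    next
      case None
      have "?g \<nu> = 0" if "locate (Suc i) c = Some \<nu>" for \<nu>
      proof (rule s(2))
        show "\<nu> \<notin> prolong i (Suc i) ` F i"
        proof
          assume "\<nu> \<in> prolong i (Suc i) ` F i"
          then obtain \<mu> where "\<mu> \<in> F i" "\<nu> = prolong i (Suc i) \<mu>" by blast
          then have "path_class i \<mu> = c" using that by (simp add: locate_iff path_class_prolong)
          then show False using None \<open>\<mu> \<in> F i\<close> locate_path_class by force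
        qed
      qed
      then show ?thesis using None by (auto simp: coord_\<Theta>[OF f] coord_\<Theta>[OF g] split: option.splits)
    qed
  qed
qed

lemma \<Theta>_push:
  assumes "f \<in> car (ell2 (F i))" "i \<le> m"
  shows "push (shift_isometry k \<Lambda> x) i m f \<in> car (ell2 (F m)) \<and>
    \<Theta> (m, push (shift_isometry k \<Lambda> x) i m f) = \<Theta> (i, f)"
  using assms(2)
proof (induction m rule: dec_induct)
  case base
  then show ?case using assms(1) by (simp add: push_def)
next
  case (step n)
  have "push (shift_isometry k \<Lambda> x) i (Suc n) f = shift_isometry k \<Lambda> x n (push (shift_isometry k \<Lambda> x) i n f)"
    using step(1) by (simp add: push_def)
  then show ?case using \<Theta>_shift step.IH by simp
qed

abbreviation D :: "(nat \<times> ('m \<Rightarrow> complex)) ip_space" where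
  "D \<equiv> direct_limit (\<lambda>i. ell2 (F i)) (shift_isometry k \<Lambda> x)"

lemma car_D: "(i, f) \<in> car D \<longleftrightarrow> f \<in> car (ell2 (F i))"
  by (auto simp: direct_limit_def)

lemma \<Theta>_add:
  assumes f: "f \<in> car (ell2 (F i))" and g: "g \<in> car (ell2 (F i))"
  shows "f + g \<in> car (ell2 (F i)) \<and> \<Theta> (i, f + g) = \<Theta> (i, f) + \<Theta> (i, g)"
proof
  obtain \<xi> \<eta> where "coord \<xi> = f" "coord \<eta> = g" using f g by (auto simp: ell2_iff)
  then have "coord (\<xi> + \<eta>) = f + g" by (auto simp: pointwise)
  then show fg: "f + g \<in> car (ell2 (F i))" using f g unfolding ell2_iff by (auto simp: pointwise)
  show "\<Theta> (i, f + g) = \<Theta> (i, f) + \<Theta> (i, g)"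
    by (rule l2_eqI) (auto simp: coord_\<Theta>[OF f] coord_\<Theta>[OF g] coord_\<Theta>[OF fg] pointwise split: option.splits)
qed

lemma \<Theta>_scale:
  assumes f: "f \<in> car (ell2 (F i))"
  shows "(\<lambda>a. c * f a) \<in> car (ell2 (F i)) \<and> \<Theta> (i, \<lambda>a. c * f a) = scaleC_l2 c (\<Theta> (i, f))"
proof
  obtain \<xi> where "coord \<xi> = f" using f by (auto simp: ell2_iff)
  then have "coord (scaleC_l2 c \<xi>) = (\<lambda>a. c * f a)" by auto
  then show fg: "(\<lambda>a. c * f a) \<in> car (ell2 (F i))" using f unfolding ell2_iff by auto
  show "\<Theta> (i, \<lambda>a. c * f a) = scaleC_l2 c (\<Theta> (i, f))"
    by (rule l2_eqI) (auto simp: coord_\<Theta>[OF f] coord_\<Theta>[OF fg] split: option.splits)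
qed

sublocale hs: hilbert_model D \<Theta>
proof
  fix a b c assume a: "a \<in> car D" and b: "b \<in> car D"
  obtain i f j g where ab: "a = (i, f)" "b = (j, g)" by fastforce
  let ?m = "max i j"
  note f = a[unfolded ab car_D] and g = b[unfolded ab car_D]
  note pf = \<Theta>_push[OF f, of ?m] and pg = \<Theta>_push[OF g, of ?m]
  have eq: "add D a b = (?m, push (shift_isometry k \<Lambda> x) i ?m f + push (shift_isometry k \<Lambda> x) j ?m g)"
    by (simp add: direct_limit_def ab Let_def ell2_def)
  show "add D a b \<in> car D \<and> \<Theta> (add D a b) = \<Theta> a + \<Theta> b"
    unfolding eq car_D using \<Theta>_add[of _ ?m] pf pg by (simp add: ab)
  have "ip D a b = ip (ell2 (F ?m)) (push (shift_isometry k \<Lambda> x) i ?m f) (push (shift_isometry k \<Lambda> x) j ?m g)"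
    by (simp add: direct_limit_def ab Let_def)
  also have "\<dots> = cinner (\<Theta> (?m, push (shift_isometry k \<Lambda> x) i ?m f)) (\<Theta> (?m, push (shift_isometry k \<Lambda> x) j ?m g))"
    by (rule cinner_\<Theta>[symmetric]) (use pf pg in auto)
  finally show "ip D a b = cinner (\<Theta> a) (\<Theta> b)" using pf pg by (simp add: ab)
next
  fix a c assume a: "a \<in> car D"
  obtain i f where ab: "a = (i, f)" by fastforce
  have "scl D c a = (i, \<lambda>z. c * f z)" by (simp add: direct_limit_def ab ell2_def)
  then show "scl D c a \<in> car D \<and> \<Theta> (scl D c a) = scaleC_l2 c (\<Theta> a)"
    using \<Theta>_scale[of f i c] a by (simp add: ab car_D)
next
  have z: "0 \<in> car (ell2 (F 0))" by (auto simp: ell2_def pointwise)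
  have "zer D = (0, 0)" by (simp add: direct_limit_def ell2_def)
  moreover have "\<Theta> (0, 0) = 0" by (rule l2_eqI) (auto simp: coord_\<Theta>[OF z] pointwise split: option.splits)
  ultimately show "zer D \<in> car D \<and> \<Theta> (zer D) = 0" using z by (simp add: car_D)
qed

lemma path_space_eq: "path_space k \<Lambda> x = hs.H"
  by (simp add: path_space_def hilbert_limit_def)

lemma path_vector_limit:
  assumes "\<mu> \<in> F i"
  shows "path_vector k \<Lambda> x i \<mu> \<in> car hs.H" "hs.limit_of (path_vector k \<Lambda> x i \<mu>) = basis_l2 (path_class i \<mu>)"
proof -
  have b: "ell2_basis \<mu> \<in> car (ell2 (F i))"
  proof -
    have "coord (basis_l2 \<mu>) = ell2_basis \<mu>" by (auto simp: coord_basis ell2_basis_def)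
    then show ?thesis using assms unfolding ell2_iff by (auto simp: ell2_basis_def)
  qed
  have "\<Theta> (i, ell2_basis \<mu>) = basis_l2 (path_class i \<mu>)"
    by (rule l2_eqI, unfold coord_\<Theta>[OF b])
       (use assms in \<open>auto simp: coord_basis ell2_basis_def locate_iff locate_path_class split: option.splits\<close>)
  then have l: "(\<lambda>n::nat. \<Theta> (i, ell2_basis \<mu>)) \<longlonglongrightarrow> basis_l2 (path_class i \<mu>)" by simp
  show "path_vector k \<Lambda> x i \<mu> \<in> car hs.H" "hs.limit_of (path_vector k \<Lambda> x i \<mu>) = basis_l2 (path_class i \<mu>)"
    unfolding path_vector_def limit_map_def hs.car_H using hs.class_limit[OF _ l] b by (simp_all add: car_D)
qed

lemma image_path_space: "hs.limit_of ` car hs.H = supported X"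
proof
  have "\<Theta> a \<in> supported X" if "a \<in> car D" for a
  proof -
    obtain i f where a: "a = (i, f)" by fastforce
    then have f: "f \<in> car (ell2 (F i))" using that by (simp add: car_D)
    show ?thesis unfolding supported_def a
      by (auto simp: coord_\<Theta>[OF f] locate_iff intro: path_class_X split: option.splits)
  qed
  then show "hs.limit_of ` car hs.H \<subseteq> supported X"
    unfolding hs.image_H by (intro closure_minimal closed_supported) auto
  show "supported X \<subseteq> hs.limit_of ` car hs.H"
  proof (rule supported_in_closed_span[OF hs.closed_image_H])
    show "0 \<in> hs.limit_of ` car hs.H" using hs.zer_H by (intro image_eqI[of _ _ "zer hs.H"]) auto
    show "\<xi> + \<eta> \<in> hs.limit_of ` car hs.H" if xe: "\<xi> \<in> hs.limit_of ` car hs.H" "\<eta> \<in> hs.limit_of ` car hs.H" for \<xi> \<eta>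
    proof -
      obtain v w where "v \<in> car hs.H" "\<xi> = hs.limit_of v" "w \<in> car hs.H" "\<eta> = hs.limit_of w"
        using xe by blast
      then show ?thesis using hs.add_H[of v w] by (intro image_eqI[of _ _ "add hs.H v w"]) auto
    qed
    fix c y assume "y \<in> X"
    then obtain i \<mu> where \<mu>: "\<mu> \<in> F i" "y = path_class i \<mu>" by (auto simp: X_def)
    show "scaleC_l2 c (basis_l2 y) \<in> hs.limit_of ` car hs.H"
      using path_vector_limit[OF \<mu>(1)] \<mu>(2) hs.scl_H[of "path_vector k \<Lambda> x i \<mu>" c]
      by (intro image_eqI[of _ _ "scl hs.H c (path_vector k \<Lambda> x i \<mu>)"]) auto
  qed
qed

lemma countable_X: "countable X"
proof -
  have "countable (Mor \<Lambda>)" using hrg by (simp add: higher_rank_graph_def)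
  then have "countable ((\<lambda>(i, \<mu>). path_class i \<mu>) ` (UNIV \<times> Mor \<Lambda>))" by simp
  moreover have "X \<subseteq> (\<lambda>(i, \<mu>). path_class i \<mu>) ` (UNIV \<times> Mor \<Lambda>)" by (auto simp: X_def F_iff)
  ultimately show ?thesis by (rule countable_subset[rotated])
qed

lemma separable_path_space: "separable (path_space k \<Lambda> x)"
  unfolding path_space_eq by (rule hs.separable_H[OF countable_X image_path_space])

section \<open>The representation\<close>

sublocale alg: completion_model "free_star_alg (Mor \<Lambda>)" "universal_seminorm (Mor \<Lambda>) (ck_relations k \<Lambda>)" lin_op
proof
  fix a b assume a: "a \<in> FA (Mor \<Lambda>)" and b: "b \<in> FA (Mor \<Lambda>)"
  have "vdiff (free_star_alg (Mor \<Lambda>)) a b = a - b" by (simp add: vdiff_def diff_eq_cscale)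
  then show "universal_seminorm (Mor \<Lambda>) (ck_relations k \<Lambda>) (vdiff (free_star_alg (Mor \<Lambda>)) a b) = norm (lin_op a - lin_op b)"
    using a b by (simp add: universal_seminorm_eq_op_norm lin_op_diff[OF a b])
qed

abbreviation A where "A \<equiv> kgraph_cstar k \<Lambda>"

lemmas A_def = kgraph_cstar_def universal_cstar_def star_completion_def

lemma car_A: "car A = cauchy_class (free_star_alg (Mor \<Lambda>)) (universal_seminorm (Mor \<Lambda>) (ck_relations k \<Lambda>)) `
    cauchy_seqs (free_star_alg (Mor \<Lambda>)) (universal_seminorm (Mor \<Lambda>) (ck_relations k \<Lambda>))"
  by (simp add: A_def)

lemmas rep_A = alg.rep_in[folded car_A] and class_A = alg.class_limit[folded car_A]

lemma apply_tendsto: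
  assumes "Z \<in> car A"
  shows "(\<lambda>n. lin_op (rep Z n) \<xi>) \<longlonglongrightarrow> alg.limit_of Z \<xi>"
  by (intro blinfun.tendsto rep_A(3)[OF assms] tendsto_const)

text \<open>
  Complex linearity and the range condition are closed under limits of operators.
\<close>

lemma compatible_limit:
  assumes Z: "Z \<in> car A"
  shows "hs.compatible_op (alg.limit_of Z)"
  unfolding hs.compatible_op_def image_path_space
proof (intro conjI allI)
  fix c \<xi>
  have "(\<lambda>n. lin_op (rep Z n) (scaleC_l2 c \<xi>)) \<longlonglongrightarrow> scaleC_l2 c (alg.limit_of Z \<xi>)"
    using bounded_linear.tendsto[OF bounded_linear_scaleC apply_tendsto[OF Z]]
    by (simp add: lin_op_scaleC[OF rep_A(4)[OF Z]])
  then show "alg.limit_of Z (scaleC_l2 c \<xi>) = scaleC_l2 c (alg.limit_of Z \<xi>)"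
    by (rule LIMSEQ_unique[OF apply_tendsto[OF Z]])
  show "alg.limit_of Z \<xi> \<in> supported X"
    by (rule closed_sequentially[OF closed_supported _ apply_tendsto[OF Z]]) (rule lin_op_supported[OF rep_A(4)[OF Z]])
qed

lemma limit_add:
  assumes Y: "Y \<in> car A" and Z: "Z \<in> car A"
  shows "add A Y Z \<in> car A" "alg.limit_of (add A Y Z) = alg.limit_of Y + alg.limit_of Z"
proof -
  note y = rep_A(4)[OF Y] and z = rep_A(4)[OF Z]
  have eq: "add A Y Z = cauchy_class (free_star_alg (Mor \<Lambda>)) (universal_seminorm (Mor \<Lambda>) (ck_relations k \<Lambda>))
      (\<lambda>n. rep Y n + rep Z n)" by (simp add: A_def)
  have l: "(\<lambda>n. lin_op (rep Y n + rep Z n)) \<longlonglongrightarrow> alg.limit_of Y + alg.limit_of Z"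
    using tendsto_add[OF rep_A(3)[OF Y] rep_A(3)[OF Z]] by (simp add: lin_op_add[OF y z])
  show "add A Y Z \<in> car A" "alg.limit_of (add A Y Z) = alg.limit_of Y + alg.limit_of Z"
    unfolding eq using class_A[OF _ l] y z by blast+
qed

lemma limit_mul:
  assumes Y: "Y \<in> car A" and Z: "Z \<in> car A"
  shows "mul A Y Z \<in> car A" "alg.limit_of (mul A Y Z) = alg.limit_of Y o\<^sub>L alg.limit_of Z"
proof -
  note y = rep_A(4)[OF Y] and z = rep_A(4)[OF Z]
  have eq: "mul A Y Z = cauchy_class (free_star_alg (Mor \<Lambda>)) (universal_seminorm (Mor \<Lambda>) (ck_relations k \<Lambda>))
      (\<lambda>n. fmul (rep Y n) (rep Z n))" by (simp add: A_def)
  have l: "(\<lambda>n. lin_op (fmul (rep Y n) (rep Z n))) \<longlonglongrightarrow> (alg.limit_of Y o\<^sub>L alg.limit_of Z)"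
    using bounded_bilinear.tendsto[OF bounded_bilinear_blinfun_compose rep_A(3)[OF Y] rep_A(3)[OF Z]]
    by (simp add: lin_op_fmul[OF y z])
  show "mul A Y Z \<in> car A" "alg.limit_of (mul A Y Z) = alg.limit_of Y o\<^sub>L alg.limit_of Z"
    unfolding eq using class_A[OF _ l] y z by blast+
qed

lemma limit_scl:
  assumes Z: "Z \<in> car A"
  shows "scl A c Z \<in> car A" "alg.limit_of (scl A c Z) = scaleC_op c o\<^sub>L alg.limit_of Z"
proof -
  note z = rep_A(4)[OF Z]
  have eq: "scl A c Z = cauchy_class (free_star_alg (Mor \<Lambda>)) (universal_seminorm (Mor \<Lambda>) (ck_relations k \<Lambda>))
      (\<lambda>n. cscale c (rep Z n))" by (simp add: A_def)
  have l: "(\<lambda>n. lin_op (cscale c (rep Z n))) \<longlonglongrightarrow> (scaleC_op c o\<^sub>L alg.limit_of Z)"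
    using bounded_bilinear.tendsto[OF bounded_bilinear_blinfun_compose tendsto_const rep_A(3)[OF Z]]
    by (simp add: lin_op_cscale[OF z])
  show "scl A c Z \<in> car A" "alg.limit_of (scl A c Z) = scaleC_op c o\<^sub>L alg.limit_of Z"
    unfolding eq using class_A[OF _ l] z by blast+
qed

lemma limit_star:
  assumes Z: "Z \<in> car A"
  shows "star A Z \<in> car A"
    "cinner (alg.limit_of Z \<xi>) \<eta> = cinner \<xi> (alg.limit_of (star A Z) \<eta>)"
proof -
  note z = rep_A(4)[OF Z]
  have eq: "star A Z = cauchy_class (free_star_alg (Mor \<Lambda>)) (universal_seminorm (Mor \<Lambda>) (ck_relations k \<Lambda>))
      (\<lambda>n. fstar (rep Z n))" by (simp add: A_def)
  have iso: "norm (lin_op (fstar (rep Z m)) - lin_op (fstar (rep Z n))) = norm (lin_op (rep Z m) - lin_op (rep Z n))" for m n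
    using norm_lin_op_fstar[of "rep Z m - rep Z n" "Mor \<Lambda>"] z[of m] z[of n]
    by (simp add: lin_op_diff[where G = "Mor \<Lambda>"])
  have "Cauchy (\<lambda>n. lin_op (rep Z n))" by (rule LIMSEQ_imp_Cauchy[OF rep_A(3)[OF Z]])
  then have "Cauchy (\<lambda>n. lin_op (fstar (rep Z n)))" unfolding Cauchy_iff iso .
  then obtain S where l: "(\<lambda>n. lin_op (fstar (rep Z n))) \<longlonglongrightarrow> S" using Cauchy_convergent convergent_def by blast
  have star: "star A Z \<in> car A" "alg.limit_of (star A Z) = S"
    unfolding eq using class_A[OF _ l] z by blast+
  show "star A Z \<in> car A" by (rule star)
  have "(\<lambda>n. cinner (lin_op (rep Z n) \<xi>) \<eta>) \<longlonglongrightarrow> cinner (alg.limit_of Z \<xi>) \<eta>"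
    by (intro tendsto_cinner apply_tendsto Z tendsto_const)
  moreover have "(\<lambda>n. cinner (lin_op (rep Z n) \<xi>) \<eta>) \<longlonglongrightarrow> cinner \<xi> (blinfun_apply S \<eta>)"
    unfolding cinner_lin_op[OF z] by (intro tendsto_cinner blinfun.tendsto l tendsto_const)
  ultimately show "cinner (alg.limit_of Z \<xi>) \<eta> = cinner \<xi> (alg.limit_of (star A Z) \<eta>)"
    unfolding star(2) by (rule LIMSEQ_unique)
qed

definition \<pi> where "\<pi> Z = hs.conj_op (alg.limit_of Z)"

lemma representation_\<pi>: "representation A (path_space k \<Lambda> x) \<pi>"
  unfolding representation_def star_hom_def path_space_eq \<pi>_def
proof (intro conjI ballI allI funcsetI)
  fix Y Z assume Y: "Y \<in> car A" and Z: "Z \<in> car A"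
  note g = compatible_limit[OF Y] compatible_limit[OF Z]
  show "hs.conj_op (alg.limit_of (add A Y Z)) =
      add (bounded_ops hs.H) (hs.conj_op (alg.limit_of Y)) (hs.conj_op (alg.limit_of Z))"
    using hs.conj_op_add[OF g] compatible_limit[OF limit_add(1)[OF Y Z]] by (simp add: limit_add[OF Y Z])
  show "hs.conj_op (alg.limit_of (mul A Y Z)) =
      mul (bounded_ops hs.H) (hs.conj_op (alg.limit_of Y)) (hs.conj_op (alg.limit_of Z))"
    using hs.conj_op_mul[OF g] compatible_limit[OF limit_mul(1)[OF Y Z]] by (simp add: limit_mul[OF Y Z])
next
  fix Z c assume Z: "Z \<in> car A"
  show "hs.conj_op (alg.limit_of Z) \<in> car (bounded_ops hs.H)" by (rule hs.conj_op_bounded[OF compatible_limit[OF Z]])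
  show "hs.conj_op (alg.limit_of (scl A c Z)) = scl (bounded_ops hs.H) c (hs.conj_op (alg.limit_of Z))"
    using hs.conj_op_scaleC[OF compatible_limit[OF Z]] compatible_limit[OF limit_scl(1)[OF Z, of c]] by (simp add: limit_scl[OF Z])
  show "hs.conj_op (alg.limit_of (star A Z)) = star (bounded_ops hs.H) (hs.conj_op (alg.limit_of Z))"
    by (rule hs.star_conj_op[OF compatible_limit[OF Z] compatible_limit[OF limit_star(1)[OF Z]] limit_star(2)[OF Z], symmetric])
qed

text \<open>
  An element of \<open>C\<^sup>*(\<Lambda>)\<close> is determined by its limit operator on all square-summable functions. Its
  representative on \<open>\<H>\<^sub>x\<close> only sees functions supported in \<open>X\<close>, but limit operators vanish on basis
  vectors outside \<open>X\<close>.
\<close>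

lemma faithful_\<pi>: "faithful A \<pi>"
  unfolding faithful_def
proof (rule inj_onI)
  fix Y Z assume Y: "Y \<in> car A" and Z: "Z \<in> car A" and eq: "\<pi> Y = \<pi> Z"
  have inside: "alg.limit_of Y \<xi> = alg.limit_of Z \<xi>" if \<xi>: "\<xi> \<in> supported X" for \<xi>
  proof -
    obtain v where v: "v \<in> car hs.H" "\<xi> = hs.limit_of v" using \<xi> unfolding image_path_space[symmetric] by blast
    show ?thesis
      using hs.conj_op_in(2)[OF compatible_limit[OF Y] v(1)] hs.conj_op_in(2)[OF compatible_limit[OF Z] v(1)] eq
      by (simp add: \<pi>_def v(2))
  qed
  have outside: "alg.limit_of W (basis_l2 c) = 0" if W: "W \<in> car A" and c: "c \<notin> X" for W c
    by (rule LIMSEQ_unique[OF apply_tendsto[OF W]]) (simp add: lin_op_outside[OF rep_A(4)[OF W] c])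
  let ?E = "{\<xi>. alg.limit_of Y \<xi> = alg.limit_of Z \<xi>}"
  have "supported UNIV \<subseteq> ?E"
  proof (rule supported_in_closed_span)
    show "closed ?E" by (intro closed_Collect_eq blinfun.continuous_on continuous_on_const continuous_on_id)
    show "scaleC_l2 c (basis_l2 y) \<in> ?E" for c y
    proof (cases "y \<in> X")
      case True
      then have "scaleC_l2 c (basis_l2 y) \<in> supported X" by (auto simp: supported_def coord_basis)
      then show ?thesis using inside by simp
    next
      case False
      then show ?thesis using outside[OF Y False] outside[OF Z False] compatible_limit[OF Y] compatible_limit[OF Z]
        by (simp add: hs.compatible_op_def)
    qed
  qed (auto simp: blinfun.add_right)
  then have "alg.limit_of Y = alg.limit_of Z" by (intro blinfun_eqI) (auto simp: supported_def)
  then show "Y = Z" using alg.limit_of_inj Y Z unfolding car_A by (simp add: inj_onD)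
qed

lemma kgraph_gen_limit:
  assumes "\<alpha> \<in> Mor \<Lambda>"
  shows "kgraph_gen k \<Lambda> \<alpha> \<in> car A" "alg.limit_of (kgraph_gen k \<Lambda> \<alpha>) = lin_op (fgen \<alpha>)"
  unfolding kgraph_gen_def universal_gen_def
  using class_A[of "\<lambda>_. fgen \<alpha>" "lin_op (fgen \<alpha>)"] assms by simp_all

lemma is_path_operator_\<pi>:
  assumes \<alpha>: "\<alpha> \<in> Mor \<Lambda>"
  shows "is_path_operator k \<Lambda> x \<alpha> (\<pi> (kgraph_gen k \<Lambda> \<alpha>))"
  unfolding is_path_operator_def path_space_eq
proof (intro conjI allI ballI)
  note g = compatible_limit[OF kgraph_gen_limit(1)[OF \<alpha>]]
  show "\<pi> (kgraph_gen k \<Lambda> \<alpha>) \<in> car (bounded_ops hs.H)" unfolding \<pi>_def by (rule hs.conj_op_bounded[OF g])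
  fix i \<mu> assume \<mu>: "\<mu> \<in> F i"
  note v = path_vector_limit[OF \<mu>]
  have lim: "hs.limit_of (\<pi> (kgraph_gen k \<Lambda> \<alpha>) (path_vector k \<Lambda> x i \<mu>)) =
      (if sc \<Lambda> \<alpha> = rg \<Lambda> \<mu> then basis_l2 (path_class i (cmp \<Lambda> \<alpha> \<mu>)) else 0)"
    unfolding \<pi>_def hs.conj_op_in(2)[OF g v(1)]
    using \<alpha> \<mu> by (simp add: v(2) kgraph_gen_limit lin_op_gen_basis path_class_X ran_path_class act_path_class)
  show "\<pi> (kgraph_gen k \<Lambda> \<alpha>) (path_vector k \<Lambda> x i \<mu>) =
      (if sc \<Lambda> \<alpha> = rg \<Lambda> \<mu> then path_vector k \<Lambda> x i (cmp \<Lambda> \<alpha> \<mu>) else zer hs.H)"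
  proof (rule hs.H_eqI)
    show "\<pi> (kgraph_gen k \<Lambda> \<alpha>) (path_vector k \<Lambda> x i \<mu>) \<in> car hs.H" unfolding \<pi>_def by (rule hs.conj_op_in(1)[OF g v(1)])
  qed (use lim prolong_cmp(1)[OF \<alpha> \<mu> _ order_refl] path_vector_limit hs.zer_H in auto)
qed

lemma is_path_operator_unique:
  assumes "\<alpha> \<in> Mor \<Lambda>" "is_path_operator k \<Lambda> x \<alpha> S" "is_path_operator k \<Lambda> x \<alpha> T"
  shows "S = T"
proof (rule hs.bounded_ops_eq_on_generators)
  let ?B = "{path_vector k \<Lambda> x i \<mu> | i \<mu>. \<mu> \<in> F i}"
  show "S \<in> car (bounded_ops hs.H)" "T \<in> car (bounded_ops hs.H)"
    using assms by (auto simp: is_path_operator_def path_space_eq)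
  show "?B \<subseteq> car hs.H" using path_vector_limit by auto
  show "hs.limit_of ` ?B = basis_l2 ` X"
  proof (intro equalityI subsetI)
    fix \<xi> assume "\<xi> \<in> basis_l2 ` X"
    then obtain i \<mu> where \<mu>: "\<mu> \<in> F i" "\<xi> = basis_l2 (path_class i \<mu>)" by (auto simp: X_def)
    then show "\<xi> \<in> hs.limit_of ` ?B"
      by (intro image_eqI[of _ _ "path_vector k \<Lambda> x i \<mu>"]) (auto simp: path_vector_limit)
  qed (auto simp: path_vector_limit path_class_X)
  show "hs.limit_of ` car hs.H \<subseteq> supported X" by (simp add: image_path_space)
  show "S v = T v" if "v \<in> ?B" for v using that assms(2,3) by (auto simp: is_path_operator_def)
qed

end

theorem proposition5p1:
  fixes k :: nat and \<Lambda> :: "'m kgraph" and x :: "(nat \<Rightarrow> nat) \<times> (nat \<Rightarrow> nat) \<Rightarrow> 'm"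
  assumes "higher_rank_graph k \<Lambda>"
    and "row_finite k \<Lambda>"
    and "strongly_connected \<Lambda>"
    and "x \<in> infinite_paths k \<Lambda>"
  shows "\<exists>T. (\<forall>\<alpha>\<in>Mor \<Lambda>. is_path_operator k \<Lambda> x \<alpha> (T \<alpha>)
              \<and> (\<forall>S. is_path_operator k \<Lambda> x \<alpha> S \<longrightarrow> S = T \<alpha>))
           \<and> (\<exists>\<pi>. representation (kgraph_cstar k \<Lambda>) (path_space k \<Lambda> x) \<pi>
                \<and> (\<forall>\<alpha>\<in>Mor \<Lambda>. \<pi> (kgraph_gen k \<Lambda> \<alpha>) = T \<alpha>)
                \<and> faithful (kgraph_cstar k \<Lambda>) \<pi>
                \<and> separable (path_space k \<Lambda> x))"
proof -
  interpret infinite_path k \<Lambda> x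
    by unfold_locales (use assms in auto)
  show ?thesis
    using is_path_operator_\<pi> is_path_operator_unique representation_\<pi> faithful_\<pi> separable_path_space
    by (intro exI[of _ "\<lambda>\<alpha>. \<pi> (kgraph_gen k \<Lambda> \<alpha>)"] conjI exI[of _ \<pi>]) auto
qed

end
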